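(* The one-to-one correspondence $(H,u)\leftrightarrow(\mathcal{H},g)$ between isomorphism classes of Hopf algebras with a grouplike element of square $1$ and isomorphism classes of Hopf superalgebras with a grouplike element of square $1$ acting by parity (described in the context) extends to a one-to-one correspondence between: (1) isomorphism classes of (ordinary) triangular Hopf algebras $H$ over $\mathbb{C}$ whose Drinfeld element $u$ satisfies $u^2=1$ (the grouplike element attached to $H$ being its Drinfeld element $u$); and (2) isomorphism classes of pairs $(\mathcal{H},g)$ where $\mathcal{H}$ is a triangular Hopf superalgebra over $\mathbb{C}$ with Drinfeld element $1$ and $g$ is a grouplike element of $\mathcal{H}$ such that $g^2=1$ and $gxg^{-1}=(-1)^{p(x)}x$ for all homogeneous $x\in\mathcal{H}$.
   Context: The ground field is $\mathbb{C}$. Supervector spaces are $\mathbb{Z}_2$-graded vector spaces with parity $p$ and commutativity constraint $\beta(v\otimes w)=(-1)^{p(v)p(w)}w\otimes v$. A Hopf superalgebra is a Hopf algebra in this symmetric tensor category; in particular the product on $\mathcal{H}\otimes\mathcal{H}$ is $(a\otimes b)(a'\otimes b')=(-1)^{p(a')p(b)}aa'\otimes bb'$. A triangular Hopf superalgebra $(\mathcal{H},\mathcal{R})$ is a Hopf superalgebra with an even $\mathcal{R}\in\mathcal{H}\otimes\mathcal{H}$ satisfying the usual triangularity axioms interpreted in this category (in particular $\mathcal{R}\mathcal{R}_{21}=1$ with $\mathcal{R}_{21}=\beta(\mathcal{R})$). Its Drinfeld element is $m\circ\beta\circ(\mathrm{Id}\otimes S)(\mathcal{R})$. For an ordinary triangular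 Hopf algebra $(H,R)$ the Drinfeld element is given by the same formula with $\beta$ replaced by the flip. The underlying correspondence of pairs: given an ordinary Hopf algebra $H$ and a grouplike $u\in H$ with $u^2=1$, put $\mathcal{H}=H$ as an algebra, graded by the adjoint action of $u$ (so $uxu^{-1}=(-1)^{p(x)}x$), and $g=u$. Write $\Delta(h)=\Delta_0(h)+\Delta_1(h)$ with $\Delta_i(h)\in H\otimes H_i$, and set $\tilde\Delta(h)=\Delta_0(h)-(-1)^{p(h)}(u\otimes 1)\Delta_1(h)$, $\tilde S(h)=u^{p(h)}S(h)$, same counit. Then $(\mathcal{H},\tilde\Delta,\varepsilon,\tilde S)$ is a Hopf superalgebra. The inverse is given by the same formulas: $\Delta(h)=\tilde\Delta_0(h)-(-1)^{p(h)}(g\otimes 1)\tilde\Delta_1(h)$, $S(h)=g^{p(h)}\tilde S(h)$, $u=g$. *)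

theory Defs
  imports Complex_Main "HOL-Library.Z2" "HOL-Library.Poly_Mapping"
begin

section \<open>Complex vector spaces\<close>

text \<open>
  A complex vector space of arbitrary dimension is a type of the following class. The Hopf
  (super)algebras below are structures on such a type, so a theorem with a free type variable of
  this class speaks about Hopf (super)algebras on every complex vector space.
\<close>

class complex_vector = ab_group_add +
  fixes scaleC :: "complex \<Rightarrow> 'a \<Rightarrow> 'a" (infixr \<open>*\<^sub>C\<close> 75)
  assumes scaleC_add_right: "c *\<^sub>C (x + y) = c *\<^sub>C x + c *\<^sub>C y"
    and scaleC_add_left: "(c + d) *\<^sub>C x = c *\<^sub>C x + d *\<^sub>C x"
    and scaleC_scaleC: "c *\<^sub>C d *\<^sub>C x = (c * d) *\<^sub>C x"
    and scaleC_one: "1 *\<^sub>C x = x"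

global_interpretation complex_vector: vector_space "scaleC :: complex \<Rightarrow> 'a \<Rightarrow> 'a::complex_vector"
  by unfold_locales (simp_all add: scaleC_add_right scaleC_add_left scaleC_scaleC scaleC_one)

abbreviation clinear :: "('a::complex_vector \<Rightarrow> 'b::complex_vector) \<Rightarrow> bool" where
  "clinear \<equiv> Vector_Spaces.linear scaleC scaleC"

lemma clinearI:
  assumes "\<And>x y. f (x + y) = f x + f y" and "\<And>c x. f (c *\<^sub>C x) = c *\<^sub>C f x"
  shows "clinear f"
  using assms by unfold_locales auto

lemma clinear_add: "clinear f \<Longrightarrow> f (x + y) = f x + f y"
  by (rule module_hom.add[OF module_hom_iff_linear[THEN iffD2]])

lemma clinear_scaleC: "clinear f \<Longrightarrow> f (c *\<^sub>C x) = c *\<^sub>C f x"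
  by (rule module_hom.scale[OF module_hom_iff_linear[THEN iffD2]])

lemma clinear_diff: "clinear f \<Longrightarrow> f (x - y) = f x - f y"
  by (rule module_hom.diff[OF module_hom_iff_linear[THEN iffD2]])

lemma clinear_zero: "clinear f \<Longrightarrow> f 0 = 0"
  by (rule module_hom.zero[OF module_hom_iff_linear[THEN iffD2]])

definition cbilinear :: "('a::complex_vector \<Rightarrow> 'b::complex_vector \<Rightarrow> 'c::complex_vector) \<Rightarrow> bool" where
  "cbilinear B \<longleftrightarrow> (\<forall>a. clinear (\<lambda>b. B a b)) \<and> (\<forall>b. clinear (\<lambda>a. B a b))"

instantiation complex :: complex_vector
begin

definition scaleC_complex :: "complex \<Rightarrow> complex \<Rightarrow> complex" where
  "scaleC_complex c x = c * x"

instance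
  by standard (simp_all add: scaleC_complex_def algebra_simps)

end

instantiation poly_mapping :: (type, complex_vector) complex_vector
begin

lift_definition scaleC_poly_mapping :: "complex \<Rightarrow> ('a \<Rightarrow>\<^sub>0 'b) \<Rightarrow> 'a \<Rightarrow>\<^sub>0 'b"
  is "\<lambda>c f k. c *\<^sub>C f k"
proof -
  fix c :: complex and f :: "'a \<Rightarrow> 'b"
  assume "finite {k. f k \<noteq> 0}"
  then show "finite {k. c *\<^sub>C f k \<noteq> 0}"
    by (rule rev_finite_subset) auto
qed

instance
  by standard
    (transfer; simp add: fun_eq_iff scaleC_add_right scaleC_add_left scaleC_scaleC scaleC_one)+

end


section \<open>Tensor products\<close>

inductive_set tensor_relations :: "('a::complex_vector \<times> 'b::complex_vector \<Rightarrow>\<^sub>0 complex) set" where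
  add_left: "Poly_Mapping.single (a + a', b) 1 - Poly_Mapping.single (a, b) 1
    - Poly_Mapping.single (a', b) 1 \<in> tensor_relations"
| add_right: "Poly_Mapping.single (a, b + b') 1 - Poly_Mapping.single (a, b) 1
    - Poly_Mapping.single (a, b') 1 \<in> tensor_relations"
| scale_left: "Poly_Mapping.single (c *\<^sub>C a, b) 1 - c *\<^sub>C Poly_Mapping.single (a, b) 1
    \<in> tensor_relations"
| scale_right: "Poly_Mapping.single (a, c *\<^sub>C b) 1 - c *\<^sub>C Poly_Mapping.single (a, b) 1
    \<in> tensor_relations"

quotient_type (overloaded) ('a, 'b) tensor (infixr \<open>\<otimes>\<close> 70) = "('a::complex_vector \<times> 'b::complex_vector) \<Rightarrow>\<^sub>0 complex" /
  "\<lambda>p q. p - q \<in> complex_vector.span tensor_relations"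
  morphisms rep_tensor abs_tensor
proof (rule equivpI)
  let ?N = "complex_vector.span (tensor_relations :: ('a \<times> 'b \<Rightarrow>\<^sub>0 complex) set)"
  show "reflp (\<lambda>p q. p - q \<in> ?N)"
    by (rule reflpI) (simp add: complex_vector.span_zero)
  show "symp (\<lambda>p q. p - q \<in> ?N)"
    by (rule sympI) (drule complex_vector.span_neg, simp)
  show "transp (\<lambda>p q. p - q \<in> ?N)"
    by (rule transpI) (drule (1) complex_vector.span_add, simp)
qed

instantiation tensor :: (complex_vector, complex_vector) complex_vector
begin

lift_definition zero_tensor :: "'a \<otimes> 'b" is 0 .

lift_definition plus_tensor :: "'a \<otimes> 'b \<Rightarrow> 'a \<otimes> 'b \<Rightarrow> 'a \<otimes> 'b" is "(+)"
  by (drule (1) complex_vector.span_add) (simp add: algebra_simps)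

lift_definition uminus_tensor :: "'a \<otimes> 'b \<Rightarrow> 'a \<otimes> 'b" is uminus
  by (drule complex_vector.span_neg) simp

lift_definition minus_tensor :: "'a \<otimes> 'b \<Rightarrow> 'a \<otimes> 'b \<Rightarrow> 'a \<otimes> 'b" is "(-)"
  by (drule (1) complex_vector.span_diff) (simp add: algebra_simps)

lift_definition scaleC_tensor :: "complex \<Rightarrow> 'a \<otimes> 'b \<Rightarrow> 'a \<otimes> 'b" is scaleC
  by (drule complex_vector.span_scale) (simp add: complex_vector.scale_right_diff_distrib)

instance
  by standard
    (transfer; simp add: complex_vector.span_zero add.assoc add.commute scaleC_add_right
      scaleC_add_left scaleC_one)+

end

lift_definition tensor :: "'a::complex_vector \<Rightarrow> 'b::complex_vector \<Rightarrow> 'a \<otimes> 'b" (infixr \<open>\<otimes>\<close> 70)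
  is "\<lambda>a b. Poly_Mapping.single (a, b) 1" .

lemma cbilinear_tensor: "cbilinear (\<otimes>)"
  unfolding cbilinear_def
proof (intro conjI allI clinearI)
  show "a \<otimes> (b + b') = a \<otimes> b + a \<otimes> b'" for a :: 'a and b b' :: 'b
    by transfer (simp add: diff_diff_add[symmetric] tensor_relations.add_right complex_vector.span_base)
  show "a \<otimes> (c *\<^sub>C b) = c *\<^sub>C (a \<otimes> b)" for a :: 'a and b :: 'b and c
    by transfer (rule complex_vector.span_base, rule tensor_relations.scale_right)
  show "(a + a') \<otimes> b = a \<otimes> b + a' \<otimes> b" for a a' :: 'a and b :: 'b
    by transfer (simp add: diff_diff_add[symmetric] tensor_relations.add_left complex_vector.span_base)
  show "(c *\<^sub>C a) \<otimes> b = c *\<^sub>C (a \<otimes> b)" for a :: 'a and b :: 'b and c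
    by transfer (rule complex_vector.span_base, rule tensor_relations.scale_left)
qed

definition free_lift ::
  "('a \<Rightarrow> 'b \<Rightarrow> 'c::complex_vector) \<Rightarrow> ('a \<times> 'b \<Rightarrow>\<^sub>0 complex) \<Rightarrow> 'c" where
  "free_lift B p = (\<Sum>(a, b)\<in>Poly_Mapping.keys p. Poly_Mapping.lookup p (a, b) *\<^sub>C B a b)"

lemma lookup_scaleC: "Poly_Mapping.lookup (c *\<^sub>C p) k = c *\<^sub>C Poly_Mapping.lookup p k"
  by transfer simp

lemma free_lift_superset:
  assumes "finite K" "Poly_Mapping.keys p \<subseteq> K"
  shows "free_lift B p = (\<Sum>(a, b)\<in>K. Poly_Mapping.lookup p (a, b) *\<^sub>C B a b)"
  unfolding free_lift_def
  by (rule sum.mono_neutral_left) (use assms in \<open>auto simp: in_keys_iff\<close>)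

lemma free_lift_single [simp]: "free_lift B (Poly_Mapping.single (a, b) c) = c *\<^sub>C B a b"
  by (subst free_lift_superset[where K = "{(a, b)}"]) auto

lemma clinear_free_lift: "clinear (free_lift B)"
proof (rule clinearI)
  fix p q :: "'a \<times> 'b \<Rightarrow>\<^sub>0 complex" and c
  let ?K = "Poly_Mapping.keys p \<union> Poly_Mapping.keys q"
  have "free_lift B (p + q) = (\<Sum>(a, b)\<in>?K. Poly_Mapping.lookup (p + q) (a, b) *\<^sub>C B a b)"
    by (rule free_lift_superset) (simp_all add: Poly_Mapping.keys_add)
  then show "free_lift B (p + q) = free_lift B p + free_lift B q"
    by (simp add: free_lift_superset[where K = ?K] lookup_add scaleC_add_left
        case_prod_unfold sum.distrib)
  have "free_lift B (c *\<^sub>C p) =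
      (\<Sum>(a, b)\<in>Poly_Mapping.keys p. Poly_Mapping.lookup (c *\<^sub>C p) (a, b) *\<^sub>C B a b)"
    by (rule free_lift_superset) (auto simp: in_keys_iff lookup_scaleC)
  then show "free_lift B (c *\<^sub>C p) = c *\<^sub>C free_lift B p"
    by (simp add: free_lift_def lookup_scaleC scaleC_complex_def case_prod_unfold
        complex_vector.scale_sum_right)
qed

lemma free_lift_relations:
  assumes B: "cbilinear B" and r: "r \<in> complex_vector.span tensor_relations"
  shows "free_lift B r = 0"
  using r
proof (induction rule: complex_vector.span_induct_alt)
  case base
  show ?case by (simp add: clinear_zero clinear_free_lift)
next
  case (step c x y)
  have [simp]: "clinear (\<lambda>b. B a b)" "clinear (\<lambda>a. B a b)" for a b
    using B by (simp_all add: cbilinear_def)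
  from step(1) have "free_lift B x = 0"
    by cases (simp_all add: clinear_diff[OF clinear_free_lift] clinear_scaleC[OF clinear_free_lift]
      scaleC_one clinear_add[of "\<lambda>a. B a _"] clinear_add[of "\<lambda>b. B _ b"]
      clinear_scaleC[of "\<lambda>a. B a _"] clinear_scaleC[of "\<lambda>b. B _ b"])
  with step show ?case
    by (simp add: clinear_add[OF clinear_free_lift] clinear_scaleC[OF clinear_free_lift])
qed

lemma poly_mapping_eq_sum:
  "p = (\<Sum>k\<in>Poly_Mapping.keys p. Poly_Mapping.lookup p k *\<^sub>C Poly_Mapping.single k (1::complex))"
  by (rule poly_mapping_eqI)
    (auto simp: lookup_sum lookup_scaleC lookup_single when_def scaleC_complex_def
      in_keys_iff if_distrib cong: if_cong)

lemma span_pure_tensors: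
  "(t :: 'a::complex_vector \<otimes> 'b::complex_vector) \<in> complex_vector.span {a \<otimes> b | a b. True}"
proof (induction t rule: tensor.abs_induct)
  case (1 p)
  have lin: "clinear (abs_tensor :: _ \<Rightarrow> 'a \<otimes> 'b)"
    by (rule clinearI) (simp_all add: plus_tensor.abs_eq scaleC_tensor.abs_eq)
  have "abs_tensor p = abs_tensor
      (\<Sum>k\<in>Poly_Mapping.keys p. Poly_Mapping.lookup p k *\<^sub>C Poly_Mapping.single k (1::complex))"
    by (subst poly_mapping_eq_sum) (rule refl)
  also have "\<dots> =
      (\<Sum>k\<in>Poly_Mapping.keys p. Poly_Mapping.lookup p k *\<^sub>C abs_tensor (Poly_Mapping.single k 1))"
    by (simp add: module_hom.sum[OF module_hom_iff_linear[THEN iffD2, OF lin]] clinear_scaleC[OF lin])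
  also have "\<dots> \<in> complex_vector.span {a \<otimes> b | a b. True}"
  proof (intro complex_vector.span_sum complex_vector.span_scale complex_vector.span_base)
    fix k :: "'a \<times> 'b"
    show "abs_tensor (Poly_Mapping.single k 1) \<in> {a \<otimes> b | a b. True}"
      by (cases k) (auto simp: tensor.abs_eq)
  qed
  finally show ?case .
qed

theorem tensor_universal_property:
  fixes B :: "'a::complex_vector \<Rightarrow> 'b::complex_vector \<Rightarrow> 'c::complex_vector"
  assumes B: "cbilinear B"
  shows "\<exists>!f. clinear f \<and> (\<forall>a b. f (a \<otimes> b) = B a b)"
proof (rule ex1I)
  let ?f = "\<lambda>t. free_lift B (rep_tensor t)"
  have f: "?f (abs_tensor p) = free_lift B p" for p
  proof -
    have "rep_tensor (abs_tensor p) - p \<in> complex_vector.span tensor_relations"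
      by (rule Quotient_rep_abs[OF Quotient_tensor]) (simp add: complex_vector.span_zero)
    then show ?thesis
      using free_lift_relations[OF B] clinear_diff[OF clinear_free_lift] by (metis right_minus_eq)
  qed
  have "clinear ?f"
  proof (rule clinearI)
    fix s t :: "'a \<otimes> 'b" and c
    show "?f (s + t) = ?f s + ?f t"
      by (induction s; induction t) (simp add: plus_tensor.abs_eq f clinear_add[OF clinear_free_lift])
    show "?f (c *\<^sub>C s) = c *\<^sub>C ?f s"
      by (induction s) (simp add: scaleC_tensor.abs_eq f clinear_scaleC[OF clinear_free_lift])
  qed
  then show "clinear ?f \<and> (\<forall>a b. ?f (a \<otimes> b) = B a b)"
    by (simp add: tensor.abs_eq f scaleC_one)
  fix g assume g: "clinear g \<and> (\<forall>a b. g (a \<otimes> b) = B a b)"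
  show "g = ?f"
  proof
    fix t :: "'a \<otimes> 'b"
    show "g t = ?f t"
      using span_pure_tensors[of t]
    proof (induction rule: complex_vector.span_induct_alt)
      case base
      show ?case using g clinear_zero[OF \<open>clinear ?f\<close>] by (simp add: clinear_zero)
    next
      case (step c x y)
      then obtain a b where x: "x = a \<otimes> b" by auto
      have "g x = ?f x" using g by (simp add: x tensor.abs_eq f scaleC_one)
      then show ?case
        using step clinear_add[of g] clinear_scaleC[of g] g
          clinear_add[OF \<open>clinear ?f\<close>] clinear_scaleC[OF \<open>clinear ?f\<close>] by simp
    qed
  qed
qed

definition tensor_lift ::
  "('a::complex_vector \<Rightarrow> 'b::complex_vector \<Rightarrow> 'c::complex_vector) \<Rightarrow> 'a \<otimes> 'b \<Rightarrow> 'c" where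
  "tensor_lift B = (THE f. clinear f \<and> (\<forall>a b. f (a \<otimes> b) = B a b))"

lemma
  assumes "cbilinear B"
  shows clinear_tensor_lift: "clinear (tensor_lift B)"
    and tensor_lift_tensor: "tensor_lift B (a \<otimes> b) = B a b"
  using theI'[OF tensor_universal_property[OF assms]] by (auto simp: tensor_lift_def)

definition tensor_map :: "('a::complex_vector \<Rightarrow> 'c::complex_vector) \<Rightarrow>
    ('b::complex_vector \<Rightarrow> 'd::complex_vector) \<Rightarrow> 'a \<otimes> 'b \<Rightarrow> 'c \<otimes> 'd" where
  "tensor_map f g = tensor_lift (\<lambda>a b. f a \<otimes> g b)"

definition tensor_assoc :: "('a::complex_vector \<otimes> 'b::complex_vector) \<otimes> 'c::complex_vector \<Rightarrow> 'a \<otimes> 'b \<otimes> 'c" where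
  "tensor_assoc = tensor_lift (\<lambda>t c. tensor_lift (\<lambda>a b. a \<otimes> b \<otimes> c) t)"

definition flip :: "'a::complex_vector \<otimes> 'b::complex_vector \<Rightarrow> 'b \<otimes> 'a" where
  "flip = tensor_lift (\<lambda>a b. b \<otimes> a)"

definition tensor_mult ::
  "('a::complex_vector \<Rightarrow> 'a \<Rightarrow> 'a) \<Rightarrow> ('b::complex_vector \<Rightarrow> 'b \<Rightarrow> 'b) \<Rightarrow> 'a \<otimes> 'b \<Rightarrow> 'a \<otimes> 'b \<Rightarrow> 'a \<otimes> 'b" where
  "tensor_mult m m' s t =
    tensor_lift (\<lambda>a b. tensor_lift (\<lambda>a' b'. m a a' \<otimes> m' b b') t) s"


section \<open>Supervector spaces\<close>

type_synonym 'a grading = "bit \<Rightarrow> 'a set"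

definition is_grading :: "'a::complex_vector grading \<Rightarrow> bool" where
  "is_grading G \<longleftrightarrow> (\<forall>i. complex_vector.subspace (G i)) \<and>
    G 0 \<inter> G 1 = {0} \<and> (\<forall>x. \<exists>y\<in>G 0. \<exists>z\<in>G 1. x = y + z)"

text \<open>In \<open>\<int>\<^sub>2\<close> the parity other than \<open>i\<close> is \<open>i + 1\<close>.\<close>

definition component :: "'a::complex_vector grading \<Rightarrow> bit \<Rightarrow> 'a \<Rightarrow> 'a" where
  "component G i x = (THE y. y \<in> G i \<and> x - y \<in> G (i + 1))"

definition parity_sign :: "bit \<Rightarrow> complex" where  \<comment> \<open>\<open>(-1)\<^sup>i\<close>\<close>
  "parity_sign i = (if i = 0 then 1 else - 1)"

definition tensor_grading ::
  "'a::complex_vector grading \<Rightarrow> 'b::complex_vector grading \<Rightarrow> ('a \<otimes> 'b) grading" where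
  "tensor_grading G G' k =
    complex_vector.span {a \<otimes> b | a b i j. a \<in> G i \<and> b \<in> G' j \<and> i + j = k}"

definition braiding :: "'a::complex_vector grading \<Rightarrow> 'b::complex_vector grading \<Rightarrow> 'a \<otimes> 'b \<Rightarrow> 'b \<otimes> 'a" where
  "braiding G G' = tensor_lift (\<lambda>v w. \<Sum>i\<in>{0, 1}. \<Sum>j\<in>{0, 1}.
    parity_sign (i * j) *\<^sub>C (component G' j w \<otimes> component G i v))"

text \<open>The product \<open>(a \<otimes> b)(a' \<otimes> b') = (-1)\<^bsup>p(a')p(b)\<^esup> aa' \<otimes> bb'\<close>.\<close>

definition super_tensor_mult ::
  "'a::complex_vector grading \<Rightarrow> ('a \<Rightarrow> 'a \<Rightarrow> 'a) \<Rightarrow>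
   'b::complex_vector grading \<Rightarrow> ('b \<Rightarrow> 'b \<Rightarrow> 'b) \<Rightarrow> 'a \<otimes> 'b \<Rightarrow> 'a \<otimes> 'b \<Rightarrow> 'a \<otimes> 'b" where
  "super_tensor_mult G m G' m' s t =
    tensor_lift (\<lambda>a b. tensor_lift (\<lambda>a' b'. \<Sum>i\<in>{0, 1}. \<Sum>j\<in>{0, 1}.
      parity_sign (i * j) *\<^sub>C (m a (component G i a') \<otimes> m' (component G' j b) b')) t) s"


section \<open>Hopf algebras and Hopf superalgebras\<close>

record (overloaded) 'a hopf =
  mult :: "'a \<Rightarrow> 'a \<Rightarrow> 'a"
  unity :: 'a
  comult :: "'a \<Rightarrow> 'a \<otimes> 'a"
  counit :: "'a \<Rightarrow> complex"
  antipode :: "'a \<Rightarrow> 'a"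

record (overloaded) 'a super_hopf = "'a hopf" +
  grade :: "'a grading"

definition algebra_axioms :: "('a::complex_vector, 'm) hopf_scheme \<Rightarrow> bool" where
  "algebra_axioms H \<longleftrightarrow> cbilinear (mult H) \<and>
    (\<forall>x y z. mult H (mult H x y) z = mult H x (mult H y z)) \<and>
    (\<forall>x. mult H (unity H) x = x \<and> mult H x (unity H) = x)"

definition coalgebra_axioms :: "('a::complex_vector, 'm) hopf_scheme \<Rightarrow> bool" where
  "coalgebra_axioms H \<longleftrightarrow> clinear (comult H) \<and> clinear (counit H) \<and>
    (\<forall>x. tensor_assoc (tensor_map (comult H) id (comult H x)) =
         tensor_map id (comult H) (comult H x)) \<and>
    (\<forall>x. tensor_lift (\<lambda>a b. counit H a *\<^sub>C b) (comult H x) = x \<and>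
         tensor_lift (\<lambda>a b. counit H b *\<^sub>C a) (comult H x) = x)"

definition antipode_axioms :: "('a::complex_vector, 'm) hopf_scheme \<Rightarrow> bool" where
  "antipode_axioms H \<longleftrightarrow> clinear (antipode H) \<and>
    (\<forall>x. tensor_lift (\<lambda>a b. mult H (antipode H a) b) (comult H x) = counit H x *\<^sub>C unity H \<and>
         tensor_lift (\<lambda>a b. mult H a (antipode H b)) (comult H x) = counit H x *\<^sub>C unity H)"

definition bialgebra_axioms ::
  "('a \<otimes> 'a \<Rightarrow> 'a \<otimes> 'a \<Rightarrow> 'a \<otimes> 'a) \<Rightarrow> ('a::complex_vector, 'm) hopf_scheme \<Rightarrow> bool" where
  "bialgebra_axioms mult2 H \<longleftrightarrow>
    (\<forall>x y. comult H (mult H x y) = mult2 (comult H x) (comult H y)) \<and>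
    comult H (unity H) = unity H \<otimes> unity H \<and>
    (\<forall>x y. counit H (mult H x y) = counit H x * counit H y) \<and>
    counit H (unity H) = 1"

abbreviation hopf_mult2 :: "('a::complex_vector, 'm) hopf_scheme \<Rightarrow> 'a \<otimes> 'a \<Rightarrow> 'a \<otimes> 'a \<Rightarrow> 'a \<otimes> 'a" where
  "hopf_mult2 H \<equiv> tensor_mult (mult H) (mult H)"

abbreviation hopf_mult3 ::
  "('a::complex_vector, 'm) hopf_scheme \<Rightarrow> 'a \<otimes> 'a \<otimes> 'a \<Rightarrow> 'a \<otimes> 'a \<otimes> 'a \<Rightarrow> 'a \<otimes> 'a \<otimes> 'a" where
  "hopf_mult3 H \<equiv> tensor_mult (mult H) (hopf_mult2 H)"

abbreviation super_mult2 ::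
  "('a::complex_vector, 'm) super_hopf_scheme \<Rightarrow> 'a \<otimes> 'a \<Rightarrow> 'a \<otimes> 'a \<Rightarrow> 'a \<otimes> 'a" where
  "super_mult2 H \<equiv> super_tensor_mult (grade H) (mult H) (grade H) (mult H)"

abbreviation super_mult3 ::
  "('a::complex_vector, 'm) super_hopf_scheme \<Rightarrow> 'a \<otimes> 'a \<otimes> 'a \<Rightarrow> 'a \<otimes> 'a \<otimes> 'a \<Rightarrow> 'a \<otimes> 'a \<otimes> 'a" where
  "super_mult3 H \<equiv> super_tensor_mult (grade H) (mult H)
    (tensor_grading (grade H) (grade H)) (super_mult2 H)"

definition hopf_algebra :: "('a::complex_vector, 'm) hopf_scheme \<Rightarrow> bool" where
  "hopf_algebra H \<longleftrightarrow> algebra_axioms H \<and> coalgebra_axioms H \<and>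
    bialgebra_axioms (hopf_mult2 H) H \<and> antipode_axioms H"

text \<open>All structure maps are morphisms of supervector spaces, i.e.\ even.\<close>

definition hopf_superalgebra :: "('a::complex_vector, 'm) super_hopf_scheme \<Rightarrow> bool" where
  "hopf_superalgebra H \<longleftrightarrow> is_grading (grade H) \<and>
    algebra_axioms H \<and> coalgebra_axioms H \<and>
    bialgebra_axioms (super_mult2 H) H \<and> antipode_axioms H \<and>
    (\<forall>i j. \<forall>x\<in>grade H i. \<forall>y\<in>grade H j. mult H x y \<in> grade H (i + j)) \<and>
    unity H \<in> grade H 0 \<and>
    (\<forall>i. \<forall>x\<in>grade H i. comult H x \<in> tensor_grading (grade H) (grade H) i) \<and>
    (\<forall>x\<in>grade H 1. counit H x = 0) \<and>
    (\<forall>i. \<forall>x\<in>grade H i. antipode H x \<in> grade H i)"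

definition grouplike :: "('a::complex_vector, 'm) hopf_scheme \<Rightarrow> 'a \<Rightarrow> bool" where
  "grouplike H g \<longleftrightarrow> g \<noteq> 0 \<and> comult H g = g \<otimes> g"

definition alg_inverse :: "('a::complex_vector, 'm) hopf_scheme \<Rightarrow> 'a \<Rightarrow> 'a" where
  "alg_inverse H g = (THE h. mult H g h = unity H \<and> mult H h g = unity H)"

definition conj_by :: "('a::complex_vector, 'm) hopf_scheme \<Rightarrow> 'a \<Rightarrow> 'a \<Rightarrow> 'a" where
  "conj_by H g x = mult H (mult H g x) (alg_inverse H g)"


section \<open>Triangular structures\<close>

text \<open>
  With \<open>op\<close> the symmetry of the ambient tensor category and \<open>mult2\<close>, \<open>mult3\<close> the products of
  \<open>H \<otimes> H\<close> and \<open>H \<otimes> H \<otimes> H\<close> in that category, the axioms read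
  \<open>\<Delta>\<^bsup>op\<^esup>(h) R = R \<Delta>(h)\<close>, \<open>(\<Delta> \<otimes> id)(R) = R\<^sub>1\<^sub>3 R\<^sub>2\<^sub>3\<close>, \<open>(id \<otimes> \<Delta>)(R) = R\<^sub>1\<^sub>3 R\<^sub>1\<^sub>2\<close> and \<open>R R\<^sub>2\<^sub>1 = 1\<close>.
  Inserting the even element \<open>1\<close> as a tensor factor involves no sign.
\<close>

definition leg12 :: "('a::complex_vector, 'm) hopf_scheme \<Rightarrow> 'a \<otimes> 'a \<Rightarrow> 'a \<otimes> 'a \<otimes> 'a" where
  "leg12 H = tensor_map id (\<lambda>b. b \<otimes> unity H)"

definition leg13 :: "('a::complex_vector, 'm) hopf_scheme \<Rightarrow> 'a \<otimes> 'a \<Rightarrow> 'a \<otimes> 'a \<otimes> 'a" where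
  "leg13 H = tensor_map id (\<lambda>b. unity H \<otimes> b)"

definition leg23 :: "('a::complex_vector, 'm) hopf_scheme \<Rightarrow> 'a \<otimes> 'a \<Rightarrow> 'a \<otimes> 'a \<otimes> 'a" where
  "leg23 H R = unity H \<otimes> R"

definition triangular_axioms ::
  "('a \<otimes> 'a \<Rightarrow> 'a \<otimes> 'a) \<Rightarrow> ('a \<otimes> 'a \<Rightarrow> 'a \<otimes> 'a \<Rightarrow> 'a \<otimes> 'a) \<Rightarrow>
   ('a \<otimes> 'a \<otimes> 'a \<Rightarrow> 'a \<otimes> 'a \<otimes> 'a \<Rightarrow> 'a \<otimes> 'a \<otimes> 'a) \<Rightarrow>
   ('a::complex_vector, 'm) hopf_scheme \<Rightarrow> 'a \<otimes> 'a \<Rightarrow> bool" where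
  "triangular_axioms op mult2 mult3 H R \<longleftrightarrow>
    (\<forall>h. mult2 (op (comult H h)) R = mult2 R (comult H h)) \<and>
    tensor_assoc (tensor_map (comult H) id R) = mult3 (leg13 H R) (leg23 H R) \<and>
    tensor_map id (comult H) R = mult3 (leg13 H R) (leg12 H R) \<and>
    mult2 R (op R) = unity H \<otimes> unity H"

definition triangular :: "('a::complex_vector, 'm) hopf_scheme \<Rightarrow> 'a \<otimes> 'a \<Rightarrow> bool" where
  "triangular H R \<longleftrightarrow> hopf_algebra H \<and>
    triangular_axioms flip (hopf_mult2 H) (hopf_mult3 H) H R"

definition super_triangular :: "('a::complex_vector, 'm) super_hopf_scheme \<Rightarrow> 'a \<otimes> 'a \<Rightarrow> bool" where
  "super_triangular H R \<longleftrightarrow> hopf_superalgebra H \<and>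
    R \<in> tensor_grading (grade H) (grade H) 0 \<and>
    triangular_axioms (braiding (grade H) (grade H)) (super_mult2 H) (super_mult3 H) H R"

definition drinfeld :: "('a::complex_vector, 'm) hopf_scheme \<Rightarrow> 'a \<otimes> 'a \<Rightarrow> 'a" where
  "drinfeld H R = tensor_lift (mult H) (flip (tensor_map id (antipode H) R))"

definition super_drinfeld :: "('a::complex_vector, 'm) super_hopf_scheme \<Rightarrow> 'a \<otimes> 'a \<Rightarrow> 'a" where
  "super_drinfeld H R =
    tensor_lift (mult H) (braiding (grade H) (grade H) (tensor_map id (antipode H) R))"


section \<open>Isomorphism classes\<close>

definition hopf_iso ::
  "('a::complex_vector \<Rightarrow> 'b::complex_vector) \<Rightarrow> ('a, 'm) hopf_scheme \<Rightarrow> ('b, 'n) hopf_scheme \<Rightarrow> bool" where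
  "hopf_iso \<phi> H K \<longleftrightarrow> clinear \<phi> \<and> bij \<phi> \<and>
    (\<forall>x y. \<phi> (mult H x y) = mult K (\<phi> x) (\<phi> y)) \<and> \<phi> (unity H) = unity K \<and>
    (\<forall>x. comult K (\<phi> x) = tensor_map \<phi> \<phi> (comult H x)) \<and>
    (\<forall>x. counit K (\<phi> x) = counit H x) \<and>
    (\<forall>x. antipode K (\<phi> x) = \<phi> (antipode H x))"

definition super_hopf_iso ::
  "('a::complex_vector \<Rightarrow> 'b::complex_vector) \<Rightarrow>
   ('a, 'm) super_hopf_scheme \<Rightarrow> ('b, 'n) super_hopf_scheme \<Rightarrow> bool" where
  "super_hopf_iso \<phi> H K \<longleftrightarrow> hopf_iso \<phi> H K \<and> (\<forall>i. \<phi> ` grade H i = grade K i)"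

definition hopf_pairs :: "('a::complex_vector hopf \<times> 'a) set" where
  "hopf_pairs = {(H, u). hopf_algebra H \<and> grouplike H u \<and> mult H u u = unity H}"

definition super_pairs :: "('a::complex_vector super_hopf \<times> 'a) set" where
  "super_pairs = {(H, g). hopf_superalgebra H \<and> grouplike H g \<and> mult H g g = unity H \<and>
    (\<forall>i. \<forall>x\<in>grade H i. conj_by H g x = parity_sign i *\<^sub>C x)}"

definition triangular_hopfs :: "('a::complex_vector hopf \<times> ('a \<otimes> 'a)) set" where
  "triangular_hopfs = {(H, R). triangular H R \<and>
    mult H (drinfeld H R) (drinfeld H R) = unity H}"

definition super_triangular_pairs :: "('a::complex_vector super_hopf \<times> ('a \<otimes> 'a) \<times> 'a) set" where
  "super_triangular_pairs = {(H, R, g). super_triangular H R \<and> super_drinfeld H R = unity H \<and>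
    grouplike H g \<and> mult H g g = unity H \<and>
    (\<forall>i. \<forall>x\<in>grade H i. conj_by H g x = parity_sign i *\<^sub>C x)}"

definition hopf_pair_iso :: "('a::complex_vector hopf \<times> 'a) rel" where
  "hopf_pair_iso = {((H, u), (K, v)). (H, u) \<in> hopf_pairs \<and> (K, v) \<in> hopf_pairs \<and>
    (\<exists>\<phi>. hopf_iso \<phi> H K \<and> \<phi> u = v)}"

definition super_pair_iso :: "('a::complex_vector super_hopf \<times> 'a) rel" where
  "super_pair_iso = {((H, g), (K, k)). (H, g) \<in> super_pairs \<and> (K, k) \<in> super_pairs \<and>
    (\<exists>\<phi>. super_hopf_iso \<phi> H K \<and> \<phi> g = k)}"

definition triangular_iso :: "('a::complex_vector hopf \<times> ('a \<otimes> 'a)) rel" where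
  "triangular_iso = {((H, R), (K, Q)). (H, R) \<in> triangular_hopfs \<and> (K, Q) \<in> triangular_hopfs \<and>
    (\<exists>\<phi>. hopf_iso \<phi> H K \<and> tensor_map \<phi> \<phi> R = Q)}"

definition super_triangular_iso :: "('a::complex_vector super_hopf \<times> ('a \<otimes> 'a) \<times> 'a) rel" where
  "super_triangular_iso = {((H, R, g), (K, Q, k)).
    (H, R, g) \<in> super_triangular_pairs \<and> (K, Q, k) \<in> super_triangular_pairs \<and>
    (\<exists>\<phi>. super_hopf_iso \<phi> H K \<and> tensor_map \<phi> \<phi> R = Q \<and> \<phi> g = k)}"


section \<open>The correspondence of pairs\<close>

definition adjoint_grading :: "('a::complex_vector, 'm) hopf_scheme \<Rightarrow> 'a \<Rightarrow> 'a grading" where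
  "adjoint_grading H u i = {x. conj_by H u x = parity_sign i *\<^sub>C x}"

text \<open>
  The comultiplication and antipode of the superalgebra are given on homogeneous \<open>h\<close> by
  \<open>\<Delta>\<^sub>0(h) - (-1)\<^bsup>p(h)\<^esup> (u \<otimes> 1) \<Delta>\<^sub>1(h)\<close>, where \<open>\<Delta>\<^sub>j(h)\<close> is the component of \<open>\<Delta>(h)\<close> in \<open>H \<otimes> H\<^sub>j\<close>,
  and by \<open>u\<^bsup>p(h)\<^esup> S(h)\<close>; the definition sums these over the components \<open>h\<^sub>0\<close>, \<open>h\<^sub>1\<close> of \<open>h\<close>.
\<close>

definition superize :: "'a::complex_vector hopf \<Rightarrow> 'a \<Rightarrow> 'a super_hopf" where
  "superize H u = (let G = adjoint_grading H u;
      comult_part = (\<lambda>j h. tensor_map id (component G j) (comult H h)) in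
    \<lparr> mult = mult H,
      unity = unity H,
      comult = (\<lambda>h. \<Sum>i\<in>{0, 1}. comult_part 0 (component G i h)
        - parity_sign i *\<^sub>C hopf_mult2 H (u \<otimes> unity H) (comult_part 1 (component G i h))),
      counit = counit H,
      antipode = (\<lambda>h. antipode H (component G 0 h) + mult H u (antipode H (component G 1 h))),
      grade = G \<rparr>)"

text \<open>
  A map \<open>f\<close> of objects induces the map on isomorphism classes sending \<open>C\<close> to the class (with
  respect to \<open>r\<close>) of the image under \<open>f\<close> of the members of \<open>C\<close>.
\<close>

definition induced :: "('y \<times> 'y) set \<Rightarrow> ('x \<Rightarrow> 'y) \<Rightarrow> 'x set \<Rightarrow> 'y set" where
  "induced r f C = r `` (f ` C)"

definition pair_correspondence ::
  "('a::complex_vector hopf \<times> 'a) set \<Rightarrow> ('a super_hopf \<times> 'a) set" where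
  "pair_correspondence = induced super_pair_iso (\<lambda>(H, u). (superize H u, u))"

definition attached_pair ::
  "('a::complex_vector hopf \<times> ('a \<otimes> 'a)) set \<Rightarrow> ('a hopf \<times> 'a) set" where
  "attached_pair = induced hopf_pair_iso (\<lambda>(H, R). (H, drinfeld H R))"

definition underlying_super_pair ::
  "('a::complex_vector super_hopf \<times> ('a \<otimes> 'a) \<times> 'a) set \<Rightarrow> ('a super_hopf \<times> 'a) set" where
  "underlying_super_pair = induced super_pair_iso (\<lambda>(H, R, g). (H, g))"

end

theory Submission
  imports Defs
begin

text \<open>
  Let \<open>u\<close> be a grouplike element of square \<open>1\<close>. A module over the Hopf algebra \<open>H\<close> is the same
  thing as a supermodule over the superalgebra \<open>\<H>\<close> on which \<open>u\<close> acts by parity, and the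
  correspondence is the translation of one language into the other. An element \<open>a \<otimes> b\<close> of
  \<open>\<H> \<otimes> \<H>\<close> acts on a tensor product \<open>v \<otimes> w\<close> of supermodules by
  \<open>(-1)\<^bsup>p(b)p(v)\<^esup> av \<otimes> bw\<close>, which is the action of \<open>\<theta>(a \<otimes> b) = a u\<^bsup>p(b)\<^esup> \<otimes> b\<close> without signs.
  So \<open>\<theta>\<close>, an involution, is an isomorphism from the product with the sign rule to the product
  without it (\<open>theta_mult\<close>); on three factors the same holds for \<open>\<theta>3\<close>. The superized
  comultiplication is \<open>\<theta> \<circ> \<Delta>\<close>. Hence every axiom on one side is the image of the axiom on the
  other side under \<open>\<theta>\<close> or \<open>\<theta>3\<close>, and because \<open>\<theta>\<close> is an involution, doing the change twice gives
  back the original Hopf algebra (\<open>twist_twist\<close>). Superization is therefore a bijection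
  on the pairs themselves (\<open>bij_betw_superize\<close>), and it respects isomorphisms in both directions,
  so it is a bijection on isomorphism classes.

  For the triangular structures the two symmetries must be compared. The braiding of supermodules
  differs from the flip by the action of
  \<open>J = 1/2 (1 \<otimes> 1 + 1 \<otimes> u + u \<otimes> 1 - u \<otimes> u)\<close>, the triangular structure of the group algebra of
  \<open>{1, u}\<close>; on elements this says \<open>\<theta> \<beta> \<theta> (t) = J flip(t) J\<close> (\<open>theta_braiding\<close>). Requiring that
  \<open>R\<close> and its super version \<open>R'\<close> define the same symmetry on modules forces \<open>R' = \<theta>(J R)\<close>. With this
  choice each triangularity axiom for \<open>R'\<close> becomes, after \<open>\<theta>\<close> or \<open>\<theta>3\<close>, the axiom for \<open>R\<close> multiplied
  by legs of \<open>J\<close>, which square to \<open>1\<close> (the lemmas \<open>super_quasitriangular_iff\<close> to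
  \<open>super_symmetric_iff\<close>). The Drinfeld element of \<open>R\<close> is that of \<open>R'\<close> times \<open>u\<close>
  (\<open>drinfeld_twist\<close>), so the first equals \<open>u\<close> exactly if the second equals \<open>1\<close>.

  One ingredient is not formal: to apply all this to a triangular Hopf algebra, its Drinfeld element
  must be grouplike (\<open>D_drinfeld\<close>). Write \<open>R = \<Sum> a \<otimes> b\<close> and \<open>u = \<Sum> S(b) a\<close>. From \<open>u x = S\<^sup>2(x) u\<close>
  and \<open>(S \<otimes> id)(R) = R\<^sub>2\<^sub>1\<close> one finds \<open>\<Sum> \<Delta>(S b) (a \<otimes> 1) = R\<^sub>2\<^sub>1 (u \<otimes> 1)\<close>, and using this twice in
  \<open>\<Delta>(u) = \<Sum> \<Delta>(S b) \<Delta>(a)\<close> gives \<open>\<Delta>(u) = R\<^sub>2\<^sub>1 R (u \<otimes> u) = u \<otimes> u\<close>. Moreover \<open>R\<close> commutes with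
  \<open>\<Delta>(u) = u \<otimes> u\<close>, so it is even.
\<close>

section \<open>Multilinear maps on tensor products\<close>

text \<open>
  The rules collected here derive linearity of a map from the shape of the term that defines it.
  Identities between tensors are checked on pure tensors, where the linearity of both sides is
  the only side condition.
\<close>

named_theorems multilinear

lemma clinear_ident [multilinear]: "clinear (\<lambda>x. x)"
  by (rule clinearI) simp_all

lemma clinear_id [multilinear]: "clinear id"
  by (rule clinearI) simp_all

lemma clinear_plus [multilinear]: "clinear f \<Longrightarrow> clinear g \<Longrightarrow> clinear (\<lambda>x. f x + g x)"
  by (rule clinearI) (simp_all add: clinear_add clinear_scaleC scaleC_add_right)

lemma clinear_minus [multilinear]: "clinear f \<Longrightarrow> clinear g \<Longrightarrow> clinear (\<lambda>x. f x - g x)"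
  by (rule clinearI)
    (simp_all add: clinear_add clinear_scaleC complex_vector.scale_right_diff_distrib)

lemma clinear_times_scalar [multilinear]: "clinear f \<Longrightarrow> clinear (\<lambda>x. c *\<^sub>C f x)"
  by (rule clinearI)
    (simp_all add: clinear_add clinear_scaleC scaleC_add_right scaleC_scaleC mult.commute)

lemma clinear_scalar_times [multilinear]: "clinear f \<Longrightarrow> clinear (\<lambda>x. f x *\<^sub>C v)"
  by (rule clinearI)
    (simp_all add: clinear_add clinear_scaleC scaleC_add_left scaleC_scaleC scaleC_complex_def)

lemma clinear_compose: "clinear f \<Longrightarrow> clinear g \<Longrightarrow> clinear (\<lambda>x. f (g x))"
  by (rule clinearI) (simp_all add: clinear_add clinear_scaleC)

lemma cbilinearI [multilinear]:
  "(\<And>a. clinear (\<lambda>b. B a b)) \<Longrightarrow> (\<And>b. clinear (\<lambda>a. B a b)) \<Longrightarrow> cbilinear B"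
  by (simp add: cbilinear_def)

lemma cbilinear_right: "cbilinear B \<Longrightarrow> clinear f \<Longrightarrow> clinear (\<lambda>x. B a (f x))"
  by (auto simp: cbilinear_def intro: clinear_compose)

lemma cbilinear_left: "cbilinear B \<Longrightarrow> clinear f \<Longrightarrow> clinear (\<lambda>x. B (f x) b)"
  by (rule clinear_compose[of "\<lambda>x. B x b"]) (auto simp: cbilinear_def)

lemmas clinear_tensor_right [multilinear] = cbilinear_right[OF cbilinear_tensor]
lemmas clinear_tensor_left [multilinear] = cbilinear_left[OF cbilinear_tensor]

lemma cbilinear_add_right: "cbilinear B \<Longrightarrow> B a (x + y) = B a x + B a y"
  and cbilinear_scale_right: "cbilinear B \<Longrightarrow> B a (c *\<^sub>C x) = c *\<^sub>C B a x"
  and cbilinear_diff_right: "cbilinear B \<Longrightarrow> B a (x - y) = B a x - B a y"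
  and cbilinear_zero_right: "cbilinear B \<Longrightarrow> B a 0 = 0"
  by (simp_all add: cbilinear_def clinear_add clinear_scaleC clinear_diff clinear_zero)

lemma cbilinear_add_left: "cbilinear B \<Longrightarrow> B (x + y) b = B x b + B y b"
  and cbilinear_scale_left: "cbilinear B \<Longrightarrow> B (c *\<^sub>C x) b = c *\<^sub>C B x b"
  and cbilinear_diff_left: "cbilinear B \<Longrightarrow> B (x - y) b = B x b - B y b"
  and cbilinear_zero_left: "cbilinear B \<Longrightarrow> B 0 b = 0"
  using clinear_add[of "\<lambda>a. B a b"] clinear_scaleC[of "\<lambda>a. B a b"]
    clinear_diff[of "\<lambda>a. B a b"] clinear_zero[of "\<lambda>a. B a b"]
  by (simp_all add: cbilinear_def)

lemma cbilinear_uminus_right: "cbilinear B \<Longrightarrow> B a (- x) = - B a x"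
  using cbilinear_diff_right[of B a 0 x] by (simp add: cbilinear_zero_right)

lemma cbilinear_uminus_left: "cbilinear B \<Longrightarrow> B (- x) b = - B x b"
  using cbilinear_diff_left[of B 0 x b] by (simp add: cbilinear_zero_left)

lemmas cbilinear_simps = cbilinear_add_right cbilinear_add_left cbilinear_scale_right
  cbilinear_scale_left cbilinear_diff_right cbilinear_diff_left cbilinear_zero_right
  cbilinear_zero_left cbilinear_uminus_right cbilinear_uminus_left

lemmas tensor_simps = cbilinear_simps[OF cbilinear_tensor]

lemma clinear_tensor_lift_arg [multilinear]:
  "cbilinear B \<Longrightarrow> clinear f \<Longrightarrow> clinear (\<lambda>x. tensor_lift B (f x))"
  by (rule clinear_compose[OF clinear_tensor_lift])

lemma tensor_eqI:
  assumes "clinear f" "clinear g" "\<And>a b. f (a \<otimes> b) = g (a \<otimes> b)"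
  shows "f t = g t"
  using span_pure_tensors[of t]
proof (induction rule: complex_vector.span_induct_alt)
  case base
  show ?case using assms by (simp add: clinear_zero)
next
  case (step c x y)
  then show ?case using assms by (auto simp: clinear_add clinear_scaleC)
qed

text \<open>
  Linearity in a parameter of the bilinear map that is lifted. Together with
  \<open>clinear_tensor_lift_arg\<close> this makes nested lifts, the analogue of iterated Sweedler sums,
  linear in each variable.
\<close>

lemma clinear_tensor_lift_family [multilinear]:
  assumes "\<And>a b. clinear (\<lambda>x. F x a b)" and B: "\<And>x. cbilinear (F x)"
  shows "clinear (\<lambda>x. tensor_lift (\<lambda>a b. F x a b) t)"
proof (rule clinearI)
  fix x y c
  note F = clinear_add[OF assms(1)] clinear_scaleC[OF assms(1)]
  have Fx: "F (x + y) = (\<lambda>a b. F x a b + F y a b)" "F (c *\<^sub>C x) = (\<lambda>a b. c *\<^sub>C F x a b)"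
    by (intro ext, simp add: F)+
  note [multilinear] = cbilinear_left[OF B] cbilinear_right[OF B] B
  have sum: "cbilinear (\<lambda>a b. F x a b + F y a b)" and scale: "cbilinear (\<lambda>a b. c *\<^sub>C F x a b)"
    by (intro multilinear)+
  have "tensor_lift (\<lambda>a b. F x a b + F y a b) t = tensor_lift (F x) t + tensor_lift (F y) t"
    by (rule tensor_eqI[where t = t])
      (intro multilinear sum | simp add: tensor_lift_tensor B sum)+
  then show "tensor_lift (F (x + y)) t = tensor_lift (F x) t + tensor_lift (F y) t"
    by (simp add: Fx)
  have "tensor_lift (\<lambda>a b. c *\<^sub>C F x a b) t = c *\<^sub>C tensor_lift (F x) t"
    by (rule tensor_eqI[where t = t])
      (intro multilinear scale | simp add: tensor_lift_tensor B scale)+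
  then show "tensor_lift (F (c *\<^sub>C x)) t = c *\<^sub>C tensor_lift (F x) t"
    by (simp add: Fx)
qed

lemma clinear_tensor_lift_distrib:
  assumes f: "clinear f" and B: "cbilinear B"
  shows "f (tensor_lift B t) = tensor_lift (\<lambda>a b. f (B a b)) t"
proof -
  note [multilinear] = clinear_compose[OF f] cbilinear_left[OF B] cbilinear_right[OF B]
  show ?thesis
    by (rule tensor_eqI[where t = t]) (intro multilinear | simp add: tensor_lift_tensor multilinear)+
qed

lemma tensor_lift_pure: "tensor_lift (\<otimes>) t = t"
  by (rule tensor_eqI) (auto intro!: multilinear simp: tensor_lift_tensor cbilinear_tensor)

lemma cbilinear_tensor_map:
  assumes "clinear f" "clinear g"
  shows "cbilinear (\<lambda>a b. f a \<otimes> g b)"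
  by (intro multilinear clinear_compose[OF assms(1)] clinear_compose[OF assms(2)])

lemma tensor_map_tensor:
  "clinear f \<Longrightarrow> clinear g \<Longrightarrow> tensor_map f g (a \<otimes> b) = f a \<otimes> g b"
  unfolding tensor_map_def by (rule tensor_lift_tensor) (rule cbilinear_tensor_map)

lemma clinear_tensor_map [multilinear]:
  "clinear f \<Longrightarrow> clinear g \<Longrightarrow> clinear h \<Longrightarrow> clinear (\<lambda>x. tensor_map f g (h x))"
  unfolding tensor_map_def by (intro clinear_tensor_lift_arg cbilinear_tensor_map)

lemma tensor_map_compose:
  assumes "clinear f" "clinear g" "clinear f'" "clinear g'"
  shows "tensor_map f g (tensor_map f' g' t) = tensor_map (\<lambda>x. f (f' x)) (\<lambda>x. g (g' x)) t"
  by (rule tensor_eqI[where t = t])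
    (use assms in \<open>simp_all add: tensor_map_tensor clinear_compose clinear_tensor_map clinear_ident\<close>)

lemma tensor_map_ident: "tensor_map (\<lambda>x. x) (\<lambda>x. x) t = t"
  by (rule tensor_eqI) (intro multilinear | simp add: tensor_map_tensor clinear_ident)+

lemma flip_tensor: "flip (a \<otimes> b) = b \<otimes> a"
  unfolding flip_def by (rule tensor_lift_tensor) (auto intro!: multilinear)

lemma clinear_flip [multilinear]: "clinear f \<Longrightarrow> clinear (\<lambda>x. flip (f x))"
  unfolding flip_def by (auto intro!: multilinear)

lemma flip_flip: "flip (flip t) = t"
  by (rule tensor_eqI) (auto intro!: multilinear simp: flip_tensor)

lemma cbilinear_tensor_assoc: "cbilinear (\<lambda>t c. tensor_lift (\<lambda>a b. a \<otimes> b \<otimes> c) t)"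
  by (auto intro!: multilinear)

lemma tensor_assoc_tensor: "tensor_assoc ((a \<otimes> b) \<otimes> c) = a \<otimes> b \<otimes> c"
  unfolding tensor_assoc_def
  by (subst tensor_lift_tensor[OF cbilinear_tensor_assoc], subst tensor_lift_tensor)
    (auto intro!: multilinear)

lemma clinear_tensor_assoc [multilinear]: "clinear f \<Longrightarrow> clinear (\<lambda>x. tensor_assoc (f x))"
  unfolding tensor_assoc_def by (auto intro!: multilinear)

lemma cbilinear_tensor_mult:
  assumes "cbilinear m" "cbilinear m'"
  shows "cbilinear (tensor_mult m m')"
proof -
  note [multilinear] = cbilinear_left[OF assms(1)] cbilinear_right[OF assms(1)]
    cbilinear_left[OF assms(2)] cbilinear_right[OF assms(2)]
  show ?thesis unfolding tensor_mult_def by (intro multilinear)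
qed

lemma tensor_mult_tensor:
  assumes "cbilinear m" "cbilinear m'"
  shows "tensor_mult m m' (a \<otimes> b) (a' \<otimes> b') = m a a' \<otimes> m' b b'"
proof -
  note [multilinear] = cbilinear_left[OF assms(1)] cbilinear_right[OF assms(1)]
    cbilinear_left[OF assms(2)] cbilinear_right[OF assms(2)]
  show ?thesis unfolding tensor_mult_def
    by (subst tensor_lift_tensor, intro multilinear, subst tensor_lift_tensor, intro multilinear) simp
qed

section \<open>Gradings given by involutions\<close>

lemma bit_cases: "(P::bit \<Rightarrow> bool) 0 \<Longrightarrow> P 1 \<Longrightarrow> P i"
  by (metis bit_not_zero_iff)

lemma parity_sign_add: "parity_sign (i + j) = parity_sign i * parity_sign j"
  by (simp add: parity_sign_def)

lemma parity_sign_simps [simp]: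
  "parity_sign 0 = 1" "parity_sign 1 = -1"
  "parity_sign i * parity_sign i = 1"
  "parity_sign i * (parity_sign i * c) = c"
  by (simp_all add: parity_sign_def)

text \<open>
  A grading by \<open>\<int>\<^sub>2\<close> on a complex vector space amounts to its parity involution \<open>B\<close>. Working with
  \<open>B\<close> replaces membership in homogeneous components by equations between linear maps.
\<close>

definition eigen_grading :: "('a::complex_vector \<Rightarrow> 'a) \<Rightarrow> 'a grading" where
  "eigen_grading B i = {x. B x = parity_sign i *\<^sub>C x}"

definition parity_part :: "('a::complex_vector \<Rightarrow> 'a) \<Rightarrow> bit \<Rightarrow> 'a \<Rightarrow> 'a" where
  "parity_part B i x = (1/2) *\<^sub>C (x + parity_sign i *\<^sub>C B x)"

lemma half_plus_half: "(1/2) *\<^sub>C x + (1/2) *\<^sub>C x = (x::'a::complex_vector)"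
  by (simp flip: scaleC_add_left add: scaleC_one)

lemma half_double: "(1/2) *\<^sub>C (x + x) = (x::'a::complex_vector)"
  by (simp add: scaleC_add_right half_plus_half)

lemma eq_neg_self_iff: "x = - x \<longleftrightarrow> x = (0::'a::complex_vector)"
proof
  assume "x = - x"
  then have "x + x = 0" by (metis add.left_inverse)
  then have "(1/2) *\<^sub>C (x + x) = 0" by simp
  then show "x = 0" by (simp only: half_double)
qed simp

lemma neg_eq_self_iff: "- x = x \<longleftrightarrow> x = (0::'a::complex_vector)"
  using eq_neg_self_iff by metis

locale involution =
  fixes B :: "'a::complex_vector \<Rightarrow> 'a"
  assumes linear: "clinear B" and inv: "B (B x) = x"
begin

lemma parity_part_eigen: "B (parity_part B i x) = parity_sign i *\<^sub>C parity_part B i x"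
  by (simp add: parity_part_def clinear_add[OF linear] clinear_scaleC[OF linear] inv
      scaleC_add_right scaleC_scaleC scaleC_one mult.assoc mult.left_commute add.commute)

lemma parity_part_sum: "parity_part B 0 x + parity_part B 1 x = x"
  by (simp add: parity_part_def scaleC_one half_plus_half flip: scaleC_add_right)
    (simp add: half_double)

lemma parity_part_homogeneous:
  "B x = parity_sign i *\<^sub>C x \<Longrightarrow> parity_part B j x = (if j = i then x else 0)"
  by (cases "i = 0"; cases "j = 0"; simp add: parity_part_def scaleC_one half_double)

lemma clinear_parity_part [multilinear]:
  "clinear f \<Longrightarrow> clinear (\<lambda>x. parity_part B i (f x))"
  unfolding parity_part_def by (intro multilinear clinear_compose[OF linear])

lemma is_grading_eigen: "is_grading (eigen_grading B)"
  unfolding is_grading_def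
proof (intro conjI allI)
  show "complex_vector.subspace (eigen_grading B i)" for i
    by (rule complex_vector.subspaceI)
      (simp_all add: eigen_grading_def clinear_zero[OF linear] clinear_add[OF linear]
        clinear_scaleC[OF linear] scaleC_add_right scaleC_scaleC mult.commute)
  show "eigen_grading B 0 \<inter> eigen_grading B 1 = {0}"
    by (auto simp: eigen_grading_def scaleC_one clinear_zero[OF linear] neg_eq_self_iff)
  show "\<exists>y\<in>eigen_grading B 0. \<exists>z\<in>eigen_grading B 1. x = y + z" for x
    using parity_part_sum[of x] parity_part_eigen
    by (intro bexI[of _ "parity_part B 0 x"] bexI[of _ "parity_part B 1 x"])
      (simp_all add: eigen_grading_def)
qed

lemma component_eigen: "component (eigen_grading B) i x = parity_part B i x"
  unfolding component_def
proof (rule the_equality)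
  have "x - parity_part B i x = parity_part B (i + 1) x"
    using parity_part_sum[of x] by (rule_tac bit_cases[of _ i]) (simp_all add: algebra_simps)
  then show "parity_part B i x \<in> eigen_grading B i \<and>
      x - parity_part B i x \<in> eigen_grading B (i + 1)"
    using parity_part_eigen by (simp add: eigen_grading_def)
  fix y assume y: "y \<in> eigen_grading B i \<and> x - y \<in> eigen_grading B (i + 1)"
  define z where "z = x - y"
  then have "parity_part B i z = 0" "parity_part B i y = y"
    using y by (auto simp: eigen_grading_def parity_part_homogeneous[of _ i]
      parity_part_homogeneous[of _ "i + 1"])
  then show "y = parity_part B i x"
    using clinear_add[OF clinear_parity_part[OF clinear_ident], of i y z] by (simp add: z_def)
qed

end

lemma involution_tensor:
  assumes "involution B" "involution C"
  shows "involution (tensor_map B C)"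
proof -
  interpret B: involution B by fact
  interpret C: involution C by fact
  show ?thesis
    by (rule involution.intro) (simp_all add: clinear_tensor_map clinear_ident B.linear C.linear
      tensor_map_compose B.inv C.inv tensor_map_ident)
qed

text \<open>
  Homogeneous pure tensors span, since each factor is the sum of its even and odd parts. This is
  how all sign computations below reduce to homogeneous elements.
\<close>

lemma tensor_homogeneous_eqI:
  assumes "involution B" "involution C" and f: "clinear f" and g: "clinear g"
    and eq: "\<And>a b i j. B a = parity_sign i *\<^sub>C a \<Longrightarrow> C b = parity_sign j *\<^sub>C b \<Longrightarrow>
      f (a \<otimes> b) = g (a \<otimes> b)"
  shows "f t = g t"
proof (rule tensor_eqI[OF f g])
  interpret B: involution B by fact
  interpret C: involution C by fact
  fix a b
  have "a \<otimes> b = (parity_part B 0 a + parity_part B 1 a) \<otimes> (parity_part C 0 b + parity_part C 1 b)"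
    by (simp only: B.parity_part_sum C.parity_part_sum)
  then show "f (a \<otimes> b) = g (a \<otimes> b)"
    by (simp only: tensor_simps clinear_add[OF f] clinear_add[OF g]
      eq[OF B.parity_part_eigen C.parity_part_eigen])
qed

text \<open>
  The even part of \<open>a \<otimes> b\<close> vanishes if the parities of \<open>a\<close> and \<open>b\<close> differ, so an even tensor is a
  sum of \<open>a \<otimes> b\<close> with factors of equal parity.
\<close>

lemma even_tensor_homogeneous_eqI:
  assumes B: "involution B" and C: "involution C" and f: "clinear f" and g: "clinear g"
    and even: "tensor_map B C t = t"
    and eq: "\<And>a b i. B a = parity_sign i *\<^sub>C a \<Longrightarrow> C b = parity_sign i *\<^sub>C b \<Longrightarrow>
      f (a \<otimes> b) = g (a \<otimes> b)"
  shows "f t = g t"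
proof -
  let ?p = "parity_part (tensor_map B C) 0"
  interpret BC: involution "tensor_map B C" by (rule involution_tensor[OF B C])
  interpret B: involution B by fact
  interpret C: involution C by fact
  have "f (?p t) = g (?p t)"
  proof (rule tensor_homogeneous_eqI[OF B C, where f = "\<lambda>t. f (?p t)" and g = "\<lambda>t. g (?p t)"])
    show "clinear (\<lambda>t. f (?p t))" "clinear (\<lambda>t. g (?p t))"
      by (intro clinear_compose[OF f] clinear_compose[OF g] multilinear)+
    fix a b i j
    assume ab: "B a = parity_sign i *\<^sub>C a" "C b = parity_sign j *\<^sub>C b"
    then have "tensor_map B C (a \<otimes> b) = parity_sign (i + j) *\<^sub>C (a \<otimes> b)"
      unfolding parity_sign_add
      by (simp add: tensor_map_tensor B.linear C.linear tensor_simps scaleC_scaleC mult.commute)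
    from BC.parity_part_homogeneous[OF this]
    show "f (?p (a \<otimes> b)) = g (?p (a \<otimes> b))"
      using eq[of a i b] ab
      by (cases "i = j") (auto simp: clinear_zero[OF f] clinear_zero[OF g] )
  qed
  moreover have "?p t = t"
    using even by (simp add: parity_part_def scaleC_one half_double)
  ultimately show ?thesis by simp
qed

text \<open>
  The projection of \<open>a \<otimes> b\<close> to parity \<open>k\<close> is the sum of the products of homogeneous parts whose
  parities add up to \<open>k\<close>; hence an eigenvector of \<open>B \<otimes> C\<close>, being its own projection, lies in the
  span.
\<close>

lemma tensor_grading_eigen:
  assumes B: "involution B" and C: "involution C"
  shows "tensor_grading (eigen_grading B) (eigen_grading C) = eigen_grading (tensor_map B C)"
proof (intro ext set_eqI iffI)
  interpret BC: involution "tensor_map B C" by (rule involution_tensor[OF B C])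
  interpret B: involution B by fact
  interpret C: involution C by fact
  fix k t
  let ?S = "{a \<otimes> b | a b i j. a \<in> eigen_grading B i \<and> b \<in> eigen_grading C j \<and> i + j = k}"
  show "t \<in> eigen_grading (tensor_map B C) k"
    if "t \<in> tensor_grading (eigen_grading B) (eigen_grading C) k"
  proof -
    have "complex_vector.span ?S \<subseteq> eigen_grading (tensor_map B C) k"
    proof (rule complex_vector.span_minimal)
      show "complex_vector.subspace (eigen_grading (tensor_map B C) k)"
        using BC.is_grading_eigen by (simp add: is_grading_def)
      show "?S \<subseteq> eigen_grading (tensor_map B C) k"
      proof safe
        fix a b i j
        assume "a \<in> eigen_grading B i" "b \<in> eigen_grading C j" "k = i + j"
        then show "a \<otimes> b \<in> eigen_grading (tensor_map B C) (i + j)"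
          unfolding eigen_grading_def parity_sign_add
          by (simp add: tensor_map_tensor B.linear C.linear tensor_simps scaleC_scaleC mult.commute)
      qed
    qed
    then show ?thesis using that by (auto simp: tensor_grading_def)
  qed
  assume t: "t \<in> eigen_grading (tensor_map B C) k"
  let ?p = "parity_part (tensor_map B C) k"
  have "?p t \<in> complex_vector.span ?S"
    using span_pure_tensors[of t]
  proof (induction rule: complex_vector.span_induct_alt)
    case base
    show ?case
      by (simp add: clinear_zero[OF BC.clinear_parity_part[OF clinear_ident]] complex_vector.span_zero)
  next
    case (step c x y)
    then obtain a b where x: "x = a \<otimes> b" by auto
    have p: "?p (parity_part B i a \<otimes> parity_part C j b) \<in> complex_vector.span ?S" for i j
    proof -
      have "tensor_map B C (parity_part B i a \<otimes> parity_part C j b) =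
          parity_sign (i + j) *\<^sub>C (parity_part B i a \<otimes> parity_part C j b)"
        unfolding parity_sign_add
        by (simp add: tensor_map_tensor B.linear C.linear tensor_simps scaleC_scaleC
          B.parity_part_eigen C.parity_part_eigen mult.commute)
      from BC.parity_part_homogeneous[OF this]
      have "?p (parity_part B i a \<otimes> parity_part C j b) =
          (if k = i + j then parity_part B i a \<otimes> parity_part C j b else 0)" .
      moreover have "parity_part B i a \<otimes> parity_part C j b \<in> ?S" if "k = i + j"
        using B.parity_part_eigen C.parity_part_eigen that unfolding eigen_grading_def by blast
      ultimately show ?thesis
        by (metis (lifting) complex_vector.span_zero complex_vector.span_base)
    qed
    have "x = (parity_part B 0 a + parity_part B 1 a) \<otimes> (parity_part C 0 b + parity_part C 1 b)"
      by (simp only: x B.parity_part_sum C.parity_part_sum)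
    then have "?p x \<in> complex_vector.span ?S"
      by (simp only: tensor_simps clinear_add[OF BC.clinear_parity_part[OF clinear_ident]] p
        complex_vector.span_add)
    with step show ?case
      by (simp add: clinear_add[OF BC.clinear_parity_part[OF clinear_ident]]
        clinear_scaleC[OF BC.clinear_parity_part[OF clinear_ident]]
        complex_vector.span_add complex_vector.span_scale)
  qed
  moreover have "?p t = t"
    using t BC.parity_part_homogeneous[of t k k] by (simp add: eigen_grading_def)
  ultimately show "t \<in> tensor_grading (eigen_grading B) (eigen_grading C) k"
    by (simp add: tensor_grading_def)
qed

section \<open>Algebras with an element of square one\<close>

locale complex_algebra =
  fixes m :: "'a::complex_vector \<Rightarrow> 'a \<Rightarrow> 'a" (infixl \<open>\<star>\<close> 75) and e :: 'a
  assumes bilinear: "cbilinear m"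
    and assoc: "(x \<star> y) \<star> z = x \<star> (y \<star> z)"
    and unit_left [simp]: "e \<star> x = x" and unit_right [simp]: "x \<star> e = x"
begin

lemmas mult_simps = cbilinear_simps[OF bilinear]
lemmas clinear_mult_left [multilinear] = cbilinear_left[OF bilinear]
lemmas clinear_mult_right [multilinear] = cbilinear_right[OF bilinear]

end

lemma complex_algebra_tensor:
  assumes "complex_algebra m e" "complex_algebra m' e'"
  shows "complex_algebra (tensor_mult m m') (e \<otimes> e')"
proof -
  interpret V: complex_algebra m e by fact
  interpret W: complex_algebra m' e' by fact
  let ?m = "tensor_mult m m'"
  have bil: "cbilinear ?m" by (rule cbilinear_tensor_mult[OF V.bilinear W.bilinear])
  note [multilinear] = cbilinear_left[OF bil] cbilinear_right[OF bil]
  note pure = tensor_mult_tensor[OF V.bilinear W.bilinear]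
  show ?thesis
  proof
    show "cbilinear ?m" by fact
    show "?m (?m x y) z = ?m x (?m y z)" for x y z
    proof (rule tensor_eqI[where t = x])
      show "?m (?m (a \<otimes> b) y) z = ?m (a \<otimes> b) (?m y z)" for a b
      proof (rule tensor_eqI[where t = y])
        show "?m (?m (a \<otimes> b) (a' \<otimes> b')) z = ?m (a \<otimes> b) (?m (a' \<otimes> b') z)" for a' b'
          by (rule tensor_eqI[where t = z])
            (intro multilinear | simp add: pure V.assoc W.assoc)+
      qed (intro multilinear)+
    qed (intro multilinear)+
    show "?m (e \<otimes> e') x = x" "?m x (e \<otimes> e') = x" for x
      by (rule tensor_eqI[where t = x], (intro multilinear | simp add: pure)+)+
  qed
qed

definition ad :: "('a::complex_vector \<Rightarrow> 'a \<Rightarrow> 'a) \<Rightarrow> 'a \<Rightarrow> 'a \<Rightarrow> 'a" where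
  "ad m u x = m (m u x) u"

text \<open>
  On \<open>b\<close> of parity \<open>j\<close> this is \<open>a \<otimes> b \<mapsto> a u\<^sup>j \<otimes> b\<close> (\<open>bosonize_homogeneous\<close>). The second factor is
  an arbitrary space with a parity involution \<open>B\<close>, because it is a tensor square in the case of
  three factors.
\<close>

definition bosonize :: "('a::complex_vector \<Rightarrow> 'a \<Rightarrow> 'a) \<Rightarrow> 'a \<Rightarrow> ('b::complex_vector \<Rightarrow> 'b) \<Rightarrow>
    'a \<otimes> 'b \<Rightarrow> 'a \<otimes> 'b" where
  "bosonize m u B = tensor_lift (\<lambda>a b. a \<otimes> parity_part B 0 b + m a u \<otimes> parity_part B 1 b)"

locale parity_algebra = complex_algebra +
  fixes u assumes square: "u \<star> u = e"
begin

abbreviation A where "A \<equiv> ad m u"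

definition pow :: "bit \<Rightarrow> 'a" where "pow i = (if i = 0 then e else u)"

lemma pow_simps [simp]: "pow 0 = e" "pow 1 = u"
  by (simp_all add: pow_def)

lemma pow_add: "pow (i + j) = pow i \<star> pow j"
  by (rule bit_cases[of _ i]; rule bit_cases[of _ j]) (simp_all add: square)

lemma square_assoc [simp]: "u \<star> (u \<star> x) = x"
  by (simp add: square flip: assoc)

lemma pow_square [simp]: "pow i \<star> pow i = e"
  by (simp add: pow_def square)

lemma clinear_A [multilinear]: "clinear f \<Longrightarrow> clinear (\<lambda>x. A (f x))"
  unfolding ad_def by (intro multilinear)

lemma A_mult: "A (x \<star> y) = A x \<star> A y"
  by (simp add: ad_def assoc)

lemma A_A: "A (A x) = x"
  by (simp add: ad_def assoc square)

lemma A_pow [simp]: "A e = e" "A u = u" "A (pow i) = pow i"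
  by (simp_all add: ad_def assoc square pow_def)

lemma involution_A: "involution A"
  by (rule involution.intro) (simp_all add: A_A clinear_A clinear_ident)

lemma homogeneous_commute:
  assumes "A x = parity_sign i *\<^sub>C x" shows "u \<star> x = parity_sign i *\<^sub>C (x \<star> u)"
proof -
  have "u \<star> x = A x \<star> u" by (simp add: ad_def assoc square)
  then show ?thesis by (simp add: assms mult_simps)
qed

text \<open>
  The source of every sign: \<open>u\<close> anticommutes with odd elements.
\<close>

lemma pow_commute:
  assumes "A x = parity_sign i *\<^sub>C x" shows "pow j \<star> x = parity_sign (i * j) *\<^sub>C (x \<star> pow j)"
  by (rule bit_cases[of _ j]) (simp_all add: scaleC_one homogeneous_commute[OF assms])

lemma homogeneous_pow:
  assumes "A x = parity_sign i *\<^sub>C x"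
  shows "A (x \<star> pow j) = parity_sign i *\<^sub>C (x \<star> pow j)" "A (pow j \<star> x) = parity_sign i *\<^sub>C (pow j \<star> x)"
  by (simp_all add: A_mult assms mult_simps)

lemma clinear_bosonize [multilinear]:
  assumes "involution B" "clinear f" shows "clinear (\<lambda>x. bosonize m u B (f x))"
proof -
  interpret involution B by fact
  show ?thesis unfolding bosonize_def by (intro multilinear assms)
qed

lemma bosonize_homogeneous:
  assumes "involution B" "B b = parity_sign j *\<^sub>C b"
  shows "bosonize m u B (a \<otimes> b) = (a \<star> pow j) \<otimes> b"
proof -
  interpret involution B by fact
  have "bosonize m u B (a \<otimes> b) = a \<otimes> parity_part B 0 b + (a \<star> u) \<otimes> parity_part B 1 b"
    unfolding bosonize_def by (rule tensor_lift_tensor) (intro multilinear)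
  then show ?thesis
    by (simp add: parity_part_homogeneous[OF assms(2)] tensor_simps pow_def)
qed

lemma bosonize_bosonize:
  assumes "involution B" shows "bosonize m u B (bosonize m u B t) = t"
proof (rule tensor_homogeneous_eqI[OF involution_A assms, where t = t])
  fix a b i j
  assume "B b = parity_sign j *\<^sub>C b"
  then show "bosonize m u B (bosonize m u B (a \<otimes> b)) = a \<otimes> b"
    by (simp add: bosonize_homogeneous[OF assms, of _ j] assoc)
qed (intro multilinear assms)+

lemma bosonize_natural:
  assumes "involution B" "involution C" "clinear f" "\<And>x. f (B x) = C (f x)"
  shows "tensor_map id f (bosonize m u B t) = bosonize m u C (tensor_map id f t)"
proof (rule tensor_homogeneous_eqI[OF involution_A assms(1), where t = t])
  fix a b i j
  assume b: "B b = parity_sign j *\<^sub>C b"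
  then have fb: "C (f b) = parity_sign j *\<^sub>C f b"
    by (simp flip: assms(4) add: clinear_scaleC[OF assms(3)])
  then show "tensor_map id f (bosonize m u B (a \<otimes> b)) = bosonize m u C (tensor_map id f (a \<otimes> b))"
    by (simp add: bosonize_homogeneous[OF assms(1) b] bosonize_homogeneous[OF assms(2) fb]
      tensor_map_tensor clinear_id assms(3))
qed (intro multilinear assms)+

lemma cbilinear_super_tensor_mult:
  assumes "involution B" "cbilinear m'"
  shows "cbilinear (super_tensor_mult (eigen_grading A) m (eigen_grading B) m')"
proof -
  interpret B: involution B by fact
  interpret A: involution A by (rule involution_A)
  note [multilinear] = cbilinear_left[OF assms(2)] cbilinear_right[OF assms(2)]
  show ?thesis
    unfolding super_tensor_mult_def A.component_eigen B.component_eigen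
    by simp (intro multilinear)
qed

lemma super_tensor_mult_homogeneous:
  assumes "involution B" "cbilinear m'" "A a' = parity_sign i *\<^sub>C a'" "B b = parity_sign j *\<^sub>C b"
  shows "super_tensor_mult (eigen_grading A) m (eigen_grading B) m' (a \<otimes> b) (a' \<otimes> b') =
    parity_sign (i * j) *\<^sub>C ((a \<star> a') \<otimes> m' b b')"
proof -
  interpret B: involution B by fact
  interpret A: involution A by (rule involution_A)
  note [multilinear] = cbilinear_left[OF assms(2)] cbilinear_right[OF assms(2)]
  have "super_tensor_mult (eigen_grading A) m (eigen_grading B) m' (a \<otimes> b) (a' \<otimes> b') =
    (\<Sum>i\<in>{0, 1}. \<Sum>j\<in>{0, 1}. parity_sign (i * j) *\<^sub>C
      (a \<star> parity_part A i a' \<otimes> m' (parity_part B j b) b'))"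
    unfolding super_tensor_mult_def A.component_eigen B.component_eigen
    by (subst tensor_lift_tensor, simp, intro multilinear,
        subst tensor_lift_tensor, simp, intro multilinear) simp
  then show ?thesis
    by (cases "i = 0"; cases "j = 0")
      (simp_all add: A.parity_part_homogeneous[OF assms(3)] B.parity_part_homogeneous[OF assms(4)]
      mult_simps tensor_simps cbilinear_simps[OF assms(2)])
qed

text \<open>
  In the product of \<open>a u\<^sup>j \<otimes> b\<close> and \<open>a' u\<^bsup>j'\<^esup> \<otimes> b'\<close> the factor \<open>u\<^sup>j\<close> has to pass \<open>a'\<close>; this costs
  \<open>(-1)\<^bsup>p(a')j\<^esup>\<close>, which is the sign of the product of superalgebras.
\<close>

lemma bosonize_mult:
  assumes B: "involution B" and m': "cbilinear m'" and hom: "\<And>x y. B (m' x y) = m' (B x) (B y)"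
  shows "bosonize m u B (super_tensor_mult (eigen_grading A) m (eigen_grading B) m' s t) =
    tensor_mult m m' (bosonize m u B s) (bosonize m u B t)"
proof -
  note bil = cbilinear_super_tensor_mult[OF B m'] cbilinear_tensor_mult[OF bilinear m']
  note [multilinear] = bil[THEN cbilinear_left] bil[THEN cbilinear_right]
  show ?thesis
  proof (rule tensor_homogeneous_eqI[OF involution_A B, where t = s])
    fix a b i j
    assume b: "B b = parity_sign j *\<^sub>C b"
    show "bosonize m u B (super_tensor_mult (eigen_grading A) m (eigen_grading B) m' (a \<otimes> b) t) =
      tensor_mult m m' (bosonize m u B (a \<otimes> b)) (bosonize m u B t)"
    proof (rule tensor_homogeneous_eqI[OF involution_A B, where t = t])
      fix a' b' i' j'
      assume a': "A a' = parity_sign i' *\<^sub>C a'" and b': "B b' = parity_sign j' *\<^sub>C b'"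
      have "B (m' b b') = parity_sign (j + j') *\<^sub>C m' b b'"
        unfolding parity_sign_add by (simp add: hom b b' cbilinear_simps[OF m'] scaleC_scaleC mult.commute)
      note bb' = bosonize_homogeneous[OF B this]
      have "a \<star> pow j \<star> (a' \<star> pow j') = parity_sign (i' * j) *\<^sub>C (a \<star> a' \<star> pow (j + j'))"
      proof -
        have "a \<star> pow j \<star> (a' \<star> pow j') = a \<star> (pow j \<star> a') \<star> pow j'"
          by (simp only: assoc)
        then show ?thesis
          unfolding pow_add by (simp add: pow_commute[OF a'] mult_simps assoc)
      qed
      then show "bosonize m u B (super_tensor_mult (eigen_grading A) m (eigen_grading B) m' (a \<otimes> b) (a' \<otimes> b')) =
        tensor_mult m m' (bosonize m u B (a \<otimes> b)) (bosonize m u B (a' \<otimes> b'))"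
        unfolding super_tensor_mult_homogeneous[OF B m' a' b] bosonize_homogeneous[OF B b]
          bosonize_homogeneous[OF B b'] clinear_scaleC[OF clinear_bosonize[OF B clinear_ident]] bb'
        by (simp add: tensor_mult_tensor[OF bilinear m'] tensor_simps)
    qed (intro multilinear B)+
  qed (intro multilinear B)+
qed

lemma braiding_homogeneous:
  assumes "A a = parity_sign i *\<^sub>C a" "A b = parity_sign j *\<^sub>C b"
  shows "braiding (eigen_grading A) (eigen_grading A) (a \<otimes> b) = parity_sign (i * j) *\<^sub>C (b \<otimes> a)"
proof -
  interpret A: involution A by (rule involution_A)
  have "braiding (eigen_grading A) (eigen_grading A) (a \<otimes> b) =
      (\<Sum>i\<in>{0, 1}. \<Sum>j\<in>{0, 1}. parity_sign (i * j) *\<^sub>C (parity_part A j b \<otimes> parity_part A i a))"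
    unfolding braiding_def A.component_eigen
    by (subst tensor_lift_tensor, simp, intro multilinear) simp
  then show ?thesis
    by (cases "i = 0"; cases "j = 0")
      (simp_all add: A.parity_part_homogeneous[OF assms(1)] A.parity_part_homogeneous[OF assms(2)]
        tensor_simps)
qed

lemma clinear_braiding [multilinear]:
  "clinear f \<Longrightarrow> clinear (\<lambda>x. braiding (eigen_grading A) (eigen_grading A) (f x))"
proof -
  interpret A: involution A by (rule involution_A)
  show "clinear f \<Longrightarrow> clinear (\<lambda>x. braiding (eigen_grading A) (eigen_grading A) (f x))"
    unfolding braiding_def A.component_eigen by simp (intro multilinear)
qed

end

section \<open>Products on tensor powers\<close>

lemma clinear_leg13 [multilinear]:
  "clinear f \<Longrightarrow> clinear (\<lambda>x. tensor_map id (\<lambda>b. e \<otimes> b) (f x))"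
  by (rule clinear_tensor_map; (intro multilinear)?)

lemma clinear_leg12 [multilinear]:
  "clinear f \<Longrightarrow> clinear (\<lambda>x. tensor_map id (\<lambda>b. b \<otimes> e) (f x))"
  by (rule clinear_tensor_map; (intro multilinear)?)

lemma leg_tensor:
  "tensor_map id (\<lambda>b. e \<otimes> b) (a \<otimes> b) = a \<otimes> e \<otimes> b"
  "tensor_map id (\<lambda>b. b \<otimes> e) (a \<otimes> b) = a \<otimes> b \<otimes> e"
  by (simp_all add: tensor_map_tensor multilinear)

lemma tensor_map_mult:
  assumes "cbilinear m" "cbilinear m'" "cbilinear n" "cbilinear n'" "clinear f" "clinear g"
    and f: "\<And>x y. f (m x y) = n (f x) (f y)" and g: "\<And>x y. g (m' x y) = n' (g x) (g y)"
  shows "tensor_map f g (tensor_mult m m' s t) =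
    tensor_mult n n' (tensor_map f g s) (tensor_map f g t)"
proof -
  note bil = cbilinear_tensor_mult[OF assms(1,2)] cbilinear_tensor_mult[OF assms(3,4)]
  note [multilinear] = bil[THEN cbilinear_left] bil[THEN cbilinear_right]
  note pure = tensor_mult_tensor[OF assms(1,2)] tensor_mult_tensor[OF assms(3,4)]
    tensor_map_tensor[OF assms(5,6)]
  show ?thesis
  proof (rule tensor_eqI[where t = s])
    show "tensor_map f g (tensor_mult m m' (a \<otimes> b) t) =
      tensor_mult n n' (tensor_map f g (a \<otimes> b)) (tensor_map f g t)" for a b
      by (rule tensor_eqI[where t = t]) (intro multilinear assms | simp add: pure f g)+
  qed (intro multilinear assms)+
qed

context complex_algebra
begin

abbreviation m2 where "m2 \<equiv> tensor_mult m m"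
abbreviation m3 where "m3 \<equiv> tensor_mult m m2"
abbreviation L12 where "L12 \<equiv> tensor_map id (\<lambda>b. b \<otimes> e)"
abbreviation L13 where "L13 \<equiv> tensor_map id (\<lambda>b. e \<otimes> b)"
abbreviation L23 where "L23 R \<equiv> e \<otimes> R"

lemma algebra2: "complex_algebra m2 (e \<otimes> e)"
  by (rule complex_algebra_tensor) unfold_locales

lemma algebra3: "complex_algebra m3 (e \<otimes> e \<otimes> e)"
  by (rule complex_algebra_tensor[OF _ algebra2]) unfold_locales

lemmas bilinear2 = cbilinear_tensor_mult[OF bilinear bilinear]
lemmas bilinear3 = cbilinear_tensor_mult[OF bilinear bilinear2]
lemmas clinear_mult2 [multilinear] = cbilinear_left[OF bilinear2] cbilinear_right[OF bilinear2]
lemmas clinear_mult3 [multilinear] = cbilinear_left[OF bilinear3] cbilinear_right[OF bilinear3]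
lemmas mult2_tensor = tensor_mult_tensor[OF bilinear bilinear]
lemmas mult3_tensor = tensor_mult_tensor[OF bilinear bilinear2]

lemma leg12_mult: "L12 (m2 s t) = m3 (L12 s) (L12 t)"
  by (rule tensor_map_mult[OF bilinear bilinear bilinear bilinear2])
    (simp_all add: multilinear mult2_tensor)

lemma leg13_mult: "L13 (m2 s t) = m3 (L13 s) (L13 t)"
  by (rule tensor_map_mult[OF bilinear bilinear bilinear bilinear2])
    (simp_all add: multilinear mult2_tensor)

lemma leg23_mult: "L23 (m2 s t) = m3 (L23 s) (L23 t)"
  by (simp add: mult3_tensor)

lemma flip_mult: "flip (m2 s t) = m2 (flip s) (flip t)"
proof (rule tensor_eqI[where t = s])
  show "flip (m2 (a \<otimes> b) t) = m2 (flip (a \<otimes> b)) (flip t)" for a b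
    by (rule tensor_eqI[where t = t]) (intro multilinear | simp add: mult2_tensor flip_tensor)+
qed (intro multilinear)+

lemma assoc_mult: "tensor_assoc (tensor_mult m2 m s t) = m3 (tensor_assoc s) (tensor_assoc t)"
proof -
  note bil = cbilinear_tensor_mult[OF bilinear2 bilinear]
  note [multilinear] = bil[THEN cbilinear_left] bil[THEN cbilinear_right]
  note pure = tensor_assoc_tensor mult2_tensor mult3_tensor tensor_mult_tensor[OF bilinear2 bilinear]
  show ?thesis
  proof (rule tensor_eqI[where t = s])
    fix r c
    show "tensor_assoc (tensor_mult m2 m (r \<otimes> c) t) = m3 (tensor_assoc (r \<otimes> c)) (tensor_assoc t)"
    proof (rule tensor_eqI[where t = t])
      fix r' c'
      show "tensor_assoc (tensor_mult m2 m (r \<otimes> c) (r' \<otimes> c')) =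
          m3 (tensor_assoc (r \<otimes> c)) (tensor_assoc (r' \<otimes> c'))"
      proof (rule tensor_eqI[where t = r])
        fix a b
        show "tensor_assoc (tensor_mult m2 m ((a \<otimes> b) \<otimes> c) (r' \<otimes> c')) =
          m3 (tensor_assoc ((a \<otimes> b) \<otimes> c)) (tensor_assoc (r' \<otimes> c'))"
          by (rule tensor_eqI[where t = r']) (intro multilinear | simp add: pure)+
      qed (intro multilinear)+
    qed (intro multilinear)+
  qed (intro multilinear)+
qed

lemma leg12_mult_tensor: "m3 (L12 s) (a \<otimes> b \<otimes> c) = tensor_assoc (m2 s (a \<otimes> b) \<otimes> c)"
proof (rule tensor_eqI[where t = s])
  show "m3 (L12 (x \<otimes> y)) (a \<otimes> b \<otimes> c) = tensor_assoc (m2 (x \<otimes> y) (a \<otimes> b) \<otimes> c)" for x y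
    by (simp add: leg_tensor mult2_tensor mult3_tensor tensor_assoc_tensor)
qed (intro multilinear)+

lemma tensor_mult_leg12: "m3 (a \<otimes> b \<otimes> c) (L12 s) = tensor_assoc (m2 (a \<otimes> b) s \<otimes> c)"
proof (rule tensor_eqI[where t = s])
  show "m3 (a \<otimes> b \<otimes> c) (L12 (x \<otimes> y)) = tensor_assoc (m2 (a \<otimes> b) (x \<otimes> y) \<otimes> c)" for x y
    by (simp add: leg_tensor mult2_tensor mult3_tensor tensor_assoc_tensor)
qed (intro multilinear)+

end

context parity_algebra
begin

abbreviation A2 where "A2 \<equiv> tensor_map A A"
abbreviation sm2 where "sm2 \<equiv> super_tensor_mult (eigen_grading A) m (eigen_grading A) m"
abbreviation sm3 where
  "sm3 \<equiv> super_tensor_mult (eigen_grading A) m (tensor_grading (eigen_grading A) (eigen_grading A)) sm2"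
abbreviation \<beta> where "\<beta> \<equiv> braiding (eigen_grading A) (eigen_grading A)"
abbreviation \<theta> where "\<theta> \<equiv> bosonize m u A"

text \<open>
  On homogeneous elements \<open>a \<otimes> b \<otimes> c \<mapsto> a u\<^bsup>p(b)+p(c)\<^esup> \<otimes> b u\<^bsup>p(c)\<^esup> \<otimes> c\<close>: each factor collects one \<open>u\<close>
  for every odd factor to its right.
\<close>

definition \<theta>3 where "\<theta>3 t = tensor_map id \<theta> (bosonize m u A2 t)"

lemma linear_A: "clinear A"
  by (rule clinear_A[OF clinear_ident])

lemma A2_tensor: "A2 (a \<otimes> b) = A a \<otimes> A b"
  by (simp add: tensor_map_tensor linear_A)

lemmas involution_A2 = involution_tensor[OF involution_A involution_A]

lemma clinear_theta [multilinear]: "clinear f \<Longrightarrow> clinear (\<lambda>x. \<theta> (f x))"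
  by (rule clinear_bosonize[OF involution_A])

lemma linear_theta: "clinear \<theta>"
  by (rule clinear_theta[OF clinear_ident])

lemma clinear_theta3 [multilinear]: "clinear f \<Longrightarrow> clinear (\<lambda>x. \<theta>3 (f x))"
  unfolding \<theta>3_def by (intro multilinear involution_A2)

lemma clinear_A2 [multilinear]: "clinear f \<Longrightarrow> clinear (\<lambda>x. A2 (f x))"
  by (intro multilinear)

lemmas theta_theta = bosonize_bosonize[OF involution_A]
lemmas theta_homogeneous = bosonize_homogeneous[OF involution_A]
lemmas bilinear_super2 = cbilinear_super_tensor_mult[OF involution_A bilinear]
lemmas super2_homogeneous = super_tensor_mult_homogeneous[OF involution_A bilinear]
lemmas clinear_super2 [multilinear] = cbilinear_left[OF bilinear_super2] cbilinear_right[OF bilinear_super2]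

lemma A2_mult: "A2 (m2 s t) = m2 (A2 s) (A2 t)"
  by (rule tensor_map_mult) (rule bilinear linear_A A_mult)+

lemma A2_theta: "A2 (\<theta> t) = \<theta> (A2 t)"
proof (rule tensor_homogeneous_eqI[OF involution_A involution_A, where t = t])
  fix a b i j
  assume a: "A a = parity_sign i *\<^sub>C a" and b: "A b = parity_sign j *\<^sub>C b"
  show "A2 (\<theta> (a \<otimes> b)) = \<theta> (A2 (a \<otimes> b))"
    by (simp add: theta_homogeneous[OF b] A2_tensor a b homogeneous_pow[OF a] tensor_simps
      clinear_scaleC[OF linear_theta])
qed (intro multilinear)+

lemma theta_mult: "\<theta> (sm2 s t) = m2 (\<theta> s) (\<theta> t)"
  by (rule bosonize_mult) (rule bilinear involution_A A_mult)+

lemma super2_eq: "sm2 s t = \<theta> (m2 (\<theta> s) (\<theta> t))"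
  by (simp flip: theta_mult add: theta_theta)

lemma A2_super2: "A2 (sm2 s t) = sm2 (A2 s) (A2 t)"
  by (simp add: super2_eq A2_theta A2_mult)

lemma theta3_mult: "\<theta>3 (sm3 s t) = m3 (\<theta>3 s) (\<theta>3 t)"
proof -
  have "bosonize m u A2 (sm3 s t) =
      tensor_mult m sm2 (bosonize m u A2 s) (bosonize m u A2 t)"
    unfolding tensor_grading_eigen[OF involution_A involution_A]
    by (rule bosonize_mult) (rule involution_A2 bilinear_super2 A2_super2)+
  then show ?thesis
    unfolding \<theta>3_def
    by (simp add: tensor_map_mult[where f = id and g = \<theta>, OF bilinear bilinear_super2 bilinear
      bilinear2 clinear_id linear_theta] theta_mult)
qed

lemma theta3_homogeneous:
  assumes b: "A b = parity_sign j *\<^sub>C b" and c: "A c = parity_sign k *\<^sub>C c"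
  shows "\<theta>3 (a \<otimes> b \<otimes> c) = (a \<star> (pow j \<star> pow k)) \<otimes> (b \<star> pow k) \<otimes> c"
proof -
  have "A2 (b \<otimes> c) = parity_sign (j + k) *\<^sub>C (b \<otimes> c)"
    unfolding parity_sign_add
    by (simp add: A2_tensor b c tensor_simps scaleC_scaleC mult.commute)
  from bosonize_homogeneous[OF involution_A2 this]
  show ?thesis
    unfolding pow_add by (simp add: \<theta>3_def tensor_map_tensor clinear_id linear_theta theta_homogeneous[OF c])
qed

lemma pow_pow_commute: "pow i \<star> pow j = pow j \<star> pow i"
  by (simp add: pow_def)

lemma theta3_theta3: "\<theta>3 (\<theta>3 t) = t"
proof (rule tensor_eqI[where t = t])
  fix a s
  show "\<theta>3 (\<theta>3 (a \<otimes> s)) = a \<otimes> s"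
  proof (rule tensor_homogeneous_eqI[OF involution_A involution_A, where t = s])
    fix b c i j
    assume b: "A b = parity_sign i *\<^sub>C b" and c: "A c = parity_sign j *\<^sub>C c"
    have "a \<star> (pow i \<star> pow j) \<star> (pow i \<star> pow j) = a \<star> ((pow i \<star> pow i) \<star> (pow j \<star> pow j))"
      by (metis assoc pow_pow_commute)
    then show "\<theta>3 (\<theta>3 (a \<otimes> b \<otimes> c)) = a \<otimes> b \<otimes> c"
      by (simp add: theta3_homogeneous[OF b c] theta3_homogeneous[OF homogeneous_pow(1)[OF b] c] assoc)
  qed (intro multilinear)+
qed (intro multilinear)+

text \<open>
  Applying a parity preserving comultiplication to the second factor commutes with \<open>\<theta>\<close>. This and
  \<open>theta_comult_left\<close> say that both ways of iterating \<open>\<theta> \<circ> D\<close> are \<open>\<theta>3\<close> of the corresponding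
  iteration of \<open>D\<close>; thus coassociativity passes from \<open>D\<close> to \<open>\<theta> \<circ> D\<close>.
\<close>

lemma theta_comult_right:
  assumes D: "clinear D" and DA: "\<And>x. D (A x) = A2 (D x)"
  shows "tensor_map id (\<lambda>x. \<theta> (D x)) (\<theta> t) = \<theta>3 (tensor_map id D t)"
proof -
  have "tensor_map id (\<lambda>x. \<theta> (D x)) (\<theta> t) = tensor_map id \<theta> (tensor_map id D (\<theta> t))"
    unfolding id_def
    by (simp add: tensor_map_compose clinear_ident linear_theta D clinear_compose[OF linear_theta D])
  then show ?thesis
    by (simp add: bosonize_natural[where f = D, OF involution_A involution_A2 D] DA \<theta>3_def)
qed

text \<open>
  The factor \<open>u\<^bsup>p(b)\<^esup>\<close> sits inside the argument of \<open>D\<close> and is spread over two factors because \<open>u\<close> is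
  grouplike. The hypothesis \<open>D(x u) = D(x) (u \<otimes> u)\<close>, in the product without signs, holds for Hopf
  algebras and, \<open>u\<close> being even, for Hopf superalgebras.
\<close>

lemma theta_comult_left:
  assumes D: "clinear D" and Du: "\<And>x. D (x \<star> u) = m2 (D x) (u \<otimes> u)"
  shows "tensor_assoc (tensor_map (\<lambda>x. \<theta> (D x)) id (\<theta> t)) = \<theta>3 (tensor_assoc (tensor_map D id t))"
proof (rule tensor_homogeneous_eqI[OF involution_A involution_A, where t = t])
  interpret T: complex_algebra m2 "e \<otimes> e" by (rule algebra2)
  note linD = clinear_compose[OF linear_theta D]
  show "clinear (\<lambda>t. tensor_assoc (tensor_map (\<lambda>x. \<theta> (D x)) id (\<theta> t)))"
    by (intro multilinear linD)
  show "clinear (\<lambda>t. \<theta>3 (tensor_assoc (tensor_map D id t)))"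
    by (intro multilinear D)
  fix a b i j
  assume b: "A b = parity_sign j *\<^sub>C b"
  have D_pow: "D (a \<star> pow j) = m2 (D a) (pow j \<otimes> pow j)"
    by (cases "j = 0") (simp_all add: Du)
  have "tensor_assoc (\<theta> (m2 s (pow j \<otimes> pow j)) \<otimes> b) = \<theta>3 (tensor_assoc (s \<otimes> b))" for s
  proof (rule tensor_homogeneous_eqI[OF involution_A involution_A, where t = s])
    fix x y k l
    assume y: "A y = parity_sign k *\<^sub>C y"
    have "tensor_assoc (\<theta> (m2 (x \<otimes> y) (pow j \<otimes> pow j)) \<otimes> b) =
        (x \<star> pow j \<star> pow k) \<otimes> (y \<star> pow j) \<otimes> b"
      by (simp add: mult2_tensor theta_homogeneous[OF homogeneous_pow(1)[OF y]] tensor_assoc_tensor)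
    also have "\<dots> = \<theta>3 (tensor_assoc ((x \<otimes> y) \<otimes> b))"
      by (simp add: tensor_assoc_tensor theta3_homogeneous[OF y b] assoc pow_pow_commute)
    finally show "tensor_assoc (\<theta> (m2 (x \<otimes> y) (pow j \<otimes> pow j)) \<otimes> b) =
        \<theta>3 (tensor_assoc ((x \<otimes> y) \<otimes> b))" .
  qed (intro multilinear)+
  then show "tensor_assoc (tensor_map (\<lambda>x. \<theta> (D x)) id (\<theta> (a \<otimes> b))) =
      \<theta>3 (tensor_assoc (tensor_map D id (a \<otimes> b)))"
    by (simp add: theta_homogeneous[OF b] tensor_map_tensor linD clinear_id D D_pow)
qed

section \<open>The triangular structure of the group of order two\<close>

text \<open>
  If \<open>e\<^sub>0\<close>, \<open>e\<^sub>1\<close> are the idempotents on which \<open>u\<close> is \<open>1\<close>, \<open>-1\<close>, then \<open>J\<close> is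
  \<open>\<Sum> (-1)\<^bsup>ij\<^esup> e\<^sub>i \<otimes> e\<^sub>j\<close>: it acts on a tensor product of supermodules by the sign of the braiding.
\<close>

definition J where "J = (1/2) *\<^sub>C (e \<otimes> e + e \<otimes> u + u \<otimes> e - u \<otimes> u)"

lemmas mult2_simps = cbilinear_simps[OF bilinear2]
lemmas mult3_simps = cbilinear_simps[OF bilinear3]

lemma flip_J: "flip J = J"
proof -
  have "clinear (flip :: 'a \<otimes> 'a \<Rightarrow> _)" by (intro multilinear)
  then show ?thesis
    by (simp add: J_def clinear_add clinear_diff clinear_scaleC flip_tensor add.assoc
      add.commute[of "u \<otimes> e"])
qed

lemma quarter_quadruple: "(1/2) *\<^sub>C ((1/2) *\<^sub>C (x + x + x + x)) = (x::'x::complex_vector)"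
  by (simp only: half_double add.assoc[of "x + x" x x])

lemma J_square: "m2 J J = e \<otimes> e"
proof -
  have "m2 J J = (1/2) *\<^sub>C ((1/2) *\<^sub>C (e \<otimes> e + e \<otimes> e + e \<otimes> e + e \<otimes> e))"
    unfolding J_def by (simp only: mult2_simps mult2_tensor square unit_left unit_right)
      (simp add: algebra_simps)
  then show ?thesis by (simp only: quarter_quadruple)
qed

lemma J_commute:
  assumes a: "A a = parity_sign i *\<^sub>C a" and b: "A b = parity_sign j *\<^sub>C b"
  shows "m2 J (b \<otimes> a) = parity_sign (i * j) *\<^sub>C m2 ((b \<star> pow i) \<otimes> (a \<star> pow j)) J"
  unfolding J_def mult2_simps mult2_tensor homogeneous_commute[OF a] homogeneous_commute[OF b]
  by (cases "i = 0"; cases "j = 0")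
    (simp_all add: assoc square tensor_simps scaleC_one mult_simps algebra_simps)

text \<open>
  Both the braiding with signs, read through \<open>\<theta>\<close>, and the flip conjugated by \<open>J\<close> send \<open>a \<otimes> b\<close> to
  \<open>(-1)\<^bsup>p(a)p(b)\<^esup> b u\<^bsup>p(a)\<^esup> \<otimes> a u\<^bsup>p(b)\<^esup>\<close>.
\<close>

lemma theta_braiding: "\<theta> (\<beta> (\<theta> t)) = m2 (m2 J (flip t)) J"
proof (rule tensor_homogeneous_eqI[OF involution_A involution_A, where t = t])
  interpret T: complex_algebra m2 "e \<otimes> e" by (rule algebra2)
  fix a b i j
  assume a: "A a = parity_sign i *\<^sub>C a" and b: "A b = parity_sign j *\<^sub>C b"
  note au = homogeneous_pow(1)[OF a, of j]
  have "\<theta> (\<beta> (\<theta> (a \<otimes> b))) = parity_sign (i * j) *\<^sub>C ((b \<star> pow i) \<otimes> (a \<star> pow j))"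
    by (simp add: theta_homogeneous[OF b] braiding_homogeneous[OF au b]
      clinear_scaleC[OF linear_theta] theta_homogeneous[OF au])
  also have "\<dots> = m2 (m2 J (flip (a \<otimes> b))) J"
    by (simp add: flip_tensor J_commute[OF a b] mult2_simps T.assoc J_square)
  finally show "\<theta> (\<beta> (\<theta> (a \<otimes> b))) = m2 (m2 J (flip (a \<otimes> b))) J" .
qed (intro multilinear)+

end

lemma (in complex_algebra) square_left_cancel: "w \<star> w = e \<Longrightarrow> w \<star> x = w \<star> y \<longleftrightarrow> x = y"
  by (metis assoc unit_left)

context parity_algebra
begin

lemma theta3_leg12: "\<theta>3 (L12 t) = L12 (\<theta> t)"
proof (rule tensor_homogeneous_eqI[OF involution_A involution_A, where t = t])
  fix a b i j
  assume b: "A b = parity_sign j *\<^sub>C b"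
  have "A e = parity_sign 0 *\<^sub>C e" by (simp add: scaleC_one)
  from theta3_homogeneous[OF b this] show "\<theta>3 (L12 (a \<otimes> b)) = L12 (\<theta> (a \<otimes> b))"
    by (simp add: leg_tensor theta_homogeneous[OF b])
qed (intro multilinear)+

text \<open>
  For even \<open>t = \<Sum> a \<otimes> b\<close> the factors \<open>u\<^bsup>p(a)+p(b)\<^esup>\<close> that \<open>\<theta>3\<close> puts in the first place are trivial.
\<close>

lemma theta3_leg23:
  assumes "A2 t = t" shows "\<theta>3 (L23 t) = L23 (\<theta> t)"
proof -
  have "A2 t = parity_sign 0 *\<^sub>C t" by (simp add: assms scaleC_one)
  from bosonize_homogeneous[OF involution_A2 this] show ?thesis
    by (simp add: \<theta>3_def tensor_map_tensor clinear_id linear_theta)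
qed

lemma theta3_leg13_homogeneous:
  assumes b: "A b = parity_sign j *\<^sub>C b"
  shows "\<theta>3 (a \<otimes> e \<otimes> b) = (a \<star> pow j) \<otimes> pow j \<otimes> b"
proof -
  have "A e = parity_sign 0 *\<^sub>C e" by (simp add: scaleC_one)
  from theta3_homogeneous[OF this b] show ?thesis by simp
qed

text \<open>
  Inserting \<open>1\<close> between the factors is the one leg embedding that does not commute with \<open>\<theta>\<close>: \<open>\<theta>3\<close>
  leaves \<open>u\<^bsup>p(b)\<^esup>\<close> in the middle place. Conjugation by \<open>J\<close> in the places 2 and 3 has the same
  effect, and so does, on even tensors, conjugation by \<open>J\<close> in the places 1 and 2
  (\<open>theta3_leg13_leg12_J\<close>). These two forms serve the two hexagon axioms.
\<close>

lemma theta3_leg13_leg23_J: "m3 (\<theta>3 (L13 t)) (L23 J) = m3 (L23 J) (L13 (\<theta> t))"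
proof (rule tensor_homogeneous_eqI[OF involution_A involution_A, where t = t])
  fix a b i j
  assume b: "A b = parity_sign j *\<^sub>C b"
  have "A e = parity_sign 0 *\<^sub>C e" by (simp add: scaleC_one)
  from J_commute[OF b this] have "m2 J (e \<otimes> b) = m2 (pow j \<otimes> b) J" by (simp add: scaleC_one)
  then show "m3 (\<theta>3 (L13 (a \<otimes> b))) (L23 J) = m3 (L23 J) (L13 (\<theta> (a \<otimes> b)))"
    by (simp add: theta3_leg13_homogeneous[OF b] theta_homogeneous[OF b] leg_tensor mult3_tensor)
qed (intro multilinear)+

lemma theta3_leg13_leg12_J:
  assumes "A2 t = t" shows "m3 (\<theta>3 (L13 t)) (L12 J) = m3 (L12 J) (L13 (\<theta> t))"
proof (rule even_tensor_homogeneous_eqI[OF involution_A involution_A _ _ assms])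
  fix a b i
  assume a: "A a = parity_sign i *\<^sub>C a" and b: "A b = parity_sign i *\<^sub>C b"
  have "A e = parity_sign 0 *\<^sub>C e" by (simp add: scaleC_one)
  from J_commute[OF this homogeneous_pow(1)[OF a]]
  have "m2 J ((a \<star> pow i) \<otimes> e) = m2 ((a \<star> pow i) \<otimes> pow i) J" by (simp add: scaleC_one)
  then show "m3 (\<theta>3 (L13 (a \<otimes> b))) (L12 J) = m3 (L12 J) (L13 (\<theta> (a \<otimes> b)))"
    by (simp add: theta3_leg13_homogeneous[OF b] theta_homogeneous[OF b] leg_tensor
      leg12_mult_tensor tensor_mult_leg12)
qed (intro multilinear)+

lemma leg_J_square:
  "m3 (L12 J) (L12 J) = e \<otimes> e \<otimes> e" "m3 (L13 J) (L13 J) = e \<otimes> e \<otimes> e"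
  "m3 (L23 J) (L23 J) = e \<otimes> e \<otimes> e"
  by (simp_all flip: leg12_mult leg13_mult leg23_mult add: J_square leg_tensor)

text \<open>
  The hexagon axioms of the group algebra of \<open>{1, u}\<close>; they express that \<open>(i, j) \<mapsto> (-1)\<^bsup>ij\<^esup>\<close> is a
  bicharacter. The factors, which commute, are written in the order in which they are cancelled
  later.
\<close>

lemma comult_left_J:
  assumes D: "clinear D" "D e = e \<otimes> e" "D u = u \<otimes> u"
  shows "tensor_assoc (tensor_map D id J) = m3 (L23 J) (L13 J)"
proof -
  have lin: "clinear (\<lambda>t. tensor_assoc (tensor_map D id t))" "clinear L13"
    by (intro multilinear D)+
  let ?s = "e \<otimes> e + e \<otimes> u + u \<otimes> e - u \<otimes> u"
  let ?t = "e \<otimes> e \<otimes> e + e \<otimes> e \<otimes> u + u \<otimes> u \<otimes> e - u \<otimes> u \<otimes> u"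
  \<comment> \<open>Of the 16 products, 8 cancel in pairs and the rest is each term of \<open>?t\<close> twice.\<close>
  have "m3 (e \<otimes> ?s) (L13 ?s) = ?t + ?t"
    unfolding clinear_add[OF lin(2)] clinear_diff[OF lin(2)] leg_tensor
    by (simp only: mult3_simps mult3_tensor mult2_tensor square unit_left unit_right tensor_simps)
      (simp add: algebra_simps)
  then have "m3 (L23 J) (L13 J) = (1/2) *\<^sub>C ((1/2) *\<^sub>C (?t + ?t))"
    unfolding J_def clinear_scaleC[OF lin(2)] cbilinear_scale_right[OF cbilinear_tensor]
      cbilinear_scale_right[OF bilinear3] cbilinear_scale_left[OF bilinear3] by (rule arg_cong)
  then show ?thesis
    unfolding half_double J_def clinear_add[OF lin(1)] clinear_diff[OF lin(1)]
      clinear_scaleC[OF lin(1)]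
    by (simp add: tensor_map_tensor D clinear_id tensor_assoc_tensor)
qed

lemma comult_right_J:
  assumes D: "clinear D" "D e = e \<otimes> e" "D u = u \<otimes> u"
  shows "tensor_map id D J = m3 (L12 J) (L13 J)"
proof -
  have lin: "clinear (\<lambda>t. tensor_map id D t)" "clinear L13" "clinear L12"
    by (intro multilinear D)+
  let ?s = "e \<otimes> e + e \<otimes> u + u \<otimes> e - u \<otimes> u"
  let ?t = "e \<otimes> e \<otimes> e + e \<otimes> u \<otimes> u + u \<otimes> e \<otimes> e - u \<otimes> u \<otimes> u"
  \<comment> \<open>Again 8 of the 16 products cancel in pairs.\<close>
  have "m3 (L12 ?s) (L13 ?s) = ?t + ?t"
    unfolding clinear_add[OF lin(2)] clinear_diff[OF lin(2)] clinear_add[OF lin(3)]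
      clinear_diff[OF lin(3)] leg_tensor
    by (simp only: mult3_simps mult3_tensor mult2_tensor square unit_left unit_right tensor_simps)
      (simp add: algebra_simps)
  then have "m3 (L12 J) (L13 J) = (1/2) *\<^sub>C ((1/2) *\<^sub>C (?t + ?t))"
    unfolding J_def clinear_scaleC[OF lin(2)] clinear_scaleC[OF lin(3)]
      cbilinear_scale_right[OF bilinear3] cbilinear_scale_left[OF bilinear3] by (rule arg_cong)
  then show ?thesis
    unfolding half_double J_def clinear_add[OF lin(1)] clinear_diff[OF lin(1)]
      clinear_scaleC[OF lin(1)]
    by (simp add: tensor_map_tensor D clinear_id)
qed

end

section \<open>Transport of triangular structures\<close>

locale parity_bialgebra = parity_algebra +
  fixes D
  assumes linear_D: "clinear D" and D_mult: "D (x \<star> y) = m2 (D x) (D y)"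
    and D_e: "D e = e \<otimes> e" and D_u: "D u = u \<otimes> u"
begin

lemma D_A: "D (A x) = A2 (D x)"
proof -
  have "m2 (m2 (u \<otimes> u) t) (u \<otimes> u) = A2 t" for t
  proof (rule tensor_eqI[where t = t])
    show "m2 (m2 (u \<otimes> u) (a \<otimes> b)) (u \<otimes> u) = A2 (a \<otimes> b)" for a b
      by (simp add: mult2_tensor A2_tensor ad_def)
  qed (intro multilinear)+
  then show ?thesis by (simp add: ad_def D_mult D_u)
qed

definition D' where "D' x = \<theta> (D x)"

lemma comult_left_mult: "tensor_assoc (tensor_map D id (m2 s t)) =
    m3 (tensor_assoc (tensor_map D id s)) (tensor_assoc (tensor_map D id t))"
proof -
  have "tensor_map D id (m2 s t) = tensor_mult m2 m (tensor_map D id s) (tensor_map D id t)"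
    by (rule tensor_map_mult)
      (rule bilinear bilinear2 linear_D clinear_id D_mult id_apply[THEN trans] | simp)+
  then show ?thesis by (simp add: assoc_mult)
qed

lemma comult_right_mult: "tensor_map id D (m2 s t) = m3 (tensor_map id D s) (tensor_map id D t)"
  by (rule tensor_map_mult)
    (rule bilinear bilinear2 linear_D clinear_id D_mult | simp)+

context
  fixes R R' :: "'a \<otimes> 'a"
  assumes even: "A2 R = R" and R': "R' = \<theta> (m2 J R)"
begin

lemma theta_R': "\<theta> R' = m2 J R"
  by (simp add: R' theta_theta)

lemma A2_J: "A2 J = J"
proof -
  have lin: "clinear A2" by (intro multilinear)
  show ?thesis
    by (simp add: J_def clinear_add[OF lin] clinear_diff[OF lin] clinear_scaleC[OF lin] A2_tensor)
qed

lemma even_R': "A2 R' = R'"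
  by (simp add: R' A2_theta A2_mult even A2_J)

lemma theta_eq_iff: "\<theta> s = \<theta> t \<longleftrightarrow> s = t"
  by (metis theta_theta)

lemma theta3_eq_iff: "\<theta>3 s = \<theta>3 t \<longleftrightarrow> s = t"
  by (metis theta3_theta3)

text \<open>
  Under \<open>\<theta>\<close> the equation on the left becomes \<open>J flip(D h) J J R = J R (D h)\<close>.
\<close>

lemma super_quasitriangular_iff:
  "sm2 (\<beta> (D' h)) R' = sm2 R' (D' h) \<longleftrightarrow> m2 (flip (D h)) R = m2 R (D h)"
proof -
  interpret T: complex_algebra m2 "e \<otimes> e" by (rule algebra2)
  have "sm2 (\<beta> (D' h)) R' = sm2 R' (D' h) \<longleftrightarrow>
      m2 (\<theta> (\<beta> (\<theta> (D h)))) (m2 J R) = m2 (m2 J R) (D h)"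
    unfolding theta_eq_iff[symmetric, of "sm2 _ _"] theta_mult theta_R' D'_def theta_theta ..
  also have "\<dots> \<longleftrightarrow> m2 J (m2 (flip (D h)) R) = m2 J (m2 R (D h))"
    unfolding theta_braiding by (simp add: T.assoc) (simp add: J_square flip: T.assoc[of J J])
  also have "\<dots> \<longleftrightarrow> m2 (flip (D h)) R = m2 R (D h)"
    by (metis J_square T.assoc T.unit_left)
  finally show ?thesis .
qed

text \<open>
  Under \<open>\<theta>3\<close> the two sides on the left become \<open>J\<^sub>2\<^sub>3 J\<^sub>1\<^sub>3\<close> times the two sides on the right: one side
  because \<open>J\<close> satisfies the hexagon axiom, the other because moving \<open>J\<^sub>2\<^sub>3\<close> through the 13 leg
  removes the correction left by \<open>\<theta>3\<close>.
\<close>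

lemma super_comult_left_iff:
  "tensor_assoc (tensor_map D' id R') = sm3 (L13 R') (L23 R') \<longleftrightarrow>
    tensor_assoc (tensor_map D id R) = m3 (L13 R) (L23 R)"
proof -
  interpret T: complex_algebra m3 "e \<otimes> e \<otimes> e" by (rule algebra3)
  have "\<theta>3 (tensor_assoc (tensor_map D' id R')) = tensor_assoc (tensor_map D id (m2 J R))"
    unfolding D'_def[abs_def] R'
    unfolding theta_comult_left[OF linear_D D_mult[of _ u, unfolded D_u]] by (rule theta3_theta3)
  then have left: "\<theta>3 (tensor_assoc (tensor_map D' id R')) =
      m3 (L23 J) (m3 (L13 J) (tensor_assoc (tensor_map D id R)))"
    by (simp add: comult_left_mult comult_left_J[OF linear_D D_e D_u] T.assoc)
  have "\<theta>3 (sm3 (L13 R') (L23 R')) = m3 (m3 (\<theta>3 (L13 R')) (L23 J)) (L23 R)"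
    by (simp add: theta3_mult theta3_leg23[OF even_R'] theta_R' leg23_mult T.assoc)
  also have "\<dots> = m3 (L23 J) (m3 (L13 J) (m3 (L13 R) (L23 R)))"
    by (simp add: theta3_leg13_leg23_J theta_R' leg13_mult T.assoc)
  finally have right: "\<theta>3 (sm3 (L13 R') (L23 R')) = m3 (L23 J) (m3 (L13 J) (m3 (L13 R) (L23 R)))" .
  show ?thesis
    unfolding theta3_eq_iff[symmetric, of "tensor_assoc _"] left right
    unfolding T.square_left_cancel[OF leg_J_square(3)] T.square_left_cancel[OF leg_J_square(2)]
      T.square_left_cancel[OF leg_J_square(1)] theta3_eq_iff ..
qed

text \<open>
  As before, with common factor \<open>J\<^sub>1\<^sub>2 J\<^sub>1\<^sub>3\<close>.
\<close>

lemma super_comult_right_iff: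
  "tensor_map id D' R' = sm3 (L13 R') (L12 R') \<longleftrightarrow> tensor_map id D R = m3 (L13 R) (L12 R)"
proof -
  interpret T: complex_algebra m3 "e \<otimes> e \<otimes> e" by (rule algebra3)
  have "\<theta>3 (tensor_map id D' R') = tensor_map id D (m2 J R)"
    unfolding D'_def[abs_def] R'
    unfolding theta_comult_right[OF linear_D D_A] by (rule theta3_theta3)
  then have left: "\<theta>3 (tensor_map id D' R') = m3 (L12 J) (m3 (L13 J) (tensor_map id D R))"
    by (simp add: comult_right_mult comult_right_J[OF linear_D D_e D_u] T.assoc)
  have "\<theta>3 (sm3 (L13 R') (L12 R')) = m3 (m3 (\<theta>3 (L13 R')) (L12 J)) (L12 R)"
    by (simp add: theta3_mult theta3_leg12 theta_R' leg12_mult T.assoc)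
  also have "\<dots> = m3 (L12 J) (m3 (L13 J) (m3 (L13 R) (L12 R)))"
    by (simp add: theta3_leg13_leg12_J[OF even_R'] theta_R' leg13_mult T.assoc)
  finally have right: "\<theta>3 (sm3 (L13 R') (L12 R')) = m3 (L12 J) (m3 (L13 J) (m3 (L13 R) (L12 R)))" .
  show ?thesis
    unfolding theta3_eq_iff[symmetric, of "tensor_map _ _ _"] left right
    unfolding T.square_left_cancel[OF leg_J_square(3)] T.square_left_cancel[OF leg_J_square(2)]
      T.square_left_cancel[OF leg_J_square(1)] theta3_eq_iff ..
qed

text \<open>
  Under \<open>\<theta>\<close> the left equation becomes \<open>J (R flip(R)) J = 1\<close>.
\<close>

lemma super_symmetric_iff: "sm2 R' (\<beta> R') = e \<otimes> e \<longleftrightarrow> m2 R (flip R) = e \<otimes> e"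
proof -
  interpret T: complex_algebra m2 "e \<otimes> e" by (rule algebra2)
  have "A e = parity_sign 0 *\<^sub>C e" by (simp add: scaleC_one)
  note theta_e = theta_homogeneous[OF this, of e]
  have "sm2 R' (\<beta> R') = e \<otimes> e \<longleftrightarrow> m2 (m2 J R) (\<theta> (\<beta> (\<theta> (m2 J R)))) = e \<otimes> e"
    unfolding theta_eq_iff[symmetric, of "sm2 _ _"] theta_mult theta_R' theta_e by (simp add: R')
  also have "\<dots> \<longleftrightarrow> m2 J (m2 (m2 R (flip R)) J) = e \<otimes> e"
    unfolding theta_braiding flip_mult flip_J
    by (simp add: T.assoc) (simp add: J_square flip: T.assoc[of J J])
  also have "\<dots> \<longleftrightarrow> m2 R (flip R) = e \<otimes> e"
    by (metis J_square T.assoc T.unit_left T.unit_right)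
  finally show ?thesis .
qed

text \<open>
  On homogeneous \<open>a \<otimes> b\<close> of equal parity \<open>i\<close>, two of the four terms of \<open>J\<close> cancel and the other two
  agree, so that contracting \<open>J \<theta>(a \<otimes> b)\<close> gives \<open>S(b) u a u\<^sup>i\<close>. Moving \<open>u\<close> to the right through
  \<open>a\<close> yields the sign \<open>(-1)\<^sup>i\<close> of the braiding.
\<close>

lemma drinfeld_twist:
  assumes S: "clinear S" and Su: "\<And>x. S (x \<star> u) = u \<star> S x" "\<And>x. S (u \<star> x) = S x \<star> u"
    and S': "\<And>x. S' x = S (parity_part A 0 x) + u \<star> S (parity_part A 1 x)"
  shows "tensor_lift m (flip (tensor_map id S R)) = tensor_lift m (\<beta> (tensor_map id S' R')) \<star> u"
proof -
  interpret A: involution A by (rule involution_A)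
  interpret T: complex_algebra m2 "e \<otimes> e" by (rule algebra2)
  have linS': "clinear S'"
    unfolding ext[of S', OF S'] by (intro multilinear clinear_compose[OF S] A.clinear_parity_part)
  have "m2 J (\<theta> R') = R"
    by (simp add: theta_R' J_square flip: T.assoc)
  moreover have "tensor_lift m (flip (tensor_map id S (m2 J (\<theta> t)))) =
      tensor_lift m (\<beta> (tensor_map id S' t)) \<star> u" if "A2 t = t" for t
  proof (rule even_tensor_homogeneous_eqI[OF involution_A involution_A _ _ that])
    have lin: "clinear (\<lambda>t. tensor_lift m (flip (tensor_map id S t)))"
      by (intro multilinear bilinear S)
    show "clinear (\<lambda>t. tensor_lift m (flip (tensor_map id S (m2 J (\<theta> t)))))"
      by (intro multilinear bilinear S)
    show "clinear (\<lambda>t. tensor_lift m (\<beta> (tensor_map id S' t)) \<star> u)"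
      by (intro multilinear bilinear linS')
    have dr: "tensor_lift m (flip (tensor_map id S (a \<otimes> b))) = S b \<star> a" for a b
      by (simp add: tensor_map_tensor clinear_id S flip_tensor tensor_lift_tensor bilinear)
    fix a b i
    assume a: "A a = parity_sign i *\<^sub>C a" and b: "A b = parity_sign i *\<^sub>C b"
    have Sb: "A (S b) = parity_sign i *\<^sub>C S b"
      using b by (metis Su S clinear_scaleC ad_def assoc)
    have S'b: "S' b = pow i \<star> S b"
      by (cases "i = 0") (simp_all add: S' A.parity_part_homogeneous[OF b] clinear_zero[OF S] mult_simps)
    have "tensor_lift m (flip (tensor_map id S (m2 J (\<theta> (a \<otimes> b))))) =
        (1/2) *\<^sub>C (S b \<star> (a \<star> pow i) + S b \<star> u \<star> (a \<star> pow i)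
           + S b \<star> u \<star> (a \<star> pow i) - S b \<star> (a \<star> pow i))"
      by (simp add: theta_homogeneous[OF b] J_def mult2_simps mult2_tensor clinear_add[OF lin]
        clinear_diff[OF lin] clinear_scaleC[OF lin] dr Su assoc add_ac)
    also have "\<dots> = S b \<star> u \<star> (a \<star> pow i)"
      by (simp add: half_double)
    also have "\<dots> = parity_sign (i * i) *\<^sub>C (pow i \<star> S b \<star> a \<star> u)"
      using a[unfolded ad_def assoc] homogeneous_commute[OF a] homogeneous_commute[OF Sb]
      by (cases "i = 0") (simp_all add: assoc mult_simps scaleC_one square)
    also have "\<dots> = tensor_lift m (\<beta> (tensor_map id S' (a \<otimes> b))) \<star> u"
      by (simp add: tensor_map_tensor clinear_id linS' S'b
        braiding_homogeneous[OF a homogeneous_pow(2)[OF Sb]]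
        clinear_scaleC[OF clinear_tensor_lift[OF bilinear]] tensor_lift_tensor bilinear mult_simps)
    finally show "tensor_lift m (flip (tensor_map id S (m2 J (\<theta> (a \<otimes> b))))) =
        tensor_lift m (\<beta> (tensor_map id S' (a \<otimes> b))) \<star> u" .
  qed
  ultimately show ?thesis using even_R' by metis
qed

end

end

section \<open>Convolution\<close>

lemma algebra_axioms_iff: "algebra_axioms H \<longleftrightarrow> complex_algebra (mult H) (unity H)"
  unfolding algebra_axioms_def complex_algebra_def by blast

text \<open>
  Coassociativity in the form used with Sweedler notation: \<open>\<Sum> F(x\<^sub>1, x\<^sub>2, x\<^sub>3)\<close> does not depend on
  the way the double coproduct is formed.
\<close>

lemma coassociativity_trilinear:
  assumes "coalgebra_axioms H"
    and F: "\<And>q r. clinear (\<lambda>p. F p q r)" "\<And>p r. clinear (\<lambda>q. F p q r)" "\<And>p q. clinear (\<lambda>r. F p q r)"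
  shows "tensor_lift (\<lambda>a b. tensor_lift (\<lambda>p q. F p q b) (comult H a)) (comult H x) =
    tensor_lift (\<lambda>a b. tensor_lift (\<lambda>q r. F a q r) (comult H b)) (comult H x)"
proof -
  have D: "clinear (comult H)"
    and coassoc: "tensor_assoc (tensor_map (comult H) id (comult H x)) = tensor_map id (comult H) (comult H x)"
    using assms(1) by (auto simp: coalgebra_axioms_def)
  note [multilinear] = clinear_compose[OF D] F[THEN clinear_compose]
  define \<Phi> where "\<Phi> = tensor_lift (\<lambda>p s. tensor_lift (\<lambda>q r. F p q r) s)"
  have \<Phi>_pure: "\<Phi> (p \<otimes> s) = tensor_lift (\<lambda>q r. F p q r) s" for p s
    unfolding \<Phi>_def by (rule tensor_lift_tensor) (intro multilinear)
  have \<Phi>_linear: "clinear \<Phi>"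
    unfolding \<Phi>_def by (intro multilinear)
  note [multilinear] = clinear_compose[OF \<Phi>_linear]
  have assoc: "\<Phi> (tensor_assoc (s \<otimes> b)) = tensor_lift (\<lambda>p q. F p q b) s" for s b
  proof (rule tensor_eqI[where t = s])
    show "\<Phi> (tensor_assoc ((p \<otimes> q) \<otimes> b)) = tensor_lift (\<lambda>p q. F p q b) (p \<otimes> q)" for p q
      by (simp add: tensor_assoc_tensor \<Phi>_pure, subst (1 2) tensor_lift_tensor) (intro multilinear | simp)+
  qed (intro multilinear)+
  have "\<Phi> (tensor_assoc (tensor_map (comult H) id t)) =
      tensor_lift (\<lambda>a b. tensor_lift (\<lambda>p q. F p q b) (comult H a)) t" for t
  proof (rule tensor_eqI[where t = t])
    show "\<Phi> (tensor_assoc (tensor_map (comult H) id (a \<otimes> b))) =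
      tensor_lift (\<lambda>a b. tensor_lift (\<lambda>p q. F p q b) (comult H a)) (a \<otimes> b)" for a b
      by (subst tensor_lift_tensor) (intro multilinear | simp add: tensor_map_tensor D clinear_id assoc)+
  qed (intro multilinear D)+
  moreover have "\<Phi> (tensor_map id (comult H) t) =
      tensor_lift (\<lambda>a b. tensor_lift (\<lambda>q r. F a q r) (comult H b)) t" for t
  proof (rule tensor_eqI[where t = t])
    show "\<Phi> (tensor_map id (comult H) (a \<otimes> b)) =
      tensor_lift (\<lambda>a b. tensor_lift (\<lambda>q r. F a q r) (comult H b)) (a \<otimes> b)" for a b
      by (subst tensor_lift_tensor) (intro multilinear | simp add: tensor_map_tensor D clinear_id \<Phi>_pure)+
  qed (intro multilinear D)+
  ultimately show ?thesis
    using coassoc by metis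
qed

text \<open>
  In the convolution product, \<open>L = L * (F * G) = (L * F) * G = w G\<close>. The factor \<open>w\<close>, instead of \<open>1\<close>,
  lets one variable of a function of two variables be treated as a parameter; that is how the
  antipode is shown to be an antihomomorphism.
\<close>

lemma convolution_inverse_unique:
  fixes n :: "'b::complex_vector \<Rightarrow> 'b \<Rightarrow> 'b"
  assumes H: "coalgebra_axioms H" and alg: "complex_algebra n one"
    and lin: "clinear F" "clinear L" "clinear G"
    and left: "\<And>x. tensor_lift (\<lambda>p q. n (L p) (F q)) (comult H x) = counit H x *\<^sub>C w"
    and right: "\<And>x. tensor_lift (\<lambda>p q. n (F p) (G q)) (comult H x) = counit H x *\<^sub>C one"
  shows "L x = n w (G x)"
proof -
  interpret complex_algebra n one by fact
  have D: "clinear (comult H)" "clinear (counit H)"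
    and counit: "tensor_lift (\<lambda>a b. counit H a *\<^sub>C b) (comult H x) = x"
      "tensor_lift (\<lambda>a b. counit H b *\<^sub>C a) (comult H x) = x"
    using H by (auto simp: coalgebra_axioms_def)
  note [multilinear] = lin[THEN clinear_compose] D[THEN clinear_compose]
  have bil: "cbilinear (\<lambda>p q. n (L p) (F q))" "cbilinear (\<lambda>p q. n (F p) (G q))"
    "cbilinear (\<lambda>a b. counit H a *\<^sub>C b)" "cbilinear (\<lambda>a b. counit H b *\<^sub>C a)"
    by (intro multilinear)+
  have "L x = tensor_lift (\<lambda>a b. n (L a) (counit H b *\<^sub>C one)) (comult H x)"
    using clinear_tensor_lift_distrib[OF lin(2) bil(4), of "comult H x"]
    by (simp add: counit mult_simps clinear_scaleC[OF lin(2)])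
  also have "\<dots> = tensor_lift (\<lambda>a b. tensor_lift (\<lambda>q r. n (L a) (n (F q) (G r))) (comult H b)) (comult H x)"
    unfolding right[symmetric]
    by (subst clinear_tensor_lift_distrib[OF clinear_mult_right[OF clinear_ident] bil(2)]) (rule refl)
  also have "\<dots> = tensor_lift (\<lambda>a b. tensor_lift (\<lambda>p q. n (L p) (n (F q) (G b))) (comult H a)) (comult H x)"
    by (rule coassociativity_trilinear[OF H, symmetric]) (intro multilinear)+
  also have "\<dots> = tensor_lift (\<lambda>a b. n (counit H a *\<^sub>C w) (G b)) (comult H x)"
    unfolding left[symmetric] assoc[symmetric]
    by (subst clinear_tensor_lift_distrib[OF clinear_mult_left[OF clinear_ident] bil(1)]) (rule refl)
  also have "\<dots> = n w (G x)"
    using clinear_tensor_lift_distrib[OF clinear_mult_right[OF lin(3)] bil(3), of w "comult H x"]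
    by (simp add: counit mult_simps clinear_scaleC[OF lin(3)])
  finally show ?thesis .
qed

section \<open>Twisting the comultiplication and the antipode\<close>

text \<open>
  The passage between Hopf algebras and Hopf superalgebras, without the grading. The same formulas
  work in both directions, whence the domain is any record extending a Hopf algebra.
\<close>

definition twist_hopf :: "('a::complex_vector, 'm) hopf_scheme \<Rightarrow> 'a \<Rightarrow> 'a hopf" where
  "twist_hopf H u = (let A = ad (mult H) u in
    \<lparr> mult = mult H, unity = unity H,
      comult = (\<lambda>h. bosonize (mult H) u A (comult H h)),
      counit = counit H,
      antipode = (\<lambda>h. antipode H (parity_part A 0 h) + mult H u (antipode H (parity_part A 1 h))) \<rparr>)"

lemma twist_hopf_simps [simp]:
  "mult (twist_hopf H u) = mult H" "unity (twist_hopf H u) = unity H"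
  "counit (twist_hopf H u) = counit H"
  "comult (twist_hopf H u) h = bosonize (mult H) u (ad (mult H) u) (comult H h)"
  "antipode (twist_hopf H u) h = antipode H (parity_part (ad (mult H) u) 0 h)
    + mult H u (antipode H (parity_part (ad (mult H) u) 1 h))"
  by (simp_all add: twist_hopf_def Let_def)

text \<open>
  The properties of a pair that are common to Hopf algebras and Hopf superalgebras with a grouplike
  element \<open>u\<close> of square \<open>1\<close>. Multiplicativity appears only for products with \<open>u\<close>: since \<open>u\<close> is
  even, these products involve no sign, whereas the full bialgebra axiom differs in the two
  cases.
\<close>

definition twistable :: "('a::complex_vector, 'm) hopf_scheme \<Rightarrow> 'a \<Rightarrow> bool" where
  "twistable H u \<longleftrightarrow> algebra_axioms H \<and> coalgebra_axioms H \<and> antipode_axioms H \<and>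
    mult H u u = unity H \<and> comult H u = u \<otimes> u \<and>
    (\<forall>x. comult H (mult H x u) = hopf_mult2 H (comult H x) (u \<otimes> u)) \<and>
    (\<forall>x. comult H (mult H u x) = hopf_mult2 H (u \<otimes> u) (comult H x)) \<and>
    (\<forall>x. counit H (mult H x u) = counit H x) \<and> (\<forall>x. counit H (mult H u x) = counit H x)"

locale twistable_hopf =
  fixes H :: "('a::complex_vector, 'm) hopf_scheme" and u
  assumes twistable: "twistable H u"
begin

abbreviation mult_H (infixl \<open>\<star>\<close> 75) where "mult_H \<equiv> mult H"
abbreviation "e \<equiv> unity H"
abbreviation "D \<equiv> comult H"
abbreviation "\<epsilon> \<equiv> counit H"
abbreviation "S \<equiv> antipode H"

sublocale parity_algebra "mult H" "unity H" u
  using twistable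
  by (simp add: twistable_def algebra_axioms_iff parity_algebra_def parity_algebra_axioms_def)

lemma coalgebra: "coalgebra_axioms H"
  and linear_D: "clinear D" and linear_counit: "clinear \<epsilon>" and linear_S: "clinear S"
  and coassoc: "tensor_assoc (tensor_map D id (D x)) = tensor_map id D (D x)"
  and counit_left: "tensor_lift (\<lambda>a b. \<epsilon> a *\<^sub>C b) (D x) = x"
  and counit_right: "tensor_lift (\<lambda>a b. \<epsilon> b *\<^sub>C a) (D x) = x"
  and antipode_left: "tensor_lift (\<lambda>a b. S a \<star> b) (D x) = \<epsilon> x *\<^sub>C e"
  and antipode_right: "tensor_lift (\<lambda>a b. a \<star> S b) (D x) = \<epsilon> x *\<^sub>C e"
  and D_u: "D u = u \<otimes> u"
  and D_mult_u: "D (x \<star> u) = m2 (D x) (u \<otimes> u)" and D_u_mult: "D (u \<star> x) = m2 (u \<otimes> u) (D x)"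
  and counit_mult_u: "\<epsilon> (x \<star> u) = \<epsilon> x" and counit_u_mult: "\<epsilon> (u \<star> x) = \<epsilon> x"
  using twistable by (auto simp: twistable_def coalgebra_axioms_def antipode_axioms_def)

lemmas clinear_structure [multilinear] =
  clinear_compose[OF linear_D] clinear_compose[OF linear_counit] clinear_compose[OF linear_S]

lemma conj_u: "m2 (m2 (u \<otimes> u) t) (u \<otimes> u) = A2 t"
proof (rule tensor_eqI[where t = t])
  show "m2 (m2 (u \<otimes> u) (a \<otimes> b)) (u \<otimes> u) = A2 (a \<otimes> b)" for a b
    by (simp add: mult2_tensor A2_tensor ad_def)
qed (intro multilinear)+

lemma D_A: "D (A x) = A2 (D x)"
  by (simp add: ad_def[of _ _ x] D_mult_u D_u_mult conj_u)

lemma bilinear_antipode: "cbilinear (\<lambda>a b. S a \<star> b)" "cbilinear (\<lambda>a b. a \<star> S b)"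
  "cbilinear (\<lambda>a b. \<epsilon> a *\<^sub>C b)" "cbilinear (\<lambda>a b. \<epsilon> b *\<^sub>C a)"
  by (intro multilinear)+

text \<open>
  The antipode reverses products with \<open>u\<close>, which is its own inverse: \<open>x \<mapsto> u S(x u)\<close> is a left
  convolution inverse of the identity.
\<close>

lemma S_mult_u: "S (x \<star> u) = u \<star> S x"
proof -
  have "u \<star> S (x \<star> u) = e \<star> S x"
  proof (rule convolution_inverse_unique[OF coalgebra complex_algebra_axioms, where F = "\<lambda>x. x" and L = "\<lambda>x. u \<star> S (x \<star> u)" and G = S])
    have bil: "cbilinear (\<lambda>p q. u \<star> S (p \<star> u) \<star> q)" by (intro multilinear)
    have "tensor_lift (\<lambda>p q. u \<star> S (p \<star> u) \<star> q) t =
        u \<star> tensor_lift (\<lambda>a b. S a \<star> b) (m2 t (u \<otimes> u)) \<star> u" for t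
    proof (rule tensor_eqI[where t = t])
      show "tensor_lift (\<lambda>p q. u \<star> S (p \<star> u) \<star> q) (a \<otimes> b) =
        u \<star> tensor_lift (\<lambda>a b. S a \<star> b) (m2 (a \<otimes> b) (u \<otimes> u)) \<star> u" for a b
        unfolding tensor_lift_tensor[OF bil] mult2_tensor tensor_lift_tensor[OF bilinear_antipode(1)]
        by (simp add: assoc square)
    qed (intro multilinear)+
    then show "tensor_lift (\<lambda>p q. u \<star> S (p \<star> u) \<star> q) (D x) = \<epsilon> x *\<^sub>C e" for x
      by (simp add: antipode_left counit_mult_u mult_simps square flip: D_mult_u)
  qed (simp_all add: antipode_right, (intro multilinear)+)
  then show ?thesis by (metis square_assoc unit_left)
qed

lemma S_u_mult: "S (u \<star> x) = S x \<star> u"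
proof -
  have "S (u \<star> x) \<star> u = e \<star> S x"
  proof (rule convolution_inverse_unique[OF coalgebra complex_algebra_axioms, where F = "\<lambda>x. x" and L = "\<lambda>x. S (u \<star> x) \<star> u" and G = S])
    have bil: "cbilinear (\<lambda>p q. S (u \<star> p) \<star> u \<star> q)" by (intro multilinear)
    have "tensor_lift (\<lambda>p q. S (u \<star> p) \<star> u \<star> q) t =
        tensor_lift (\<lambda>a b. S a \<star> b) (m2 (u \<otimes> u) t)" for t
    proof (rule tensor_eqI[where t = t])
      show "tensor_lift (\<lambda>p q. S (u \<star> p) \<star> u \<star> q) (a \<otimes> b) =
        tensor_lift (\<lambda>a b. S a \<star> b) (m2 (u \<otimes> u) (a \<otimes> b))" for a b
        unfolding tensor_lift_tensor[OF bil] mult2_tensor tensor_lift_tensor[OF bilinear_antipode(1)]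
        by (simp add: assoc)
    qed (intro multilinear)+
    then show "tensor_lift (\<lambda>p q. S (u \<star> p) \<star> u \<star> q) (D x) = \<epsilon> x *\<^sub>C e" for x
      by (simp add: antipode_left counit_u_mult flip: D_u_mult)
  qed (simp_all add: antipode_right, (intro multilinear)+)
  then show ?thesis by (metis square assoc unit_right unit_left)
qed

lemma S_A: "S (A x) = A (S x)"
  by (simp add: ad_def S_mult_u S_u_mult assoc)

lemma counit_A: "\<epsilon> (A x) = \<epsilon> x"
  by (simp add: ad_def counit_mult_u counit_u_mult)

lemma counit_odd: "A x = - x \<Longrightarrow> \<epsilon> x = 0"
  using counit_A[of x] clinear_diff[OF linear_counit, of 0 x] clinear_zero[OF linear_counit] by simp

abbreviation "H' \<equiv> twist_hopf H u"
abbreviation "S' \<equiv> antipode H'"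

lemma linear_S': "clinear S'"
proof -
  interpret A: involution A by (rule involution_A)
  have "S' = (\<lambda>x. S (parity_part A 0 x) + u \<star> S (parity_part A 1 x))"
    by (rule ext) simp
  then show ?thesis by simp (intro multilinear A.clinear_parity_part)
qed

lemma S'_homogeneous: "A x = parity_sign i *\<^sub>C x \<Longrightarrow> S' x = pow i \<star> S x"
proof -
  interpret A: involution A by (rule involution_A)
  assume "A x = parity_sign i *\<^sub>C x"
  then show "S' x = pow i \<star> S x"
    by (cases "i = 0")
      (simp_all add: A.parity_part_homogeneous[of x i] clinear_zero[OF linear_S] mult_simps)
qed

lemma S_pow: "S (x \<star> pow i) = pow i \<star> S x"
  by (cases "i = 0") (simp_all add: S_mult_u)

lemma counit_pow: "\<epsilon> (x \<star> pow i) = \<epsilon> x"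
  by (cases "i = 0") (simp_all add: counit_mult_u)

lemma theta_mult_u: "\<theta> (m2 t (u \<otimes> u)) = m2 (\<theta> t) (u \<otimes> u)"
proof (rule tensor_homogeneous_eqI[OF involution_A involution_A, where t = t])
  fix a b i j assume b: "A b = parity_sign j *\<^sub>C b"
  then have "A (b \<star> u) = parity_sign j *\<^sub>C (b \<star> u)" by (simp add: A_mult mult_simps)
  then show "\<theta> (m2 (a \<otimes> b) (u \<otimes> u)) = m2 (\<theta> (a \<otimes> b)) (u \<otimes> u)"
    using pow_pow_commute[of 1 j] by (simp add: mult2_tensor theta_homogeneous[of _ j] b assoc)
qed (intro multilinear)+

lemma theta_u_mult: "\<theta> (m2 (u \<otimes> u) t) = m2 (u \<otimes> u) (\<theta> t)"
proof (rule tensor_homogeneous_eqI[OF involution_A involution_A, where t = t])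
  fix a b i j assume b: "A b = parity_sign j *\<^sub>C b"
  then have "A (u \<star> b) = parity_sign j *\<^sub>C (u \<star> b)" by (simp add: A_mult mult_simps)
  then show "\<theta> (m2 (u \<otimes> u) (a \<otimes> b)) = m2 (u \<otimes> u) (\<theta> (a \<otimes> b))"
    by (simp add: mult2_tensor theta_homogeneous[of _ j] b assoc)
qed (intro multilinear)+

lemma theta_pure_even: "A b = b \<Longrightarrow> \<theta> (a \<otimes> b) = a \<otimes> b"
  using theta_homogeneous[of b 0 a] by (simp add: scaleC_one)

text \<open>
  The counit axioms survive because \<open>\<epsilon>(u) = 1\<close> and \<open>\<epsilon>\<close> vanishes on odd elements.
\<close>

lemma coalgebra_twist: "coalgebra_axioms H'"
proof -
  have eq: "comult H' = (\<lambda>x. \<theta> (D x))" by (rule ext) simp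
  show ?thesis unfolding coalgebra_axioms_def eq twist_hopf_simps
  proof (intro conjI allI)
  show "clinear (\<lambda>x. \<theta> (D x))" by (intro multilinear)
  show "clinear \<epsilon>" by (rule linear_counit)
  show "tensor_assoc (tensor_map (\<lambda>x. \<theta> (D x)) id (\<theta> (D x))) = tensor_map id (\<lambda>x. \<theta> (D x)) (\<theta> (D x))" for x
    unfolding theta_comult_left[OF linear_D D_mult_u] theta_comult_right[OF linear_D D_A] coassoc ..
  have "tensor_lift (\<lambda>a b. \<epsilon> a *\<^sub>C b) (\<theta> t) = tensor_lift (\<lambda>a b. \<epsilon> a *\<^sub>C b) t" for t
  proof (rule tensor_homogeneous_eqI[OF involution_A involution_A, where t = t])
    fix a b i j assume b: "A b = parity_sign j *\<^sub>C b"
    show "tensor_lift (\<lambda>a b. \<epsilon> a *\<^sub>C b) (\<theta> (a \<otimes> b)) = tensor_lift (\<lambda>a b. \<epsilon> a *\<^sub>C b) (a \<otimes> b)"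
      unfolding theta_homogeneous[OF b] tensor_lift_tensor[OF bilinear_antipode(3)] counit_pow ..
  qed (intro multilinear)+
  then show "tensor_lift (\<lambda>a b. \<epsilon> a *\<^sub>C b) (\<theta> (D x)) = x" for x
    by (simp add: counit_left)
  have "tensor_lift (\<lambda>a b. \<epsilon> b *\<^sub>C a) (\<theta> t) = tensor_lift (\<lambda>a b. \<epsilon> b *\<^sub>C a) t" for t
  proof (rule tensor_homogeneous_eqI[OF involution_A involution_A, where t = t])
    fix a b i j assume b: "A b = parity_sign j *\<^sub>C b"
    then show "tensor_lift (\<lambda>a b. \<epsilon> b *\<^sub>C a) (\<theta> (a \<otimes> b)) = tensor_lift (\<lambda>a b. \<epsilon> b *\<^sub>C a) (a \<otimes> b)"
      using counit_odd[of b] unfolding theta_homogeneous[OF b] tensor_lift_tensor[OF bilinear_antipode(4)]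
      by (cases "j = 0") (simp_all add: scaleC_one)
  qed (intro multilinear)+
  then show "tensor_lift (\<lambda>a b. \<epsilon> b *\<^sub>C a) (\<theta> (D x)) = x" for x
    by (simp add: counit_right)
  qed
qed

text \<open>
  On the left, contracting \<open>\<theta>(a \<otimes> b)\<close> gives \<open>u\<^bsup>p(a)+p(b)\<^esup> S(a) b\<close>. The exponent is the parity of
  \<open>S(a) b\<close>, so this is a linear operator \<open>E\<close> applied to the contraction of \<open>a \<otimes> b\<close>, and \<open>E\<close> fixes
  \<open>1\<close>. On the right the two powers of \<open>u\<close> meet and cancel.
\<close>

lemma antipode_twist: "antipode_axioms H'"
  unfolding antipode_axioms_def twist_hopf_simps(1-4)
proof (intro conjI allI)
  show "clinear S'" by (rule linear_S')
  note [multilinear] = clinear_compose[OF linear_S']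
  interpret A: involution A by (rule involution_A)
  have bil: "cbilinear (\<lambda>a b. S' a \<star> b)" "cbilinear (\<lambda>a b. a \<star> S' b)" by (intro multilinear)+
  \<comment> \<open>On \<open>x\<close> of parity \<open>i\<close> this is multiplication by \<open>u\<^sup>i\<close>.\<close>
  define E where "E x = parity_part A 0 x + u \<star> parity_part A 1 x" for x
  have linear_E: "clinear E"
    unfolding E_def[abs_def] by (intro multilinear A.clinear_parity_part)
  have E: "E x = pow i \<star> x" if "A x = parity_sign i *\<^sub>C x" for x i
    by (cases "i = 0") (simp_all add: E_def A.parity_part_homogeneous[OF that] mult_simps)
  have "tensor_lift (\<lambda>a b. S' a \<star> b) (\<theta> t) = E (tensor_lift (\<lambda>a b. S a \<star> b) t)" for t
  proof (rule tensor_homogeneous_eqI[OF involution_A involution_A, where t = t])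
    fix a b i j
    assume a: "A a = parity_sign i *\<^sub>C a" and b: "A b = parity_sign j *\<^sub>C b"
    have "A (S a \<star> b) = parity_sign (i + j) *\<^sub>C (S a \<star> b)"
      unfolding parity_sign_add
      by (simp add: A_mult S_A[symmetric] a b clinear_scaleC[OF linear_S] mult_simps scaleC_scaleC mult.commute)
    note Sab = E[OF this]
    show "tensor_lift (\<lambda>a b. S' a \<star> b) (\<theta> (a \<otimes> b)) = E (tensor_lift (\<lambda>a b. S a \<star> b) (a \<otimes> b))"
      unfolding theta_homogeneous[OF b] tensor_lift_tensor[OF bil(1)]
        tensor_lift_tensor[OF bilinear_antipode(1)] Sab S'_homogeneous[OF homogeneous_pow(1)[OF a]]
        S_pow pow_add by (simp add: assoc)
  qed (intro multilinear clinear_compose[OF linear_E])+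
  moreover have "E e = e" using E[of e 0] by (simp add: scaleC_one)
  ultimately show "tensor_lift (\<lambda>a b. S' a \<star> b) (\<theta> (D x)) = \<epsilon> x *\<^sub>C e" for x
    by (simp add: antipode_left clinear_scaleC[OF linear_E])
  have "tensor_lift (\<lambda>a b. a \<star> S' b) (\<theta> t) = tensor_lift (\<lambda>a b. a \<star> S b) t" for t
  proof (rule tensor_homogeneous_eqI[OF involution_A involution_A, where t = t])
    fix a b i j
    assume b: "A b = parity_sign j *\<^sub>C b"
    have "a \<star> pow j \<star> (pow j \<star> S b) = a \<star> (pow j \<star> pow j) \<star> S b" by (simp only: assoc)
    then show "tensor_lift (\<lambda>a b. a \<star> S' b) (\<theta> (a \<otimes> b)) = tensor_lift (\<lambda>a b. a \<star> S b) (a \<otimes> b)"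
      unfolding theta_homogeneous[OF b] tensor_lift_tensor[OF bil(2)]
        tensor_lift_tensor[OF bilinear_antipode(2)] S'_homogeneous[OF b] by simp
  qed (intro multilinear)+
  then show "tensor_lift (\<lambda>a b. a \<star> S' b) (\<theta> (D x)) = \<epsilon> x *\<^sub>C e" for x
    by (simp add: antipode_right)
qed

lemma twistable_twist: "twistable H' u"
  using twistable coalgebra_twist antipode_twist
  by (simp add: twistable_def algebra_axioms_def theta_mult_u theta_u_mult theta_pure_even)

lemma twist_twist: "twist_hopf H' u = hopf.truncate H"
proof -
  interpret A: involution A by (rule involution_A)
  have "antipode (twist_hopf H' u) x = S x" for x
  proof -
    have "antipode (twist_hopf H' u) x = S' (parity_part A 0 x) + u \<star> S' (parity_part A 1 x)"
      by (simp only: twist_hopf_simps(5)[of H'] twist_hopf_simps(1))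
    also have "\<dots> = S (parity_part A 0 x) + S (parity_part A 1 x)"
      by (simp only: S'_homogeneous[OF A.parity_part_eigen] pow_simps unit_left square_assoc)
    also have "\<dots> = S x"
      by (simp only: A.parity_part_sum flip: clinear_add[OF linear_S])
    finally show ?thesis .
  qed
  then show ?thesis
    by (intro hopf.equality ext) (simp_all add: hopf.truncate_def theta_theta del: twist_hopf_simps(5))
qed

text \<open>
  Immediate, as \<open>\<theta>\<close> identifies the product with signs and the product without signs.
\<close>

lemma bialgebra_twist_iff: "bialgebra_axioms sm2 H' \<longleftrightarrow> bialgebra_axioms m2 H"
proof -
  have theta_eq_iff: "\<theta> s = \<theta> t \<longleftrightarrow> s = t" for s t by (metis theta_theta)
  have "\<theta> (D (x \<star> y)) = sm2 (\<theta> (D x)) (\<theta> (D y)) \<longleftrightarrow> D (x \<star> y) = m2 (D x) (D y)" for x y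
    unfolding super2_eq theta_theta theta_eq_iff ..
  moreover have "\<theta> (D e) = e \<otimes> e \<longleftrightarrow> D e = e \<otimes> e"
    using theta_eq_iff[of "D e" "e \<otimes> e"] by (simp add: theta_pure_even)
  ultimately show ?thesis
    by (simp add: bialgebra_axioms_def)
qed

end

section \<open>The Drinfeld element of a triangular Hopf algebra\<close>

locale ordinary_hopf =
  fixes H :: "('a::complex_vector, 'm) hopf_scheme"
  assumes hopf: "hopf_algebra H"
begin

abbreviation mult_H (infixl \<open>\<star>\<close> 75) where "mult_H \<equiv> mult H"
abbreviation "e \<equiv> unity H"
abbreviation "D \<equiv> comult H"
abbreviation "\<epsilon> \<equiv> counit H"
abbreviation "S \<equiv> antipode H"

sublocale complex_algebra "mult H" "unity H"
  using hopf by (simp add: hopf_algebra_def algebra_axioms_iff)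

lemma coalgebra: "coalgebra_axioms H"
  and linear_D: "clinear D" and linear_counit: "clinear \<epsilon>" and linear_S: "clinear S"
  and counit_left: "tensor_lift (\<lambda>a b. \<epsilon> a *\<^sub>C b) (D x) = x"
  and counit_right: "tensor_lift (\<lambda>a b. \<epsilon> b *\<^sub>C a) (D x) = x"
  and antipode_left: "tensor_lift (\<lambda>a b. S a \<star> b) (D x) = \<epsilon> x *\<^sub>C e"
  and antipode_right: "tensor_lift (\<lambda>a b. a \<star> S b) (D x) = \<epsilon> x *\<^sub>C e"
  and D_mult: "D (x \<star> y) = m2 (D x) (D y)" and D_e: "D e = e \<otimes> e"
  and counit_mult: "\<epsilon> (x \<star> y) = \<epsilon> x * \<epsilon> y" and counit_e: "\<epsilon> e = 1"
  using hopf
  by (auto simp: hopf_algebra_def coalgebra_axioms_def antipode_axioms_def bialgebra_axioms_def)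

lemmas clinear_structure [multilinear] =
  clinear_compose[OF linear_D] clinear_compose[OF linear_counit] clinear_compose[OF linear_S]

lemma bilinear_structure: "cbilinear (\<lambda>a b. S a \<star> b)" "cbilinear (\<lambda>a b. a \<star> S b)"
  "cbilinear (\<lambda>a b. \<epsilon> a *\<^sub>C b)" "cbilinear (\<lambda>a b. \<epsilon> b *\<^sub>C a)"
  by (intro multilinear)+

lemma e_nonzero: "e \<noteq> 0"
  using counit_e clinear_zero[OF linear_counit] by auto

lemma S_e: "S e = e"
  using antipode_left[of e] tensor_lift_tensor[OF bilinear_structure(1), of e e]
  by (simp add: D_e counit_e scaleC_one)

text \<open>
  The claim \<open>\<Sum> S(x\<^sub>1 y) x\<^sub>2 = \<epsilon>(x) S(y)\<close> follows by uniqueness of convolution inverses in \<open>y\<close> with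
  \<open>x\<close> fixed, because \<open>\<Sum> S(x\<^sub>1 y\<^sub>1) x\<^sub>2 y\<^sub>2 = \<epsilon>(x y)\<close>. By the claim, the same uniqueness in \<open>x\<close>
  with \<open>y\<close> fixed gives the result. In this way the tensor product coalgebra is avoided.
\<close>

lemma S_mult: "S (x \<star> y) = S y \<star> S x"
proof -
  have claim: "tensor_lift (\<lambda>p q. S (p \<star> y) \<star> q) (D x) = (\<epsilon> x *\<^sub>C e) \<star> S y" for x y
  proof (rule convolution_inverse_unique[OF coalgebra complex_algebra_axioms, where F = "\<lambda>x. x" and G = S
      and L = "\<lambda>y. tensor_lift (\<lambda>p q. S (p \<star> y) \<star> q) (D x)"])
    fix y
    have "tensor_lift (\<lambda>r s. tensor_lift (\<lambda>p q. S (p \<star> r) \<star> q) t \<star> s) t' =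
        tensor_lift (\<lambda>p q. S p \<star> q) (m2 t t')" for t t'
    proof (rule tensor_eqI[where t = t])
      fix a b
      show "tensor_lift (\<lambda>r s. tensor_lift (\<lambda>p q. S (p \<star> r) \<star> q) (a \<otimes> b) \<star> s) t' =
        tensor_lift (\<lambda>p q. S p \<star> q) (m2 (a \<otimes> b) t')"
      proof (rule tensor_eqI[where t = t'])
        fix c d
        have "cbilinear (\<lambda>p q. S (p \<star> r) \<star> q)" for r by (intro multilinear)
        note 1 = tensor_lift_tensor[OF this]
        have "cbilinear (\<lambda>r s. S (a \<star> r) \<star> b \<star> s)" by (intro multilinear)
        note 2 = tensor_lift_tensor[OF this]
        show "tensor_lift (\<lambda>r s. tensor_lift (\<lambda>p q. S (p \<star> r) \<star> q) (a \<otimes> b) \<star> s) (c \<otimes> d) =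
          tensor_lift (\<lambda>p q. S p \<star> q) (m2 (a \<otimes> b) (c \<otimes> d))"
          unfolding 1 2 mult2_tensor tensor_lift_tensor[OF bilinear_structure(1)] by (rule assoc)
      qed (intro multilinear)+
    qed (intro multilinear)+
    then show "tensor_lift (\<lambda>r s. tensor_lift (\<lambda>p q. S (p \<star> r) \<star> q) (D x) \<star> s) (D y) =
        \<epsilon> y *\<^sub>C \<epsilon> x *\<^sub>C e"
      by (simp add: antipode_left counit_mult scaleC_scaleC mult.commute flip: D_mult)
  qed (simp_all add: antipode_right, (intro multilinear)+)
  show ?thesis
  proof (rule convolution_inverse_unique[OF coalgebra complex_algebra_axioms, where F = "\<lambda>x. x" and G = S
      and L = "\<lambda>x. S (x \<star> y)"])
    show "tensor_lift (\<lambda>p q. S (p \<star> y) \<star> q) (D x) = \<epsilon> x *\<^sub>C S y" for x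
      by (simp add: claim mult_simps)
  qed (simp_all add: antipode_right, (intro multilinear)+)
qed

text \<open>
  Both sides are convolution inverse to the comultiplication: the left side because \<open>D\<close> is
  multiplicative, the right side since
  \<open>\<Sum> x\<^sub>1 S(x\<^sub>4) \<otimes> x\<^sub>2 S(x\<^sub>3) = \<Sum> x\<^sub>1 S(x\<^sub>2) \<otimes> 1 = \<epsilon>(x) 1 \<otimes> 1\<close>.
\<close>

lemma D_S: "D (S x) = flip (tensor_map S S (D x))"
proof -
  interpret T: complex_algebra m2 "e \<otimes> e" by (rule algebra2)
  define G where "G x = flip (tensor_map S S (D x))" for x
  have linear_G: "clinear G"
    unfolding G_def[abs_def] by (intro multilinear linear_S)
  note [multilinear] = clinear_compose[OF linear_G]
  have G_lift: "m2 (p \<otimes> q) (G r) = tensor_lift (\<lambda>s t. (p \<star> S t) \<otimes> (q \<star> S s)) (D r)" for p q r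
  proof -
    have bil: "cbilinear (\<lambda>s t. (p \<star> S t) \<otimes> (q \<star> S s))" by (intro multilinear)
    have "m2 (p \<otimes> q) (flip (tensor_map S S v)) = tensor_lift (\<lambda>s t. (p \<star> S t) \<otimes> (q \<star> S s)) v" for v
      by (rule tensor_eqI[where t = v]) (intro multilinear linear_S |
        simp add: tensor_lift_tensor[OF bil] tensor_map_tensor linear_S flip_tensor mult2_tensor)+
    then show ?thesis by (simp add: G_def)
  qed
  have inner: "tensor_lift (\<lambda>q r. m2 (a \<otimes> q) (G r)) (D b) = (a \<star> S b) \<otimes> e" for a b
  proof -
    have "tensor_lift (\<lambda>q r. m2 (a \<otimes> q) (G r)) (D b) =
        tensor_lift (\<lambda>q r. tensor_lift (\<lambda>s t. (a \<star> S t) \<otimes> (q \<star> S s)) (D r)) (D b)"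
      by (simp add: G_lift)
    also have "\<dots> = tensor_lift (\<lambda>c t. tensor_lift (\<lambda>q s. (a \<star> S t) \<otimes> (q \<star> S s)) (D c)) (D b)"
      by (rule coassociativity_trilinear[OF coalgebra, symmetric]) (intro multilinear)+
    also have "\<dots> = tensor_lift (\<lambda>c t. (a \<star> S (\<epsilon> c *\<^sub>C t)) \<otimes> e) (D b)"
      by (simp add: antipode_right tensor_simps clinear_scaleC[OF linear_S] mult_simps
        flip: clinear_tensor_lift_distrib[OF clinear_tensor_right[OF clinear_ident] bilinear_structure(2)])
    also have "\<dots> = (a \<star> S b) \<otimes> e"
    proof -
      have "clinear (\<lambda>x. (a \<star> S x) \<otimes> e)" by (intro multilinear)
      from clinear_tensor_lift_distrib[OF this bilinear_structure(3), of "D b"]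
      show ?thesis by (simp add: counit_left)
    qed
    finally show ?thesis .
  qed
  have "D (S x) = m2 (e \<otimes> e) (G x)"
  proof (rule convolution_inverse_unique[OF coalgebra algebra2, where F = D and G = G
      and L = "\<lambda>x. D (S x)"])
    show "tensor_lift (\<lambda>p q. m2 (D (S p)) (D q)) (D x) = \<epsilon> x *\<^sub>C (e \<otimes> e)" for x
      using clinear_tensor_lift_distrib[OF linear_D bilinear_structure(1), of "D x"]
      by (simp add: D_mult antipode_left clinear_scaleC[OF linear_D] D_e)
    show "tensor_lift (\<lambda>p q. m2 (D p) (G q)) (D x) = \<epsilon> x *\<^sub>C (e \<otimes> e)" for x
    proof -
      have G_split: "m2 v (G r) = tensor_lift (\<lambda>p q. m2 (p \<otimes> q) (G r)) v" for v r
        using clinear_tensor_lift_distrib[OF T.clinear_mult_left[OF clinear_ident] cbilinear_tensor, of v "G r"]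
        by (simp add: tensor_lift_pure)
      have "tensor_lift (\<lambda>p r. m2 (D p) (G r)) (D x) =
          tensor_lift (\<lambda>a r. tensor_lift (\<lambda>p q. m2 (p \<otimes> q) (G r)) (D a)) (D x)"
        by (intro arg_cong[where f = "\<lambda>F. tensor_lift F (D x)"] ext) (rule G_split)
      also have "\<dots> = tensor_lift (\<lambda>a b. tensor_lift (\<lambda>q r. m2 (a \<otimes> q) (G r)) (D b)) (D x)"
        by (rule coassociativity_trilinear[OF coalgebra]) (intro multilinear)+
      also have "\<dots> = \<epsilon> x *\<^sub>C (e \<otimes> e)"
        by (simp add: inner antipode_right tensor_simps
          flip: clinear_tensor_lift_distrib[OF clinear_tensor_left[OF clinear_ident] bilinear_structure(2)])
      finally show ?thesis .
    qed
  qed (intro multilinear linear_D linear_G)+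
  then show ?thesis by (simp add: G_def)
qed

end

locale triangular_hopf = ordinary_hopf +
  fixes R
  assumes quasi: "m2 (flip (D h)) R = m2 R (D h)"
    and D_left: "tensor_assoc (tensor_map D id R) = m3 (L13 R) (L23 R)"
    and D_right: "tensor_map id D R = m3 (L13 R) (L12 R)"
    and R_flip: "m2 R (flip R) = e \<otimes> e"
begin

sublocale T: complex_algebra m2 "e \<otimes> e" by (rule algebra2)

lemma flip_R: "m2 (flip R) R = e \<otimes> e"
  using arg_cong[OF R_flip, of flip] by (simp add: flip_mult flip_flip flip_tensor)

text \<open>
  Apply \<open>a \<otimes> b \<otimes> c \<mapsto> f(a) b \<otimes> c\<close> to the first hexagon axiom. With \<open>f = \<epsilon>\<close> this gives
  \<open>(\<epsilon> \<otimes> id)(R) = 1\<close>, and then with \<open>f = S\<close> it gives \<open>(S \<otimes> id)(R) R = 1\<close>.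
\<close>

lemma left_contraction:
  assumes f: "clinear f"
  shows "tensor_map (\<lambda>x. tensor_lift (\<lambda>a b. f a \<star> b) (D x)) id R = m2 (tensor_map f id R) R"
proof -
  note [multilinear] = clinear_compose[OF f]
  define \<Phi> :: "'a \<otimes> 'a \<otimes> 'a \<Rightarrow> 'a \<otimes> 'a"
    where "\<Phi> = tensor_lift (\<lambda>a s. tensor_map (\<lambda>b. f a \<star> b) id s)"
  have bil: "cbilinear (\<lambda>a (s :: 'a \<otimes> 'a). tensor_map (\<lambda>b. f a \<star> b) id s)"
    unfolding tensor_map_def id_def by (intro multilinear)
  have \<Phi>_linear: "clinear \<Phi>" unfolding \<Phi>_def by (rule clinear_tensor_lift[OF bil])
  note [multilinear] = clinear_compose[OF \<Phi>_linear]
  have \<Phi>: "\<Phi> (a \<otimes> b \<otimes> c) = (f a \<star> b) \<otimes> c" for a b c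
    unfolding \<Phi>_def tensor_lift_tensor[OF bil] by (simp add: tensor_map_tensor clinear_id multilinear)
  have bilf: "cbilinear (\<lambda>a b. f a \<star> b)" by (intro multilinear)
  have lin: "clinear (\<lambda>x. tensor_lift (\<lambda>a b. f a \<star> b) (D x))" by (intro multilinear)
  have assoc: "\<Phi> (tensor_assoc (s \<otimes> c)) = tensor_lift (\<lambda>a b. f a \<star> b) s \<otimes> c" for s c
  proof (rule tensor_eqI[where t = s])
    show "\<Phi> (tensor_assoc ((a \<otimes> b) \<otimes> c)) = tensor_lift (\<lambda>a b. f a \<star> b) (a \<otimes> b) \<otimes> c" for a b
      unfolding tensor_lift_tensor[OF bilf] tensor_assoc_tensor \<Phi> ..
  qed (intro multilinear)+
  have "\<Phi> (tensor_assoc (tensor_map D id t)) =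
      tensor_map (\<lambda>x. tensor_lift (\<lambda>a b. f a \<star> b) (D x)) id t" for t
  proof (rule tensor_eqI[where t = t])
    show "\<Phi> (tensor_assoc (tensor_map D id (a \<otimes> b))) =
      tensor_map (\<lambda>x. tensor_lift (\<lambda>a b. f a \<star> b) (D x)) id (a \<otimes> b)" for a b
      unfolding tensor_map_tensor[OF linear_D clinear_id] tensor_map_tensor[OF lin clinear_id] assoc by simp
  qed (intro multilinear linear_D lin)+
  moreover have "\<Phi> (m3 (L13 s) (L23 t)) = m2 (tensor_map f id s) t" for s t
  proof (rule tensor_eqI[where t = s])
    fix a b
    show "\<Phi> (m3 (L13 (a \<otimes> b)) (L23 t)) = m2 (tensor_map f id (a \<otimes> b)) t"
    proof (rule tensor_eqI[where t = t])
      show "\<Phi> (m3 (L13 (a \<otimes> b)) (L23 (c \<otimes> d))) = m2 (tensor_map f id (a \<otimes> b)) (c \<otimes> d)" for c d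
        by (simp add: leg_tensor mult3_tensor mult2_tensor \<Phi> tensor_map_tensor f clinear_id)
    qed (intro multilinear)+
  qed (intro multilinear f)+
  ultimately show ?thesis using D_left by metis
qed

lemma counit_R: "tensor_map (\<lambda>a. \<epsilon> a *\<^sub>C e) id R = e \<otimes> e"
proof -
  have "clinear (\<lambda>a. \<epsilon> a *\<^sub>C e)" by (intro multilinear)
  from left_contraction[OF this] have "R = m2 (tensor_map (\<lambda>a. \<epsilon> a *\<^sub>C e) id R) R"
    by (simp add: mult_simps counit_left) (simp add: id_def tensor_map_ident)
  then show ?thesis
    by (metis R_flip T.assoc T.unit_right)
qed

lemma S_R: "tensor_map S id R = flip R"
proof -
  have "m2 (tensor_map S id R) R = e \<otimes> e"
    by (simp add: antipode_left counit_R flip: left_contraction[OF linear_S])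
  then show ?thesis
    by (metis R_flip T.assoc T.unit_left T.unit_right)
qed

lemma SS_R: "tensor_map (\<lambda>a. S (S a)) S R = flip R"
proof -
  have flip_map: "tensor_map id S (flip t) = flip (tensor_map S id t)"
    "tensor_map S id (flip t) = flip (tensor_map id S t)" for t
    by (rule tensor_eqI[where t = t], (intro multilinear linear_S)+,
      simp add: tensor_map_tensor flip_tensor linear_S clinear_id clinear_ident)+
  have "tensor_map id S (tensor_map S id R) = R"
    by (simp only: S_R flip_map flip_flip)
  then have "tensor_map S id (tensor_map id S (tensor_map S id R)) = flip R"
    by (simp only: S_R)
  then show ?thesis
    by (simp add: tensor_map_compose clinear_id linear_S clinear_compose[OF linear_S])
qed

abbreviation "\<Omega> \<equiv> tensor_lift (\<lambda>a b. S b \<star> a)"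

lemma \<Omega>_tensor: "\<Omega> (a \<otimes> b) = S b \<star> a"
  by (rule tensor_lift_tensor) (intro multilinear)

definition v where "v = \<Omega> R"

lemma drinfeld_eq: "drinfeld H R = v"
proof -
  have "tensor_lift (mult H) (flip (tensor_map id S t)) = \<Omega> t" for t
    by (rule tensor_eqI[where t = t], (intro multilinear bilinear linear_S)+)
      (simp add: \<Omega>_tensor tensor_map_tensor flip_tensor linear_S clinear_id clinear_ident
        tensor_lift_tensor bilinear)
  then show ?thesis by (simp add: drinfeld_def v_def)
qed

lemma \<Omega>_mult_right: "\<Omega> (m2 t s) = tensor_lift (\<lambda>c d. S d \<star> \<Omega> t \<star> c) s"
proof (rule tensor_eqI[where t = t])
  fix a b
  have bil: "cbilinear (\<lambda>c d. S d \<star> \<Omega> (a \<otimes> b) \<star> c)" by (intro multilinear)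
  show "\<Omega> (m2 (a \<otimes> b) s) = tensor_lift (\<lambda>c d. S d \<star> \<Omega> (a \<otimes> b) \<star> c) s"
    by (rule tensor_eqI[where t = s]) (intro multilinear | simp add: mult2_tensor
      tensor_lift_tensor[OF bil], simp add: \<Omega>_tensor S_mult assoc)+
qed (intro multilinear)+

lemma \<Omega>_mult_left:
  "\<Omega> (m2 (flip s) t) = tensor_lift (\<lambda>a b. S b \<star> tensor_lift (\<lambda>c d. S c \<star> d) s \<star> a) t"
proof (rule tensor_eqI[where t = s])
  fix c d
  have bil: "cbilinear (\<lambda>a b. S b \<star> tensor_lift (\<lambda>c d. S c \<star> d) (c \<otimes> d) \<star> a)" by (intro multilinear)
  show "\<Omega> (m2 (flip (c \<otimes> d)) t) =
      tensor_lift (\<lambda>a b. S b \<star> tensor_lift (\<lambda>c d. S c \<star> d) (c \<otimes> d) \<star> a) t"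
    by (rule tensor_eqI[where t = t]) (intro multilinear | simp add: mult2_tensor flip_tensor
      tensor_lift_tensor[OF bil], simp add: tensor_lift_tensor[OF bilinear_structure(1)] \<Omega>_tensor S_mult assoc)+
qed (intro multilinear)+

text \<open>
  Multiply the identity \<open>flip(\<Delta>(x\<^sub>1)) R \<otimes> x\<^sub>2 = R \<Delta>(x\<^sub>1) \<otimes> x\<^sub>2\<close> out by
  \<open>p \<otimes> q \<otimes> z \<mapsto> S\<^sup>2(z) S(q) p\<close>. On the left \<open>S(x\<^sub>1) x\<^sub>2\<close> appears next to the factors of \<open>R\<close>, on the right
  \<open>S(x\<^sub>2 S(x\<^sub>3))\<close>, so that all but one coproduct factor is contracted away.
\<close>

lemma drinfeld_commute: "v \<star> x = S (S x) \<star> v"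
proof -
  have left: "\<Omega> (m2 (flip (D y)) R) = \<epsilon> y *\<^sub>C v" for y
  proof -
    have bil: "cbilinear (\<lambda>a b. S b \<star> a)" by (intro multilinear)
    show ?thesis
      unfolding \<Omega>_mult_left antipode_left v_def
      using clinear_tensor_lift_distrib[OF clinear_times_scalar[OF clinear_ident] bil, of "\<epsilon> y" R]
      by (simp add: mult_simps)
  qed
  have right: "\<Omega> (m2 R (D y)) = tensor_lift (\<lambda>c d. S d \<star> v \<star> c) (D y)" for y
    by (simp only: \<Omega>_mult_right v_def)
  have "S (S x) \<star> v = tensor_lift (\<lambda>y z. S (S z) \<star> (\<epsilon> y *\<^sub>C v)) (D x)"
  proof -
    have "clinear (\<lambda>x. S (S x) \<star> v)" by (intro multilinear)
    from clinear_tensor_lift_distrib[OF this bilinear_structure(3), of "D x"]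
    show ?thesis by (simp add: counit_left clinear_scaleC[OF linear_S] mult_simps)
  qed
  also have "\<dots> = tensor_lift (\<lambda>y z. S (S z) \<star> tensor_lift (\<lambda>c d. S d \<star> v \<star> c) (D y)) (D x)"
    by (simp only: quasi right flip: left)
  also have "\<dots> = tensor_lift (\<lambda>y z. tensor_lift (\<lambda>c d. S (S z) \<star> (S d \<star> v \<star> c)) (D y)) (D x)"
    by (subst clinear_tensor_lift_distrib[OF clinear_mult_right[OF clinear_ident]]) (intro multilinear refl)+
  also have "\<dots> = tensor_lift (\<lambda>c b. tensor_lift (\<lambda>d z. S (S z) \<star> (S d \<star> v \<star> c)) (D b)) (D x)"
    by (rule coassociativity_trilinear[OF coalgebra]) (intro multilinear)+
  also have "\<dots> = tensor_lift (\<lambda>c b. S (tensor_lift (\<lambda>d z. d \<star> S z) (D b)) \<star> v \<star> c) (D x)"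
  proof -
    have "clinear (\<lambda>y. S y \<star> v \<star> c)" for c by (intro multilinear)
    from clinear_tensor_lift_distrib[OF this bilinear_structure(2)] show ?thesis
      by (simp add: S_mult assoc)
  qed
  also have "\<dots> = tensor_lift (\<lambda>c b. v \<star> (\<epsilon> b *\<^sub>C c)) (D x)"
    by (simp add: antipode_right clinear_scaleC[OF linear_S] S_e mult_simps)
  also have "\<dots> = v \<star> x"
    using clinear_tensor_lift_distrib[OF clinear_mult_right[OF clinear_ident] bilinear_structure(4), of v "D x"]
    by (simp add: counit_right)
  finally show ?thesis by simp
qed

text \<open>
  By the second hexagon axiom and \<open>\<Delta> S = flip (S \<otimes> S) \<Delta>\<close> the left side is
  \<open>\<Sum> S(b) a a' \<otimes> S(b') = \<Sum> v a' \<otimes> S(b')\<close>, where \<open>\<Sum> a \<otimes> b\<close> and \<open>\<Sum> a' \<otimes> b'\<close> are copies of \<open>R\<close>.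
  Moving \<open>v\<close> to the right turns this into \<open>(S\<^sup>2 \<otimes> S)(R) (v \<otimes> 1)\<close>.
\<close>

lemma contraction_right: "tensor_lift (\<lambda>a b. m2 (D (S b)) (a \<otimes> e)) R = m2 (flip R) (v \<otimes> e)"
proof -
  define \<Psi> where "\<Psi> = tensor_lift (\<lambda>a s. m2 (flip (tensor_map S S s)) (a \<otimes> e))"
  have bil: "cbilinear (\<lambda>a s. m2 (flip (tensor_map S S s)) (a \<otimes> e))"
    by (intro multilinear linear_S)
  have \<Psi>_linear: "clinear \<Psi>" unfolding \<Psi>_def by (rule clinear_tensor_lift[OF bil])
  note [multilinear] = clinear_compose[OF \<Psi>_linear]
  have \<Psi>: "\<Psi> (a \<otimes> s) = m2 (flip (tensor_map S S s)) (a \<otimes> e)" for a s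
    unfolding \<Psi>_def by (rule tensor_lift_tensor[OF bil])
  have bil': "cbilinear (\<lambda>a b. m2 (D (S b)) (a \<otimes> e))" by (intro multilinear)
  have "tensor_lift (\<lambda>a b. m2 (D (S b)) (a \<otimes> e)) t = \<Psi> (tensor_map id D t)" for t
  proof (rule tensor_eqI[where t = t])
    show "tensor_lift (\<lambda>a b. m2 (D (S b)) (a \<otimes> e)) (a \<otimes> b) = \<Psi> (tensor_map id D (a \<otimes> b))" for a b
      unfolding tensor_lift_tensor[OF bil'] tensor_map_tensor[OF clinear_id linear_D] \<Psi>
      by (simp add: D_S)
  qed (intro multilinear linear_D)+
  moreover have "\<Psi> (m3 (L13 s) (L12 t)) = tensor_map (\<lambda>a. \<Omega> s \<star> a) S t" for s t
  proof (rule tensor_eqI[where t = s])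
    fix a b
    have lin: "clinear (\<lambda>c. \<Omega> (a \<otimes> b) \<star> c)" by (intro multilinear)
    show "\<Psi> (m3 (L13 (a \<otimes> b)) (L12 t)) = tensor_map (\<lambda>c. \<Omega> (a \<otimes> b) \<star> c) S t"
    proof (rule tensor_eqI[where t = t])
      show "\<Psi> (m3 (L13 (a \<otimes> b)) (L12 (c \<otimes> d))) = tensor_map (\<lambda>c. \<Omega> (a \<otimes> b) \<star> c) S (c \<otimes> d)" for c d
        unfolding tensor_map_tensor[OF lin linear_S]
        unfolding leg_tensor mult3_tensor mult2_tensor \<Psi>
          tensor_map_tensor[OF linear_S linear_S] flip_tensor \<Omega>_tensor by (simp add: assoc)
    qed (intro multilinear lin linear_S)+
    show "clinear (\<lambda>s. tensor_map (\<lambda>a. \<Omega> s \<star> a) S t)"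
      unfolding tensor_map_def by (intro multilinear)
  qed (intro multilinear)+
  ultimately have "tensor_lift (\<lambda>a b. m2 (D (S b)) (a \<otimes> e)) R = tensor_map (\<lambda>a. v \<star> a) S R"
    by (simp add: D_right v_def)
  also have "\<dots> = tensor_map (\<lambda>a. S (S a) \<star> v) S R"
    by (simp add: drinfeld_commute)
  also have "\<dots> = m2 (tensor_map (\<lambda>a. S (S a)) S R) (v \<otimes> e)"
  proof -
    have lin: "clinear (\<lambda>a. S (S a))" "clinear (\<lambda>a. S (S a) \<star> v)" by (intro multilinear)+
    show ?thesis
      by (rule tensor_eqI[where t = R]) (intro multilinear lin linear_S |
        simp add: tensor_map_tensor lin linear_S mult2_tensor)+
  qed
  finally show ?thesis by (simp add: SS_R)
qed

text \<open>
  By the first hexagon axiom \<open>\<Delta>(v) = \<Sum> \<Delta>(S b) \<Delta>(a)\<close> equals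
  \<open>\<Sum> \<Delta>(S b') \<Delta>(S b) (a \<otimes> a')\<close>, summed over two copies of \<open>R\<close>. The inner sum is \<open>R\<^sub>2\<^sub>1 (v \<otimes> 1)\<close> by
  \<open>contraction_right\<close>. Then \<open>\<Delta>(S b')\<close> is moved across \<open>R\<^sub>2\<^sub>1\<close>, the inverse of \<open>R\<close>; this flips it, and
  the outer sum becomes the flip of the same contraction.
\<close>

lemma D_drinfeld: "D v = v \<otimes> v"
proof -
  define P where "P = tensor_lift (\<lambda>a b. m2 (D (S b)) (a \<otimes> e))"
  have bilP: "cbilinear (\<lambda>a b. m2 (D (S b)) (a \<otimes> e))" by (intro multilinear)
  have linear_P: "clinear P" unfolding P_def by (rule clinear_tensor_lift[OF bilP])
  have P: "P (a \<otimes> b) = m2 (D (S b)) (a \<otimes> e)" for a b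
    unfolding P_def by (rule tensor_lift_tensor[OF bilP])
  have P_R: "P R = m2 (flip R) (v \<otimes> e)"
    unfolding P_def by (rule contraction_right)
  define \<Psi> where "\<Psi> = tensor_lift (\<lambda>p s. tensor_lift (\<lambda>q b. m2 (D (S b)) (p \<otimes> q)) s)"
  have bil: "cbilinear (\<lambda>p s. tensor_lift (\<lambda>q b. m2 (D (S b)) (p \<otimes> q)) s)"
    "\<And>p. cbilinear (\<lambda>q b. m2 (D (S b)) (p \<otimes> q))"
    by (intro multilinear)+
  have \<Psi>_linear: "clinear \<Psi>" unfolding \<Psi>_def by (rule clinear_tensor_lift[OF bil(1)])
  note [multilinear] = clinear_compose[OF \<Psi>_linear] clinear_compose[OF linear_P]
  have \<Psi>: "\<Psi> (p \<otimes> q \<otimes> b) = m2 (D (S b)) (p \<otimes> q)" for p q b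
    unfolding \<Psi>_def tensor_lift_tensor[OF bil(1)] tensor_lift_tensor[OF bil(2)] ..
  have assoc: "\<Psi> (tensor_assoc (s \<otimes> b)) = m2 (D (S b)) s" for s b
    by (rule tensor_eqI[where t = s]) (intro multilinear | simp add: tensor_assoc_tensor \<Psi>)+
  have bilD: "cbilinear (\<lambda>a b. S b \<star> a)" by (intro multilinear)
  have "D (\<Omega> t) = \<Psi> (tensor_assoc (tensor_map D id t))" for t
  proof (rule tensor_eqI[where t = t])
    show "D (\<Omega> (a \<otimes> b)) = \<Psi> (tensor_assoc (tensor_map D id (a \<otimes> b)))" for a b
      by (simp add: \<Omega>_tensor tensor_map_tensor linear_D clinear_id assoc D_mult)
  qed (intro multilinear linear_D)+
  then have "D v = \<Psi> (m3 (L13 R) (L23 R))"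
    by (simp add: v_def D_left)
  also have "\<Psi> (m3 (L13 s) (L23 t)) = tensor_lift (\<lambda>a b. m2 (m2 (D (S b)) (P s)) (e \<otimes> a)) t" for s t
  proof (rule tensor_eqI[where t = s])
    fix a b
    have bil: "cbilinear (\<lambda>c d. m2 (m2 (D (S d)) (P (a \<otimes> b))) (e \<otimes> c))" by (intro multilinear)
    show "\<Psi> (m3 (L13 (a \<otimes> b)) (L23 t)) = tensor_lift (\<lambda>c d. m2 (m2 (D (S d)) (P (a \<otimes> b))) (e \<otimes> c)) t"
    proof (rule tensor_eqI[where t = t])
      show "\<Psi> (m3 (L13 (a \<otimes> b)) (L23 (c \<otimes> d))) =
          tensor_lift (\<lambda>c d. m2 (m2 (D (S d)) (P (a \<otimes> b))) (e \<otimes> c)) (c \<otimes> d)" for c d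
        unfolding tensor_lift_tensor[OF bil]
        unfolding leg_tensor mult3_tensor mult2_tensor \<Psi> P S_mult D_mult
        by (simp add: T.assoc mult2_tensor)
    qed (intro multilinear)+
  qed (intro multilinear)+
  also have "(\<lambda>a b. m2 (m2 (D (S b)) (P R)) (e \<otimes> a)) =
      (\<lambda>a b. m2 (m2 (flip R) (flip (m2 (D (S b)) (a \<otimes> e)))) (v \<otimes> e))"
  proof (intro ext)
    fix a b
    \<comment> \<open>The axiom \<open>flip(\<Delta>(h)) R = R \<Delta>(h)\<close>, multiplied by \<open>R\<^sub>2\<^sub>1\<close> on both sides.\<close>
    have D_flip: "m2 (D h) (flip R) = m2 (flip R) (flip (D h))" for h
      by (metis quasi R_flip flip_R T.assoc T.unit_left T.unit_right)
    have "m2 (m2 (D (S b)) (P R)) (e \<otimes> a) = m2 (m2 (D (S b)) (flip R)) (m2 (v \<otimes> e) (e \<otimes> a))"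
      by (simp only: P_R T.assoc)
    also have "m2 (v \<otimes> e) (e \<otimes> a) = m2 (e \<otimes> a) (v \<otimes> e)"
      by (simp add: mult2_tensor)
    finally show "m2 (m2 (D (S b)) (P R)) (e \<otimes> a) =
        m2 (m2 (flip R) (flip (m2 (D (S b)) (a \<otimes> e)))) (v \<otimes> e)"
      by (simp add: D_flip T.assoc flip_mult flip_tensor)
  qed
  also have "tensor_lift \<dots> R = m2 (m2 (flip R) (flip (P R))) (v \<otimes> e)"
  proof -
    have "clinear (\<lambda>t. m2 (m2 (flip R) (flip t)) (v \<otimes> e))" by (intro multilinear)
    from clinear_tensor_lift_distrib[OF this bilP, of R] show ?thesis by (simp add: P_def)
  qed
  also have "\<dots> = m2 (m2 (m2 (flip R) R) (e \<otimes> v)) (v \<otimes> e)"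
    by (simp add: P_R flip_mult flip_flip flip_tensor T.assoc)
  also have "\<dots> = v \<otimes> v"
    by (simp add: flip_R mult2_tensor)
  finally show ?thesis .
qed

end

lemma triangular_hopf_iff: "triangular H R \<longleftrightarrow> triangular_hopf H R"
  unfolding triangular_def triangular_axioms_def triangular_hopf_def ordinary_hopf_def
    triangular_hopf_axioms_def leg12_def leg13_def leg23_def by blast

section \<open>Bijections between classes\<close>

lemma induced_class:
  assumes s: "equiv B s" and x: "(x, x) \<in> r" and f: "\<And>y. (x, y) \<in> r \<Longrightarrow> (f x, f y) \<in> s"
  shows "induced s f (r `` {x}) = s `` {f x}"
proof -
  have "s `` {f y} = s `` {f x}" if "(x, y) \<in> r" for y
    using equiv_class_eq[OF s f[OF that]] by simp
  then show ?thesis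
    using x unfolding induced_def by blast
qed

text \<open>
  A bijection between objects that preserves and reflects isomorphism induces a bijection between
  isomorphism classes.
\<close>

lemma bij_betw_induced:
  assumes r: "equiv A r" and s: "equiv B s" and F: "bij_betw F A B"
    and iff: "\<And>x y. x \<in> A \<Longrightarrow> y \<in> A \<Longrightarrow> (x, y) \<in> r \<longleftrightarrow> (F x, F y) \<in> s"
  shows "bij_betw (induced s F) (A // r) (B // s)"
proof -
  have class_F: "induced s F (r `` {x}) = s `` {F x}" if "x \<in> A" for x
    using equiv_type[OF r] iff that equiv_class_self[OF r that] by (intro induced_class[OF s]) auto
  have FB: "F x \<in> B" if "x \<in> A" for x
    using F that by (auto simp: bij_betw_def)
  have "inj_on (induced s F) (A // r)"
  proof (rule inj_onI)
    fix X Y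
    assume "X \<in> A // r" "Y \<in> A // r" and eq: "induced s F X = induced s F Y"
    then obtain x y where xy: "x \<in> A" "y \<in> A" and X: "X = r `` {x}" "Y = r `` {y}"
      by (auto simp: quotient_def)
    from eq have "s `` {F x} = s `` {F y}" by (simp add: X class_F xy)
    then have "(F x, F y) \<in> s" using eq_equiv_class[OF _ s FB[OF xy(2)]] by blast
    then show "X = Y" using equiv_class_eq[OF r] iff xy X by blast
  qed
  moreover have "induced s F ` (A // r) = B // s"
  proof -
    have "induced s F ` (A // r) = (\<lambda>x. s `` {F x}) ` A"
      unfolding quotient_def using class_F by auto
    also have "\<dots> = (\<lambda>y. s `` {y}) ` (F ` A)" by auto
    also have "\<dots> = B // s" using F by (auto simp: bij_betw_def quotient_def)
    finally show ?thesis .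
  qed
  ultimately show ?thesis by (simp add: bij_betw_def)
qed

text \<open>
  All four isomorphism relations have this form, for different notions of structure preserving
  map \<open>I f x y\<close>.
\<close>

lemma equiv_isomorphic:
  assumes "\<And>x. I id x x" "\<And>f x y. I f x y \<Longrightarrow> I (inv f) y x"
    and "\<And>f g x y z. I f x y \<Longrightarrow> I g y z \<Longrightarrow> I (g \<circ> f) x z"
  shows "equiv A {(x, y). x \<in> A \<and> y \<in> A \<and> (\<exists>f. I f x y)}"
proof (rule equivI)
  show "refl_on A {(x, y). x \<in> A \<and> y \<in> A \<and> (\<exists>f. I f x y)}"
    using assms(1) by (auto simp: refl_on_def)
  show "sym {(x, y). x \<in> A \<and> y \<in> A \<and> (\<exists>f. I f x y)}"
    using assms(2) by (auto simp: sym_def)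
  show "trans {(x, y). x \<in> A \<and> y \<in> A \<and> (\<exists>f. I f x y)}"
    unfolding trans_def using assms(3) by blast
qed auto

section \<open>Isomorphisms\<close>

lemma hopf_iso_id: "hopf_iso id H H"
  by (simp add: hopf_iso_def clinear_id) (simp add: id_def tensor_map_ident)

lemma hopf_iso_comp:
  assumes "hopf_iso f H K" "hopf_iso g K L" shows "hopf_iso (g \<circ> f) H L"
  using assms unfolding hopf_iso_def comp_def
  by (auto simp: clinear_compose tensor_map_compose intro: bij_comp[unfolded comp_def])

lemma tensor_map_inv:
  assumes "clinear f" "bij f" "clinear (inv f)"
  shows "tensor_map (inv f) (inv f) (tensor_map f f t) = t"
  using assms by (simp add: tensor_map_compose bij_is_inj tensor_map_ident)

lemma clinear_inv:
  assumes "clinear f" "bij f" shows "clinear (inv f)"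
proof (rule clinearI)
  fix x y c
  have f: "f (inv f z) = z" "inv f (f w) = w" for z w
    using assms(2) by (simp_all add: bij_is_surj surj_f_inv_f bij_is_inj)
  show "inv f (x + y) = inv f x + inv f y" "inv f (c *\<^sub>C x) = c *\<^sub>C inv f x"
    using clinear_add[OF assms(1), of "inv f x" "inv f y"] clinear_scaleC[OF assms(1), of c "inv f x"]
    by (metis f)+
qed

lemma hopf_iso_inv:
  assumes "hopf_iso f H K" shows "hopf_iso (inv f) K H"
proof -
  have f: "clinear f" "bij f" and hom: "\<And>x y. f (mult H x y) = mult K (f x) (f y)" "f (unity H) = unity K"
    "\<And>x. comult K (f x) = tensor_map f f (comult H x)" "\<And>x. counit K (f x) = counit H x"
    "\<And>x. antipode K (f x) = f (antipode H x)"
    using assms by (auto simp: hopf_iso_def)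
  have inv: "f (inv f z) = z" "inv f (f w) = w" for z w
    using f(2) by (simp_all add: bij_is_surj surj_f_inv_f bij_is_inj)
  have lin: "clinear (inv f)" by (rule clinear_inv[OF f])
  show ?thesis
    unfolding hopf_iso_def
  proof (intro conjI allI lin bij_imp_bij_inv f)
    fix x y
    show "inv f (mult K x y) = mult H (inv f x) (inv f y)" by (metis inv hom(1))
    show "inv f (unity K) = unity H" by (metis inv hom(2))
    show "comult H (inv f x) = tensor_map (inv f) (inv f) (comult K x)"
      using hom(3)[of "inv f x"] by (simp add: inv tensor_map_inv f lin)
    show "counit H (inv f x) = counit K x" by (metis inv hom(4))
    show "antipode H (inv f x) = inv f (antipode K x)" by (metis inv hom(5))
  qed
qed

lemma super_hopf_iso_id: "super_hopf_iso id H H"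
  by (simp add: super_hopf_iso_def hopf_iso_id)

lemma super_hopf_iso_comp:
  "super_hopf_iso f H K \<Longrightarrow> super_hopf_iso g K L \<Longrightarrow> super_hopf_iso (g \<circ> f) H L"
  unfolding super_hopf_iso_def image_comp[symmetric] by (auto intro: hopf_iso_comp)

lemma super_hopf_iso_inv:
  assumes "super_hopf_iso f H K" shows "super_hopf_iso (inv f) K H"
proof -
  have "hopf_iso f H K" and gr: "\<And>i. f ` grade H i = grade K i"
    using assms by (auto simp: super_hopf_iso_def)
  then have "bij f" by (simp add: hopf_iso_def)
  then have "inv f ` grade K i = grade H i" for i
    by (simp add: gr[symmetric] image_inv_f_f bij_is_inj)
  with hopf_iso_inv[OF \<open>hopf_iso f H K\<close>] show ?thesis by (simp add: super_hopf_iso_def)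
qed

lemma hopf_iso_linear_bij:
  "hopf_iso f H K \<Longrightarrow> clinear f" "hopf_iso f H K \<Longrightarrow> bij f"
  "super_hopf_iso f H' K' \<Longrightarrow> clinear f" "super_hopf_iso f H' K' \<Longrightarrow> bij f"
  by (simp_all add: hopf_iso_def super_hopf_iso_def)

lemma hopf_iso_inv_cancel:
  "hopf_iso f H K \<Longrightarrow> inv f (f x) = x" "super_hopf_iso f H' K' \<Longrightarrow> inv f (f x) = x"
  by (metis hopf_iso_linear_bij bij_is_inj inv_f_f)+

lemma inv_tensor_map_iso:
  assumes "clinear f" "bij f" shows "tensor_map (inv f) (inv f) (tensor_map f f t) = t"
  by (rule tensor_map_inv[OF assms clinear_inv[OF assms]])

lemma equiv_hopf_pair_iso: "equiv hopf_pairs hopf_pair_iso"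
proof -
  have "equiv hopf_pairs {(x, y). x \<in> hopf_pairs \<and> y \<in> hopf_pairs \<and>
      (\<exists>f. hopf_iso f (fst x) (fst y) \<and> f (snd x) = snd y)}"
    by (rule equiv_isomorphic)
      (auto simp: hopf_iso_id hopf_iso_inv hopf_iso_comp intro: hopf_iso_inv_cancel)
  also have "{(x, y). x \<in> hopf_pairs \<and> y \<in> hopf_pairs \<and>
      (\<exists>f. hopf_iso f (fst x) (fst y) \<and> f (snd x) = snd y)} = hopf_pair_iso"
    by (auto simp: hopf_pair_iso_def)
  finally show ?thesis .
qed

lemma equiv_super_pair_iso: "equiv super_pairs super_pair_iso"
proof -
  have "equiv super_pairs {(x, y). x \<in> super_pairs \<and> y \<in> super_pairs \<and>
      (\<exists>f. super_hopf_iso f (fst x) (fst y) \<and> f (snd x) = snd y)}"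
    by (rule equiv_isomorphic)
      (auto simp: super_hopf_iso_id super_hopf_iso_inv super_hopf_iso_comp
        intro: hopf_iso_inv_cancel)
  also have "{(x, y). x \<in> super_pairs \<and> y \<in> super_pairs \<and>
      (\<exists>f. super_hopf_iso f (fst x) (fst y) \<and> f (snd x) = snd y)} = super_pair_iso"
    by (auto simp: super_pair_iso_def)
  finally show ?thesis .
qed

lemma equiv_triangular_iso: "equiv triangular_hopfs triangular_iso"
proof -
  define I :: "('a \<Rightarrow> 'a) \<Rightarrow> 'a::complex_vector hopf \<times> ('a \<otimes> 'a) \<Rightarrow> 'a hopf \<times> ('a \<otimes> 'a) \<Rightarrow> bool"
    where "I f x y \<longleftrightarrow> hopf_iso f (fst x) (fst y) \<and> tensor_map f f (snd x) = snd y" for f x y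
  have "equiv triangular_hopfs {(x, y). x \<in> triangular_hopfs \<and> y \<in> triangular_hopfs \<and> (\<exists>f. I f x y)}"
  proof (rule equiv_isomorphic)
    fix f g and x y z :: "'a hopf \<times> ('a \<otimes> 'a)"
    show "I id x x"
      by (simp add: I_def hopf_iso_id) (simp add: id_def tensor_map_ident)
    assume f: "I f x y"
    then show "I (inv f) y x"
      unfolding I_def by (metis hopf_iso_inv hopf_iso_linear_bij(1,2) inv_tensor_map_iso)
    assume g: "I g y z"
    from f g have "tensor_map (g \<circ> f) (g \<circ> f) (snd x) = snd z"
      by (auto simp: I_def comp_def hopf_iso_def simp flip: tensor_map_compose)
    with f g show "I (g \<circ> f) x z"
      by (auto simp: I_def intro: hopf_iso_comp)
  qed
  also have "{(x, y). x \<in> triangular_hopfs \<and> y \<in> triangular_hopfs \<and> (\<exists>f. I f x y)} = triangular_iso"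
    by (auto simp: triangular_iso_def I_def)
  finally show ?thesis .
qed

lemma equiv_super_triangular_iso: "equiv super_triangular_pairs super_triangular_iso"
proof -
  define I :: "('a \<Rightarrow> 'a) \<Rightarrow> 'a::complex_vector super_hopf \<times> ('a \<otimes> 'a) \<times> 'a \<Rightarrow>
      'a super_hopf \<times> ('a \<otimes> 'a) \<times> 'a \<Rightarrow> bool"
    where "I f x y \<longleftrightarrow> super_hopf_iso f (fst x) (fst y) \<and>
      tensor_map f f (fst (snd x)) = fst (snd y) \<and> f (snd (snd x)) = snd (snd y)" for f x y
  have "equiv super_triangular_pairs {(x, y). x \<in> super_triangular_pairs \<and>
      y \<in> super_triangular_pairs \<and> (\<exists>f. I f x y)}"
  proof (rule equiv_isomorphic)
    fix f g and x y z :: "'a super_hopf \<times> ('a \<otimes> 'a) \<times> 'a"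
    show "I id x x"
      by (simp add: I_def super_hopf_iso_id) (simp add: id_def tensor_map_ident)
    assume f: "I f x y"
    then show "I (inv f) y x"
      unfolding I_def
      by (metis super_hopf_iso_inv hopf_iso_linear_bij(3,4) inv_tensor_map_iso hopf_iso_inv_cancel(2))
    assume g: "I g y z"
    from f g have "tensor_map (g \<circ> f) (g \<circ> f) (fst (snd x)) = fst (snd z)"
      by (auto simp: I_def comp_def super_hopf_iso_def hopf_iso_def simp flip: tensor_map_compose)
    with f g show "I (g \<circ> f) x z"
      by (auto simp: I_def intro: super_hopf_iso_comp)
  qed
  also have "{(x, y). x \<in> super_triangular_pairs \<and> y \<in> super_triangular_pairs \<and> (\<exists>f. I f x y)} =
      super_triangular_iso"
    by (auto simp: super_triangular_iso_def I_def)
  finally show ?thesis .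
qed

section \<open>Superization as a bijection\<close>

lemma hopf_truncate_simps [simp]:
  "mult (hopf.truncate X) = mult X" "unity (hopf.truncate X) = unity X"
  "comult (hopf.truncate X) = comult X" "counit (hopf.truncate X) = counit X"
  "antipode (hopf.truncate X) = antipode X"
  by (simp_all add: hopf.truncate_def)

lemma axioms_truncate:
  "algebra_axioms (hopf.truncate X) = algebra_axioms X"
  "coalgebra_axioms (hopf.truncate X) = coalgebra_axioms X"
  "antipode_axioms (hopf.truncate X) = antipode_axioms X"
  "bialgebra_axioms n (hopf.truncate X) = bialgebra_axioms n X"
  "twistable (hopf.truncate X) u = twistable X u"
  "hopf_iso f (hopf.truncate X) (hopf.truncate Y) = hopf_iso f X Y"
  "twist_hopf (hopf.truncate X) u = twist_hopf X u"
  by (simp_all add: algebra_axioms_def coalgebra_axioms_def antipode_axioms_def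
    bialgebra_axioms_def twistable_def hopf_iso_def twist_hopf_def)

lemma super_hopf_eqI:
  fixes X Y :: "'a::complex_vector super_hopf"
  assumes "hopf.truncate X = hopf.truncate Y" "grade X = grade Y"
  shows "X = Y"
  using assms by (cases X, cases Y) (simp add: hopf.truncate_def)

lemma alg_inverse_self:
  assumes "complex_algebra (mult H) (unity H)" "mult H u u = unity H"
  shows "alg_inverse H u = u"
proof -
  interpret complex_algebra "mult H" "unity H" by fact
  show ?thesis
    unfolding alg_inverse_def
    by (rule the_equality) (use assms(2) assoc unit_left unit_right in metis)+
qed

lemma conj_by_ad:
  assumes "complex_algebra (mult H) (unity H)" "mult H u u = unity H"
  shows "conj_by H u x = ad (mult H) u x"
  by (simp add: conj_by_def ad_def alg_inverse_self[OF assms])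

lemma counit_grouplike:
  assumes H: "coalgebra_axioms H" and u: "grouplike H u"
  shows "counit H u = 1"
proof -
  have bil: "cbilinear (\<lambda>a b. counit H a *\<^sub>C b)"
    using H by (intro multilinear) (auto simp: coalgebra_axioms_def)
  have "tensor_lift (\<lambda>a b. counit H a *\<^sub>C b) (u \<otimes> u) = counit H u *\<^sub>C u"
    by (rule tensor_lift_tensor[OF bil])
  then have "tensor_lift (\<lambda>a b. counit H a *\<^sub>C b) (comult H u) = counit H u *\<^sub>C u"
    using u by (simp add: grouplike_def)
  then have "counit H u *\<^sub>C u = 1 *\<^sub>C u"
    using H by (simp add: coalgebra_axioms_def scaleC_one)
  then show ?thesis
    using u unfolding complex_vector.scale_cancel_right by (simp add: grouplike_def)
qed

lemma twistable_hopf_pair: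
  assumes "(H, u) \<in> hopf_pairs" shows "twistable H u"
  using assms counit_grouplike[of H u]
  by (auto simp: hopf_pairs_def hopf_algebra_def twistable_def bialgebra_axioms_def grouplike_def)

context twistable_hopf
begin

lemma conj_by_u: "conj_by H u x = A x"
  by (rule conj_by_ad) (simp_all add: complex_algebra_axioms square)

lemma adjoint_grading_u: "adjoint_grading H u = eigen_grading A"
  by (simp add: adjoint_grading_def eigen_grading_def conj_by_u fun_eq_iff)

text \<open>
  The formula for the superized comultiplication multiplies by \<open>u\<close> on the left, \<open>\<theta>\<close> does so on the
  right. If \<open>a \<otimes> b\<close> has parity \<open>i\<close> and \<open>b\<close> is odd, then \<open>a\<close> has parity \<open>i + 1\<close> and
  \<open>-(-1)\<^sup>i u a = a u\<close>.
\<close>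

lemma superized_comult_homogeneous:
  assumes "A2 t = parity_sign i *\<^sub>C t"
  shows "tensor_map id (parity_part A 0) t
      - parity_sign i *\<^sub>C m2 (u \<otimes> e) (tensor_map id (parity_part A 1) t) = \<theta> t"
proof -
  interpret A: involution A by (rule involution_A)
  interpret A2: involution A2 by (rule involution_A2)
  let ?Q = "\<lambda>t. tensor_map id (parity_part A 0) t
      - parity_sign i *\<^sub>C m2 (u \<otimes> e) (tensor_map id (parity_part A 1) t)"
  have lin: "clinear (parity_part A j)" for j by (intro A.clinear_parity_part multilinear)
  have linear_Q: "clinear ?Q" by (intro multilinear lin)
  have "?Q (parity_part A2 i s) = \<theta> (parity_part A2 i s)" for s
  proof (rule tensor_homogeneous_eqI[OF involution_A involution_A, where t = s])
    show "clinear (\<lambda>s. ?Q (parity_part A2 i s))"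
      by (rule clinear_compose[OF linear_Q A2.clinear_parity_part[OF clinear_ident]])
    show "clinear (\<lambda>s. \<theta> (parity_part A2 i s))"
      by (intro multilinear A2.clinear_parity_part)
    fix a b k l
    assume a: "A a = parity_sign k *\<^sub>C a" and b: "A b = parity_sign l *\<^sub>C b"
    have "A2 (a \<otimes> b) = parity_sign (k + l) *\<^sub>C (a \<otimes> b)"
      unfolding parity_sign_add
      by (simp add: A2_tensor a b tensor_simps scaleC_scaleC mult.commute)
    note part = A2.parity_part_homogeneous[OF this, of i]
    show "?Q (parity_part A2 i (a \<otimes> b)) = \<theta> (parity_part A2 i (a \<otimes> b))"
    proof (cases "i = k + l")
      case False
      then show ?thesis
        using clinear_zero[OF linear_Q] by (simp only: part if_False clinear_zero[OF linear_theta])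
    next
      case True
      have "?Q (a \<otimes> b) = \<theta> (a \<otimes> b)"
        unfolding True parity_sign_add theta_homogeneous[OF b]
          tensor_map_tensor[OF clinear_id lin] A.parity_part_homogeneous[OF b]
        by (cases "l = 0") (simp_all add: tensor_simps mult2_tensor homogeneous_commute[OF a]
          scaleC_scaleC scaleC_one mult2_simps)
      moreover have "parity_part A2 i (a \<otimes> b) = a \<otimes> b" unfolding part by (rule if_P[OF True])
      ultimately show ?thesis by (simp only:)
    qed
  qed
  moreover have "parity_part A2 i t = t"
    using A2.parity_part_homogeneous[OF assms, of i] by simp
  ultimately show ?thesis by metis
qed

lemma theta_D_A: "A2 (\<theta> (D x)) = \<theta> (D (A x))"
  by (simp add: A2_theta D_A)

end

lemma superize_fields:
  assumes "twistable H u"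
  shows truncate_superize: "hopf.truncate (superize H u) = twist_hopf H u"
    and grade_superize: "grade (superize H u) = eigen_grading (ad (mult H) u)"
proof -
  interpret twistable_hopf H u by (rule twistable_hopf.intro[OF assms])
  interpret A: involution A by (rule involution_A)
  show "grade (superize H u) = eigen_grading (ad (mult H) u)"
    by (simp add: superize_def Let_def adjoint_grading_u)
  have comp: "component (adjoint_grading H u) i = parity_part A i" for i
    by (rule ext) (simp add: adjoint_grading_u A.component_eigen)
  have "comult (superize H u) h = \<theta> (D h)" for h
  proof -
    have part: "A2 (D (parity_part A i h)) = parity_sign i *\<^sub>C D (parity_part A i h)" for i
      by (simp add: D_A[symmetric] A.parity_part_eigen clinear_scaleC[OF linear_D])
    have "comult (superize H u) h = \<theta> (D (parity_part A 0 h)) + \<theta> (D (parity_part A 1 h))"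
      unfolding superized_comult_homogeneous[OF part, symmetric]
      by (simp add: superize_def Let_def comp)
    also have "\<dots> = \<theta> (D h)"
      by (simp only: clinear_add[OF linear_theta, symmetric] clinear_add[OF linear_D, symmetric]
        A.parity_part_sum)
    finally show ?thesis .
  qed
  then show "hopf.truncate (superize H u) = twist_hopf H u"
    by (intro hopf.equality ext)
      (simp_all add: hopf.truncate_def superize_def Let_def comp twist_hopf_def)
qed

lemma superize_simps:
  assumes "twistable H u"
  shows "mult (superize H u) = mult H" "unity (superize H u) = unity H"
    "comult (superize H u) = comult (twist_hopf H u)" "counit (superize H u) = counit H"
    "antipode (superize H u) = antipode (twist_hopf H u)"
  using truncate_superize[OF assms] by (metis hopf_truncate_simps twist_hopf_simps(1-3))+

lemma superize_axioms:
  assumes "twistable H u"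
  shows "algebra_axioms (superize H u)" "coalgebra_axioms (superize H u)"
    "antipode_axioms (superize H u)"
    "bialgebra_axioms (super_mult2 (superize H u)) (superize H u) \<longleftrightarrow> bialgebra_axioms (hopf_mult2 H) H"
proof -
  interpret twistable_hopf H u by (rule twistable_hopf.intro[OF assms])
  show "algebra_axioms (superize H u)" "coalgebra_axioms (superize H u)"
    "antipode_axioms (superize H u)"
    unfolding axioms_truncate(1-3)[of "superize H u", symmetric] truncate_superize[OF assms]
    using twistable_twist coalgebra_twist antipode_twist by (simp_all add: twistable_def)
  show "bialgebra_axioms (super_mult2 (superize H u)) (superize H u) \<longleftrightarrow> bialgebra_axioms (hopf_mult2 H) H"
    unfolding axioms_truncate(4)[of _ "superize H u", symmetric] truncate_superize[OF assms]
      grade_superize[OF assms] superize_simps[OF assms] by (rule bialgebra_twist_iff)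
qed

lemma twist_superize:
  assumes "twistable H u" shows "twist_hopf (superize H u) u = H"
proof -
  interpret twistable_hopf H u by (rule twistable_hopf.intro[OF assms])
  show ?thesis
    unfolding axioms_truncate(7)[of "superize H u", symmetric] truncate_superize[OF assms] twist_twist
    by (simp add: hopf.truncate_def)
qed

lemma superize_in_super_pairs:
  assumes "(H, u) \<in> hopf_pairs" shows "(superize H u, u) \<in> super_pairs"
proof -
  note tw = twistable_hopf_pair[OF assms]
  interpret twistable_hopf H u by (rule twistable_hopf.intro[OF tw])
  interpret A: involution A by (rule involution_A)
  have H: "hopf_algebra H" and u: "u \<noteq> 0"
    using assms by (auto simp: hopf_pairs_def grouplike_def)
  note gr = grade_superize[OF tw] superize_simps[OF tw]
  have eigen: "x \<in> eigen_grading A i \<longleftrightarrow> A x = parity_sign i *\<^sub>C x" for x i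
    by (simp add: eigen_grading_def)
  have "hopf_superalgebra (superize H u)"
    unfolding hopf_superalgebra_def
  proof (intro conjI allI ballI)
    show "is_grading (grade (superize H u))"
      unfolding gr by (rule A.is_grading_eigen)
    show "bialgebra_axioms (super_mult2 (superize H u)) (superize H u)"
      using superize_axioms(4)[OF tw] H by (simp add: hopf_algebra_def)
    show "mult (superize H u) x y \<in> grade (superize H u) (i + j)"
      if "x \<in> grade (superize H u) i" "y \<in> grade (superize H u) j" for i j x y
      using that unfolding gr eigen parity_sign_add
      by (simp add: A_mult mult_simps scaleC_scaleC mult.commute)
    show "unity (superize H u) \<in> grade (superize H u) 0"
      unfolding gr eigen by (simp add: scaleC_one)
    show "comult (superize H u) x \<in>
        tensor_grading (grade (superize H u)) (grade (superize H u)) i"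
      if "x \<in> grade (superize H u) i" for i x
      using that unfolding gr tensor_grading_eigen[OF involution_A involution_A]
      by (simp add: eigen_grading_def theta_D_A clinear_scaleC[OF linear_D] clinear_scaleC[OF linear_theta])
    show "counit (superize H u) x = 0" if "x \<in> grade (superize H u) 1" for x
      using that unfolding gr eigen by (simp add: scaleC_one counit_odd)
    show "antipode (superize H u) x \<in> grade (superize H u) i" if "x \<in> grade (superize H u) i" for i x
    proof -
      have x: "A x = parity_sign i *\<^sub>C x" using that unfolding gr eigen .
      then have "A (S x) = parity_sign i *\<^sub>C S x"
        by (simp add: S_A[symmetric] clinear_scaleC[OF linear_S])
      then show ?thesis
        unfolding gr eigen S'_homogeneous[OF x] by (rule homogeneous_pow)
    qed
  qed (use superize_axioms[OF tw] in auto)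
  moreover have "conj_by (superize H u) u x = A x" for x
    unfolding conj_by_u[symmetric] by (simp add: conj_by_def alg_inverse_def gr)
  ultimately show ?thesis
    using u by (simp add: super_pairs_def grouplike_def gr eigen square D_u theta_pure_even)
qed

text \<open>
  A grading for which \<open>g\<close> acts by parity is the grading by conjugation with \<open>g\<close>: if
  \<open>x = y + z\<close> with \<open>y\<close> even and \<open>z\<close> odd is an eigenvector, one of \<open>y\<close> and \<open>z\<close> vanishes. So the
  grading of a super pair can be recovered from \<open>g\<close>.
\<close>

lemma super_pair_twistable:
  assumes "(K, g) \<in> super_pairs"
  shows "twistable K g" and "grade K = eigen_grading (ad (mult K) g)"
proof -
  have K: "hopf_superalgebra K" and g: "grouplike K g" "mult K g g = unity K"
    and conj: "\<And>i x. x \<in> grade K i \<Longrightarrow> conj_by K g x = parity_sign i *\<^sub>C x"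
    using assms by (auto simp: super_pairs_def)
  have alg: "algebra_axioms K" and coalg: "coalgebra_axioms K" and anti: "antipode_axioms K"
    and bialg: "bialgebra_axioms (super_mult2 K) K" and grading: "is_grading (grade K)"
    using K by (auto simp: hopf_superalgebra_def)
  interpret parity_algebra "mult K" "unity K" g
    using alg g by (simp add: algebra_axioms_iff parity_algebra_def parity_algebra_axioms_def)
  interpret A: involution A by (rule involution_A)
  have A: "A x = parity_sign i *\<^sub>C x" if "x \<in> grade K i" for x i
    using conj[OF that] conj_by_ad[OF complex_algebra_axioms square] by simp
  show grade: "grade K = eigen_grading A"
  proof (intro ext set_eqI iffI)
    fix i x
    show "x \<in> eigen_grading A i" if "x \<in> grade K i"
      using A[OF that] by (simp add: eigen_grading_def)
    assume x: "x \<in> eigen_grading A i"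
    obtain y z where yz: "y \<in> grade K 0" "z \<in> grade K 1" "x = y + z"
      using grading unfolding is_grading_def by blast
    note hom = A.parity_part_homogeneous[OF A[OF yz(1)]] A.parity_part_homogeneous[OF A[OF yz(2)]]
    have "x = parity_part A i x"
      using x A.parity_part_homogeneous[of x i i] by (simp add: eigen_grading_def)
    also have "\<dots> = parity_part A i y + parity_part A i z"
      unfolding yz(3) by (rule clinear_add[OF A.clinear_parity_part[OF clinear_ident]])
    finally show "x \<in> grade K i"
      using yz by (cases "i = 0") (simp_all add: hom)
  qed
  have mult: "comult K (mult K x y) = sm2 (comult K x) (comult K y)" for x y
    using bialg by (simp add: bialgebra_axioms_def grade)
  have g_even: "A g = parity_sign 0 *\<^sub>C g" by (simp add: scaleC_one)
  have right: "sm2 t (g \<otimes> g) = m2 t (g \<otimes> g)" for t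
  proof (rule tensor_homogeneous_eqI[OF involution_A involution_A, where t = t])
    fix a b i j assume "A b = parity_sign j *\<^sub>C b"
    from super2_homogeneous[OF g_even this] show "sm2 (a \<otimes> b) (g \<otimes> g) = m2 (a \<otimes> b) (g \<otimes> g)"
      by (simp add: mult2_tensor scaleC_one)
  qed (intro multilinear)+
  have left: "sm2 (g \<otimes> g) t = m2 (g \<otimes> g) t" for t
  proof (rule tensor_homogeneous_eqI[OF involution_A involution_A, where t = t])
    fix a b i j assume "A a = parity_sign i *\<^sub>C a"
    from super2_homogeneous[OF this g_even] show "sm2 (g \<otimes> g) (a \<otimes> b) = m2 (g \<otimes> g) (a \<otimes> b)"
      by (simp add: mult2_tensor scaleC_one)
  qed (intro multilinear)+
  have "counit K (mult K x y) = counit K x * counit K y" for x y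
    using bialg by (simp add: bialgebra_axioms_def)
  then show "twistable K g"
    using alg coalg anti g counit_grouplike[OF coalg g(1)] mult left right
    by (simp add: twistable_def grouplike_def)
qed

lemma superize_twist:
  assumes "(K, g) \<in> super_pairs"
  shows "(twist_hopf K g, g) \<in> hopf_pairs" and "superize (twist_hopf K g) g = K"
proof -
  note tw = super_pair_twistable[OF assms]
  interpret twistable_hopf K g by (rule twistable_hopf.intro[OF tw(1)])
  note tw' = twistable_twist
  show eq: "superize (twist_hopf K g) g = K"
    by (rule super_hopf_eqI)
      (simp_all add: truncate_superize[OF tw'] twist_twist grade_superize[OF tw'] tw(2))
  have "hopf_superalgebra K" "g \<noteq> 0"
    using assms by (auto simp: super_pairs_def grouplike_def)
  then have "bialgebra_axioms (hopf_mult2 (twist_hopf K g)) (twist_hopf K g)"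
    using superize_axioms(4)[OF tw'] by (simp add: eq hopf_superalgebra_def)
  with tw' \<open>g \<noteq> 0\<close> show "(twist_hopf K g, g) \<in> hopf_pairs"
    unfolding hopf_pairs_def hopf_algebra_def grouplike_def twistable_def by simp
qed

lemma bij_betw_superize: "bij_betw (\<lambda>(H, u). (superize H u, u)) hopf_pairs super_pairs"
  by (rule bij_betw_byWitness[where f' = "\<lambda>(K, g). (twist_hopf K g, g)"])
    (auto simp: twist_superize twistable_hopf_pair superize_twist superize_in_super_pairs)

section \<open>Naturality\<close>

lemma ad_natural:
  "hopf_iso f H K \<Longrightarrow> f u = v \<Longrightarrow> f (ad (mult H) u x) = ad (mult K) v (f x)"
  by (auto simp: hopf_iso_def ad_def)

lemma parity_part_natural:
  assumes "clinear f" "\<And>x. f (B x) = C (f x)"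
  shows "f (parity_part B i x) = parity_part C i (f x)"
  by (simp add: parity_part_def clinear_add[OF assms(1)] clinear_scaleC[OF assms(1)] assms(2))

lemma bosonize_hopf_iso:
  assumes H: "twistable H u" and K: "twistable K v" and f: "hopf_iso f H K" "f u = v"
  shows "tensor_map f f (bosonize (mult H) u (ad (mult H) u) t) =
    bosonize (mult K) v (ad (mult K) v) (tensor_map f f t)"
proof -
  interpret H: twistable_hopf H u by (rule twistable_hopf.intro[OF H])
  interpret K: twistable_hopf K v by (rule twistable_hopf.intro[OF K])
  have lin: "clinear f" and mult: "f (mult H x y) = mult K (f x) (f y)" and unity: "f (unity H) = unity K" for x y
    using f by (auto simp: hopf_iso_def)
  show ?thesis
  proof (rule tensor_homogeneous_eqI[OF H.involution_A H.involution_A, where t = t])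
    fix a b i j
    assume b: "H.A b = parity_sign j *\<^sub>C b"
    then have fb: "K.A (f b) = parity_sign j *\<^sub>C f b"
      by (simp add: clinear_scaleC[OF lin] flip: ad_natural[OF f])
    have "f (H.pow j) = K.pow j" by (simp add: H.pow_def K.pow_def unity f(2))
    then show "tensor_map f f (H.\<theta> (a \<otimes> b)) = K.\<theta> (tensor_map f f (a \<otimes> b))"
      by (simp add: H.theta_homogeneous[OF b] K.theta_homogeneous[OF fb] tensor_map_tensor lin mult)
  qed (intro multilinear H.clinear_theta K.clinear_theta lin)+
qed

lemma twist_hopf_iso:
  assumes H: "twistable H u" and K: "twistable K v" and f: "hopf_iso f H K" "f u = v"
  shows "hopf_iso f (twist_hopf H u) (twist_hopf K v)"
proof -
  have lin: "clinear f" using f by (simp add: hopf_iso_def)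
  have part: "f (parity_part (ad (mult H) u) i x) = parity_part (ad (mult K) v) i (f x)" for i x
    by (rule parity_part_natural) (rule lin ad_natural[OF f])+
  show ?thesis
    using f bosonize_hopf_iso[OF H K f]
    by (simp add: hopf_iso_def part[symmetric] clinear_add[OF lin])
qed

text \<open>
  The converse direction follows from the first one, as the twist of the superization is
  the original Hopf algebra; the gradings correspond because an isomorphism carries conjugation by
  \<open>u\<close> to conjugation by \<open>v\<close>.
\<close>

lemma superize_iso_iff:
  assumes H: "(H, u) \<in> hopf_pairs" and K: "(K, v) \<in> hopf_pairs" and f: "f u = v"
  shows "super_hopf_iso f (superize H u) (superize K v) \<longleftrightarrow> hopf_iso f H K"
proof
  note tw = twistable_hopf_pair[OF H] twistable_hopf_pair[OF K]
  note tw' = super_pair_twistable(1)[OF superize_in_super_pairs[OF H]]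
    super_pair_twistable(1)[OF superize_in_super_pairs[OF K]]
  show "hopf_iso f H K" if "super_hopf_iso f (superize H u) (superize K v)"
    using twist_hopf_iso[where f = f and u = u and v = v, OF tw' _ f] that by (simp add: super_hopf_iso_def twist_superize tw)
  assume iso: "hopf_iso f H K"
  then have lin: "clinear f" and bij: "bij f" by (simp_all add: hopf_iso_def)
  have "hopf_iso f (superize H u) (superize K v)"
    using twist_hopf_iso[OF tw iso f] truncate_superize[OF tw(1)] truncate_superize[OF tw(2)]
    by (metis axioms_truncate(6))
  moreover have "f ` grade (superize H u) i = grade (superize K v) i" for i
  proof -
    have "x \<in> eigen_grading (ad (mult H) u) i \<longleftrightarrow> f x \<in> eigen_grading (ad (mult K) v) i" for x
      by (simp add: eigen_grading_def ad_natural[OF iso f, symmetric] clinear_scaleC[OF lin, symmetric]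
        bij_is_inj[OF bij] inj_eq)
    then show ?thesis
      unfolding grade_superize[OF tw(1)] grade_superize[OF tw(2)]
      using bij_is_surj[OF bij] by (auto, metis imageI surjD)
  qed
  ultimately show "super_hopf_iso f (superize H u) (superize K v)"
    by (simp add: super_hopf_iso_def)
qed

section \<open>The correspondence of triangular structures\<close>

text \<open>
  \<open>R' = \<theta>(J R)\<close> and, \<open>\<theta>\<close> and \<open>J\<close> being of order two, its inverse \<open>R = J \<theta>(R')\<close>.
\<close>

definition superize_R :: "'a::complex_vector hopf \<Rightarrow> 'a \<Rightarrow> 'a \<otimes> 'a \<Rightarrow> 'a \<otimes> 'a" where
  "superize_R H u R = bosonize (mult H) u (ad (mult H) u) (hopf_mult2 H (parity_algebra.J (unity H) u) R)"

definition unsuperize_R :: "'a::complex_vector hopf \<Rightarrow> 'a \<Rightarrow> 'a \<otimes> 'a \<Rightarrow> 'a \<otimes> 'a" where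
  "unsuperize_R H u Q = hopf_mult2 H (parity_algebra.J (unity H) u) (bosonize (mult H) u (ad (mult H) u) Q)"

lemma unsuperize_superize_R:
  assumes "twistable H u"
  shows "unsuperize_R H u (superize_R H u R) = R" "superize_R H u (unsuperize_R H u Q) = Q"
proof -
  interpret twistable_hopf H u by (rule twistable_hopf.intro[OF assms])
  interpret T: complex_algebra m2 "e \<otimes> e" by (rule algebra2)
  show "unsuperize_R H u (superize_R H u R) = R" "superize_R H u (unsuperize_R H u Q) = Q"
    by (simp_all add: unsuperize_R_def superize_R_def theta_theta J_square flip: T.assoc)
qed

lemma superize_R_natural:
  assumes H: "twistable H u" and K: "twistable K v" and f: "hopf_iso f H K" "f u = v"
  shows "tensor_map f f (superize_R H u R) = superize_R K v (tensor_map f f R)"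
proof -
  interpret H: twistable_hopf H u by (rule twistable_hopf.intro[OF H])
  interpret K: twistable_hopf K v by (rule twistable_hopf.intro[OF K])
  have lin: "clinear f" and mult: "\<And>x y. f (mult H x y) = mult K (f x) (f y)"
    and unity: "f (unity H) = unity K"
    using f by (auto simp: hopf_iso_def)
  have lin2: "clinear (tensor_map f f)" by (intro multilinear lin)
  have "tensor_map f f H.J = K.J"
    by (simp add: H.J_def K.J_def clinear_add[OF lin2] clinear_diff[OF lin2] clinear_scaleC[OF lin2]
      tensor_map_tensor lin unity f(2))
  moreover have "tensor_map f f (H.m2 s t) = K.m2 (tensor_map f f s) (tensor_map f f t)" for s t
    by (rule tensor_map_mult) (rule H.bilinear K.bilinear lin mult)+
  ultimately show ?thesis
    by (simp add: superize_R_def bosonize_hopf_iso[OF H K f])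
qed

lemma drinfeld_natural:
  assumes "algebra_axioms H" "algebra_axioms K" "clinear (antipode H)" "clinear (antipode K)"
    and f: "hopf_iso f H K"
  shows "f (drinfeld H R) = drinfeld K (tensor_map f f R)"
proof -
  have lin: "clinear f" and mult: "\<And>x y. f (mult H x y) = mult K (f x) (f y)"
    and anti: "\<And>x. antipode K (f x) = f (antipode H x)"
    using f by (auto simp: hopf_iso_def)
  have bil: "cbilinear (mult H)" "cbilinear (mult K)"
    using assms(1,2) by (auto simp: algebra_axioms_def)
  show ?thesis
    unfolding drinfeld_def
  proof (rule tensor_eqI[where t = R])
    show "f (tensor_lift (mult H) (flip (tensor_map id (antipode H) (a \<otimes> b)))) =
      tensor_lift (mult K) (flip (tensor_map id (antipode K) (tensor_map f f (a \<otimes> b))))" for a b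
      by (simp add: tensor_map_tensor lin clinear_id assms flip_tensor tensor_lift_tensor bil mult anti)
  qed (intro multilinear clinear_compose[OF lin] lin bil assms)+
qed

lemma super_triangular_superize_iff:
  assumes pair: "(H, u) \<in> hopf_pairs"
    and even: "tensor_map (ad (mult H) u) (ad (mult H) u) R = R"
  shows "super_triangular (superize H u) (superize_R H u R) \<longleftrightarrow> triangular H R"
    and "drinfeld H R = mult H (super_drinfeld (superize H u) (superize_R H u R)) u"
proof -
  note tw = twistable_hopf_pair[OF pair]
  interpret twistable_hopf H u by (rule twistable_hopf.intro[OF tw])
  have H: "hopf_algebra H" using pair by (auto simp: hopf_pairs_def)
  interpret B: parity_bialgebra "mult H" "unity H" u "comult H"
    using H linear_D D_u
    by (intro parity_bialgebra.intro parity_bialgebra_axioms.intro parity_algebra_axioms)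
      (auto simp: hopf_algebra_def bialgebra_axioms_def)
  note R' = superize_R_def[of H u R]
  have comult: "comult (superize H u) = B.D'"
    by (rule ext) (simp add: superize_simps[OF tw] B.D'_def)
  have "superize_R H u R \<in> tensor_grading (eigen_grading A) (eigen_grading A) 0"
    unfolding tensor_grading_eigen[OF involution_A involution_A]
    by (simp add: eigen_grading_def B.even_R'[OF even R'] scaleC_one)
  moreover have "hopf_superalgebra (superize H u)"
    using superize_in_super_pairs[OF pair] by (simp add: super_pairs_def)
  ultimately show "super_triangular (superize H u) (superize_R H u R) \<longleftrightarrow> triangular H R"
    using H unfolding super_triangular_def triangular_def triangular_axioms_def
      leg12_def leg13_def leg23_def superize_simps(1,2,4,5)[OF tw] grade_superize[OF tw] comult
      B.super_quasitriangular_iff[OF even R'] B.super_comult_left_iff[OF even R']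
      B.super_comult_right_iff[OF even R'] B.super_symmetric_iff[OF even R'] by simp
  show "drinfeld H R = mult H (super_drinfeld (superize H u) (superize_R H u R)) u"
    unfolding drinfeld_def super_drinfeld_def superize_simps(1,5)[OF tw] grade_superize[OF tw]
    by (rule B.drinfeld_twist[OF even R' linear_S S_mult_u S_u_mult]) simp
qed

text \<open>
  The Drinfeld element is grouplike, so the axiom on \<open>flip(\<Delta>(h)) R\<close> for \<open>h = u\<close> says that \<open>R\<close>
  commutes with \<open>u \<otimes> u\<close>; that is, \<open>R\<close> is even for the grading defined by \<open>u\<close>.
\<close>

lemma triangular_hopf_pair:
  assumes "(H, R) \<in> triangular_hopfs"
  shows "(H, drinfeld H R) \<in> hopf_pairs"
    and "tensor_map (ad (mult H) (drinfeld H R)) (ad (mult H) (drinfeld H R)) R = R"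
proof -
  let ?u = "drinfeld H R"
  have tri: "triangular H R" and square: "mult H ?u ?u = unity H"
    using assms by (auto simp: triangular_hopfs_def)
  interpret triangular_hopf H R using tri by (simp add: triangular_hopf_iff)
  have "?u \<noteq> 0" using square e_nonzero cbilinear_zero_left[OF bilinear] by metis
  then have grouplike: "grouplike H ?u"
    by (simp add: grouplike_def drinfeld_eq D_drinfeld)
  then show pair: "(H, ?u) \<in> hopf_pairs"
    using square hopf by (simp add: hopf_pairs_def)
  interpret U: twistable_hopf H ?u
    by (rule twistable_hopf.intro[OF twistable_hopf_pair[OF pair]])
  have "m2 (?u \<otimes> ?u) R = m2 R (?u \<otimes> ?u)"
    using quasi[of ?u] by (simp add: drinfeld_eq D_drinfeld flip_tensor)
  then have "U.A2 R = m2 R (m2 (?u \<otimes> ?u) (?u \<otimes> ?u))"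
    by (simp add: U.conj_u[symmetric] T.assoc)
  then show "U.A2 R = R" by (simp add: mult2_tensor square)
qed

lemma super_triangular_pairs_underlying:
  "(K, Q, g) \<in> super_triangular_pairs \<Longrightarrow> (K, g) \<in> super_pairs"
  by (simp add: super_triangular_pairs_def super_pairs_def super_triangular_def)

definition superize_triangular ::
  "'a::complex_vector hopf \<times> ('a \<otimes> 'a) \<Rightarrow> 'a super_hopf \<times> ('a \<otimes> 'a) \<times> 'a" where
  "superize_triangular = (\<lambda>(H, R). let u = drinfeld H R in (superize H u, superize_R H u R, u))"

lemma superize_triangular_mem:
  assumes HR: "(H, R) \<in> triangular_hopfs"
  shows "superize_triangular (H, R) \<in> super_triangular_pairs"
proof -
  let ?u = "drinfeld H R"
  note pair = triangular_hopf_pair(1)[OF HR]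
  note iff = super_triangular_superize_iff[OF triangular_hopf_pair[OF HR]]
  interpret twistable_hopf H ?u by (rule twistable_hopf.intro[OF twistable_hopf_pair[OF pair]])
  have "super_drinfeld (superize H ?u) (superize_R H ?u R) = unity H"
    using arg_cong[OF iff(2), of "\<lambda>x. mult H x ?u"] by (simp add: assoc square)
  then show ?thesis
    using HR iff(1) superize_in_super_pairs[OF pair]
    by (simp add: superize_triangular_def Let_def super_triangular_pairs_def super_pairs_def
      triangular_hopfs_def superize_simps[OF twistable_hopf_pair[OF pair]])
qed

lemma unsuperize_triangular:
  assumes KQ: "(K, Q, g) \<in> super_triangular_pairs"
  defines "H \<equiv> twist_hopf K g"
  shows "(H, unsuperize_R H g Q) \<in> triangular_hopfs"
    and "superize_triangular (H, unsuperize_R H g Q) = (K, Q, g)"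
proof -
  let ?R = "unsuperize_R H g Q"
  have pair: "(K, g) \<in> super_pairs" and tri: "super_triangular K Q"
    and dr: "super_drinfeld K Q = unity K"
    using KQ by (auto simp: super_triangular_pairs_def super_pairs_def super_triangular_def)
  note Hg = superize_twist[OF pair, folded H_def]
  note tw = twistable_hopf_pair[OF Hg(1)]
  interpret twistable_hopf H g by (rule twistable_hopf.intro[OF tw])
  have Q: "superize_R H g ?R = Q" by (rule unsuperize_superize_R(2)[OF tw])
  interpret B: parity_bialgebra "mult H" "unity H" g "comult H"
    using Hg(1) linear_D D_u
    by (intro parity_bialgebra.intro parity_bialgebra_axioms.intro parity_algebra_axioms)
      (auto simp: hopf_pairs_def hopf_algebra_def bialgebra_axioms_def)
  have "Q \<in> tensor_grading (grade K) (grade K) 0"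
    using tri by (simp add: super_triangular_def)
  then have "A2 Q = Q"
    using tensor_grading_eigen[OF involution_A involution_A] super_pair_twistable(2)[OF pair]
    by (simp add: eigen_grading_def scaleC_one H_def)
  then have even: "A2 ?R = ?R"
    by (simp add: unsuperize_R_def A2_mult A2_theta B.A2_J)
  note iff = super_triangular_superize_iff[OF Hg(1) even, unfolded Q Hg(2)]
  have u: "drinfeld H ?R = g"
    unfolding iff(2) dr using unit_left[of g] by (simp add: H_def)
  show "(H, ?R) \<in> triangular_hopfs"
    using iff(1) tri u square by (simp add: triangular_hopfs_def)
  show "superize_triangular (H, ?R) = (K, Q, g)"
    by (simp add: superize_triangular_def u Q Hg(2))
qed

lemma bij_betw_superize_triangular:
  "bij_betw superize_triangular triangular_hopfs super_triangular_pairs"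
proof (rule bij_betw_byWitness[where f' = "\<lambda>(K, Q, g). (twist_hopf K g, unsuperize_R (twist_hopf K g) g Q)"])
  show "\<forall>x\<in>triangular_hopfs. (case superize_triangular x of
      (K, Q, g) \<Rightarrow> (twist_hopf K g, unsuperize_R (twist_hopf K g) g Q)) = x"
    by (auto simp: superize_triangular_def Let_def unsuperize_superize_R
      twist_superize[OF twistable_hopf_pair[OF triangular_hopf_pair(1)]]
      twistable_hopf_pair[OF triangular_hopf_pair(1)])
qed (auto simp: unsuperize_triangular superize_triangular_mem)

lemma superize_triangular_iso_iff:
  assumes x: "x \<in> triangular_hopfs" and y: "y \<in> triangular_hopfs"
  shows "(x, y) \<in> triangular_iso \<longleftrightarrow> (superize_triangular x, superize_triangular y) \<in> super_triangular_iso"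
proof -
  obtain H R K Q where xy: "x = (H, R)" "y = (K, Q)" by (cases x, cases y)
  let ?u = "drinfeld H R" and ?v = "drinfeld K Q"
  note pair = triangular_hopf_pair(1)[OF x[unfolded xy]] triangular_hopf_pair(1)[OF y[unfolded xy]]
  note tw = twistable_hopf_pair[OF pair(1)] twistable_hopf_pair[OF pair(2)]
  have drinfeld: "f ?u = ?v" if "hopf_iso f H K" "tensor_map f f R = Q" for f
    using drinfeld_natural[of H K f R] tw that by (simp add: twistable_def antipode_axioms_def)
  have R_iff: "tensor_map f f (superize_R H ?u R) = superize_R K ?v Q \<longleftrightarrow> tensor_map f f R = Q"
    if f: "hopf_iso f H K" "f ?u = ?v" for f
    unfolding superize_R_natural[OF tw f]
    by (metis unsuperize_superize_R(1)[OF tw(2)])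
  have "hopf_iso f H K \<and> tensor_map f f R = Q \<longleftrightarrow>
      super_hopf_iso f (superize H ?u) (superize K ?v) \<and>
      tensor_map f f (superize_R H ?u R) = superize_R K ?v Q \<and> f ?u = ?v" for f
    using drinfeld R_iff superize_iso_iff[OF pair] by blast
  then show ?thesis
    using x y superize_triangular_mem
    by (auto simp: xy triangular_iso_def super_triangular_iso_def superize_triangular_def Let_def)
qed

lemma superize_pair_iso_iff:
  assumes "x \<in> hopf_pairs" "y \<in> hopf_pairs"
  shows "(x, y) \<in> hopf_pair_iso \<longleftrightarrow>
    ((\<lambda>(H, u). (superize H u, u)) x, (\<lambda>(H, u). (superize H u, u)) y) \<in> super_pair_iso"
  using assms superize_iso_iff superize_in_super_pairs
  by (cases x, cases y) (auto simp: hopf_pair_iso_def super_pair_iso_def; blast)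

theorem theorem3p3p1:
  shows "bij_betw pair_correspondence
      (hopf_pairs // hopf_pair_iso :: ('a::complex_vector hopf \<times> 'a) set set)
      (super_pairs // super_pair_iso) \<and>
    (\<exists>\<Phi>. bij_betw \<Phi>
        (triangular_hopfs // triangular_iso :: ('a hopf \<times> ('a \<otimes> 'a)) set set)
        (super_triangular_pairs // super_triangular_iso) \<and>
      (\<forall>C \<in> triangular_hopfs // triangular_iso.
        underlying_super_pair (\<Phi> C) = pair_correspondence (attached_pair C)))"
proof (intro conjI exI ballI)
  show "bij_betw pair_correspondence
      (hopf_pairs // hopf_pair_iso :: ('a hopf \<times> 'a) set set) (super_pairs // super_pair_iso)"
    unfolding pair_correspondence_def
    by (rule bij_betw_induced[OF equiv_hopf_pair_iso equiv_super_pair_iso bij_betw_superize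
      superize_pair_iso_iff])
  show "bij_betw (induced super_triangular_iso superize_triangular)
      (triangular_hopfs // triangular_iso :: ('a hopf \<times> ('a \<otimes> 'a)) set set)
      (super_triangular_pairs // super_triangular_iso)"
    by (rule bij_betw_induced[OF equiv_triangular_iso equiv_super_triangular_iso
      bij_betw_superize_triangular superize_triangular_iso_iff])
  fix C :: "('a hopf \<times> ('a \<otimes> 'a)) set"
  assume "C \<in> triangular_hopfs // triangular_iso"
  then obtain H R where HR: "(H, R) \<in> triangular_hopfs" and C: "C = triangular_iso `` {(H, R)}"
    by (auto simp: quotient_def)
  let ?u = "drinfeld H R"
  note pair = triangular_hopf_pair(1)[OF HR]
  have HR_refl: "((H, R), (H, R)) \<in> triangular_iso"
    by (rule equiv_class_self[OF equiv_triangular_iso HR, simplified])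
  have "induced super_triangular_iso superize_triangular C =
      super_triangular_iso `` {superize_triangular (H, R)}"
    unfolding C
  proof (rule induced_class[OF equiv_super_triangular_iso HR_refl])
    show "(superize_triangular (H, R), superize_triangular y) \<in> super_triangular_iso"
      if "((H, R), y) \<in> triangular_iso" for y
      using that superize_triangular_iso_iff[OF HR] equiv_type[OF equiv_triangular_iso] by blast
  qed
  then have "underlying_super_pair (induced super_triangular_iso superize_triangular C) =
      underlying_super_pair (super_triangular_iso `` {(superize H ?u, superize_R H ?u R, ?u)})"
    by (simp add: superize_triangular_def Let_def)
  also have "\<dots> = super_pair_iso `` {(superize H ?u, ?u)}"
  proof -
    let ?x = "(superize H ?u, superize_R H ?u R, ?u)"
    have "?x \<in> super_triangular_pairs"
      using superize_triangular_mem[OF HR] by (simp add: superize_triangular_def Let_def)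
    then have "(?x, ?x) \<in> super_triangular_iso"
      using equiv_class_self[OF equiv_super_triangular_iso] by blast
    moreover have "((\<lambda>(H, R, g). (H, g)) ?x, (\<lambda>(H, R, g). (H, g)) y) \<in> super_pair_iso"
      if "(?x, y) \<in> super_triangular_iso" for y :: "'a super_hopf \<times> ('a \<otimes> 'a) \<times> 'a"
    proof (cases y)
      case (fields K Q k)
      with that show ?thesis
        using super_triangular_pairs_underlying by (auto simp: super_triangular_iso_def super_pair_iso_def)
    qed
    ultimately show ?thesis
      unfolding underlying_super_pair_def
      using induced_class[OF equiv_super_pair_iso, of ?x super_triangular_iso "\<lambda>(H, R, g). (H, g)"]
      by simp
  qed
  also have "\<dots> = pair_correspondence (hopf_pair_iso `` {(H, ?u)})"
  proof -
    have "((H, ?u), (H, ?u)) \<in> hopf_pair_iso"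
      using equiv_class_self[OF equiv_hopf_pair_iso pair] by blast
    from induced_class[OF equiv_super_pair_iso this, of "\<lambda>(H, u). (superize H u, u)"]
    show ?thesis
      unfolding pair_correspondence_def
      using superize_pair_iso_iff[OF pair] equiv_type[OF equiv_hopf_pair_iso] by auto
  qed
  also have "hopf_pair_iso `` {(H, ?u)} = attached_pair C"
    unfolding attached_pair_def C
  proof (subst induced_class[OF equiv_hopf_pair_iso HR_refl])
    fix y assume y: "((H, R), y) \<in> triangular_iso"
    obtain K Q where KQ: "y = (K, Q)" by (cases y)
    obtain f where f: "hopf_iso f H K" "tensor_map f f R = Q" and mem: "(K, Q) \<in> triangular_hopfs"
      using y by (auto simp: KQ triangular_iso_def)
    note pairK = triangular_hopf_pair(1)[OF mem]
    have "f ?u = drinfeld K Q"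
      using drinfeld_natural[of H K f R] f twistable_hopf_pair[OF pair] twistable_hopf_pair[OF pairK]
      by (simp add: twistable_def antipode_axioms_def)
    then show "((\<lambda>(H, R). (H, drinfeld H R)) (H, R), (\<lambda>(H, R). (H, drinfeld H R)) y) \<in> hopf_pair_iso"
      using f pair pairK by (auto simp: KQ hopf_pair_iso_def)
  qed simp
  finally show "underlying_super_pair (induced super_triangular_iso superize_triangular C) =
      pair_correspondence (attached_pair C)" .
qed

end
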